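(* Let $d\in\{1,2,3\}$, let $\Omega\subset\mathbb R^d$ be a bounded domain, $\delta>0$, and let $\phi_g$ be the positive ground state of $E_\Omega$ (box potential; see context), depending on $\beta$ and $\delta$. (1) If $\beta\to+\infty$ and $\delta=o(\beta)$, then $|\phi_g|^2\to\rho_\infty=|\phi_\infty|^2$ in $L^2(\Omega)$, where $\phi_\infty$ is the unique nonnegative minimizer of $E_b(\phi)=\int_\Omega\frac12|\phi|^4\,d\mathbf x$ with $\|\phi\|_{L^2(\Omega)}^2=1$. More precisely, $\rho_\infty=\frac1{|\Omega|}$, where $|\Omega|$ is the volume of $\Omega$. (2) If $\beta\to+\infty$ and $\lim_{\beta\to+\infty}\delta/\beta=\delta_\infty$ for some $\delta_\infty>0$, then $|\phi_g|^2\to\rho_\infty$ in $H^1(\Omega)$, where $\rho_\infty$ is the unique nonnegative minimizer of $$E_{bd}^+(\sqrt\rho)=\int_\Omega\Big[\tfrac12|\rho|^2+\tfrac{\delta_\infty}2|\nabla\rho|^2\Big]d\mathbf x,\qquad \rho\ge0,\quad\int_\Omega\rho\,d\mathbf x=1 .$$ Moreover, $\rho=\rho_\infty\ge0$ satisfies $\rho-\delta_\infty\Delta\rho=2E_{bd}^+(\sqrt\rho)$ in $\Omega$ and $\rho|_{\partial\Omega}=0$. (3) If $\beta\to+\infty$, $\delta\to+\infty$ and $\beta=o(\delta)$, then $|\phi_g|^2\to\rho_\infty$ in $H^1(\Omega)$, where $\rho_\infty$ is the unique nonnegative minimizer of $$E_d(\sqrt\rho)=\int_\Omega\tfrac12|\nabla\rho|^2\,d\mathbf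 x,\qquad \rho\ge0,\quad\int_\Omega\rho\,d\mathbf x=1 .$$ Moreover, $\rho=\rho_\infty\ge0$ satisfies $-\Delta\rho=2E_d(\sqrt\rho)$ in $\Omega$ and $\rho|_{\partial\Omega}=0$.
   Context: The box potential is $V=0$ in $\Omega$ and $V=+\infty$ outside $\Omega$; wave functions satisfy zero Dirichlet boundary conditions on $\partial\Omega$. The energy is $$E_\Omega(\phi)=\int_\Omega\Big[\tfrac12|\nabla\phi|^2+\tfrac\beta2|\phi|^4+\tfrac\delta2\big|\nabla|\phi|^2\big|^2\Big]d\mathbf x,$$ and a ground state is a minimizer of $E_\Omega$ among $\phi\in H_0^1(\Omega)$ with $\|\phi\|_{L^2(\Omega)}=1$ and finite energy. "Domain" means connected open set. The functionals $E_{bd}^+$ and $E_d$ are minimized over $\rho\in H_0^1(\Omega)$ with the stated constraints; $E_b$ is minimized over $\phi\in L^4(\Omega)$ with the stated constraint. *)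

theory Defs
  imports "HOL-Analysis.Analysis" "HOL-Library.Landau_Symbols"
begin

text \<open>Functions on \<open>\<Omega>\<close> are total functions whose values outside \<open>\<Omega>\<close> are irrelevant; they are
  identified when they agree almost everywhere on \<open>\<Omega>\<close>. The Sobolev notions are generic in the
  codomain, which is used both for complex wave functions \<open>\<phi>\<close> and for real densities \<open>\<rho>\<close>.\<close>

definition pd :: "'a::euclidean_space \<Rightarrow> ('a \<Rightarrow> 'b::real_normed_vector) \<Rightarrow> 'a \<Rightarrow> 'b" where
  "pd b f x = frechet_derivative f (at x) b"

primrec Ck :: "nat \<Rightarrow> ('a::euclidean_space \<Rightarrow> 'b::real_normed_vector) \<Rightarrow> bool" where
  "Ck 0 f \<longleftrightarrow> continuous_on UNIV f"
| "Ck (Suc k) f \<longleftrightarrow> (\<forall>x. f differentiable (at x)) \<and> (\<forall>b\<in>Basis. Ck k (pd b f))"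

text \<open>Elements of \<open>C\<^sub>c\<^sup>\<infinity>(\<Omega>)\<close>, extended by zero.\<close>

definition test_function ::
    "'a::euclidean_space set \<Rightarrow> ('a \<Rightarrow> 'b::real_normed_vector) \<Rightarrow> bool" where
  "test_function \<Omega> \<psi> \<longleftrightarrow>
     (\<forall>k. Ck k \<psi>) \<and> compact (closure {x. \<psi> x \<noteq> 0}) \<and> closure {x. \<psi> x \<noteq> 0} \<subseteq> \<Omega>"

definition Lp :: "nat \<Rightarrow> 'a::euclidean_space set \<Rightarrow> ('a \<Rightarrow> 'b::euclidean_space) \<Rightarrow> bool" where
  "Lp p \<Omega> u \<longleftrightarrow> u \<in> borel_measurable (lebesgue_on \<Omega>) \<and>
     integrable (lebesgue_on \<Omega>) (\<lambda>x. norm (u x) ^ p)"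

definition loc_integrable :: "'a::euclidean_space set \<Rightarrow> ('a \<Rightarrow> 'b::euclidean_space) \<Rightarrow> bool" where
  "loc_integrable \<Omega> u \<longleftrightarrow> (\<forall>K. compact K \<and> K \<subseteq> \<Omega> \<longrightarrow> integrable (lebesgue_on K) u)"

definition has_weak_pd :: "'a::euclidean_space set \<Rightarrow> 'a \<Rightarrow> ('a \<Rightarrow> 'b::euclidean_space)
    \<Rightarrow> ('a \<Rightarrow> 'b) \<Rightarrow> bool" where
  "has_weak_pd \<Omega> b u g \<longleftrightarrow> loc_integrable \<Omega> u \<and> loc_integrable \<Omega> g \<and>
     (\<forall>\<psi>::'a \<Rightarrow> real. test_function \<Omega> \<psi> \<longrightarrow>
        (LINT x|lebesgue_on \<Omega>. pd b \<psi> x *\<^sub>R u x) = - (LINT x|lebesgue_on \<Omega>. \<psi> x *\<^sub>R g x))"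

definition has_weak_laplacian ::
    "'a::euclidean_space set \<Rightarrow> ('a \<Rightarrow> real) \<Rightarrow> ('a \<Rightarrow> real) \<Rightarrow> bool" where
  "has_weak_laplacian \<Omega> u g \<longleftrightarrow> loc_integrable \<Omega> u \<and> loc_integrable \<Omega> g \<and>
     (\<forall>\<psi>. test_function \<Omega> \<psi> \<longrightarrow>
        (LINT x|lebesgue_on \<Omega>. (\<Sum>b\<in>Basis. pd b (pd b \<psi>) x) * u x) =
        (LINT x|lebesgue_on \<Omega>. \<psi> x * g x))"

definition weakly_differentiable ::
    "'a::euclidean_space set \<Rightarrow> ('a \<Rightarrow> 'b::euclidean_space) \<Rightarrow> bool" where
  "weakly_differentiable \<Omega> u \<longleftrightarrow> (\<forall>b\<in>Basis. \<exists>g. has_weak_pd \<Omega> b u g)"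

text \<open>Weak derivatives are determined almost everywhere on \<open>\<Omega>\<close>. \<open>weak_pd\<close> picks a representative,
  and is meaningful only for weakly differentiable functions.\<close>

definition weak_pd :: "'a::euclidean_space set \<Rightarrow> 'a \<Rightarrow> ('a \<Rightarrow> 'b::euclidean_space) \<Rightarrow> 'a \<Rightarrow> 'b" where
  "weak_pd \<Omega> b u = (SOME g. has_weak_pd \<Omega> b u g)"

text \<open>The function \<open>\<bar>\<nabla>u\<bar>\<^sup>2\<close>.\<close>

definition grad_sq :: "'a::euclidean_space set \<Rightarrow> ('a \<Rightarrow> 'b::euclidean_space) \<Rightarrow> 'a \<Rightarrow> real" where
  "grad_sq \<Omega> u x = (\<Sum>b\<in>Basis. (norm (weak_pd \<Omega> b u x))\<^sup>2)"

definition H1 :: "'a::euclidean_space set \<Rightarrow> ('a \<Rightarrow> 'b::euclidean_space) \<Rightarrow> bool" where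
  "H1 \<Omega> u \<longleftrightarrow> Lp 2 \<Omega> u \<and> (\<forall>b\<in>Basis. \<exists>g. Lp 2 \<Omega> g \<and> has_weak_pd \<Omega> b u g)"

definition L2_norm :: "'a::euclidean_space set \<Rightarrow> ('a \<Rightarrow> 'b::euclidean_space) \<Rightarrow> real" where
  "L2_norm \<Omega> u = sqrt (LINT x|lebesgue_on \<Omega>. (norm (u x))\<^sup>2)"

definition H1_norm :: "'a::euclidean_space set \<Rightarrow> ('a \<Rightarrow> 'b::euclidean_space) \<Rightarrow> real" where
  "H1_norm \<Omega> u = sqrt ((LINT x|lebesgue_on \<Omega>. (norm (u x))\<^sup>2) + (LINT x|lebesgue_on \<Omega>. grad_sq \<Omega> u x))"

text \<open>The membership conditions are needed because a non-integrable function has integral zero.\<close>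

definition L2_tendsto :: "'a::euclidean_space set \<Rightarrow> ('i \<Rightarrow> 'a \<Rightarrow> 'b::euclidean_space) \<Rightarrow> ('a \<Rightarrow> 'b)
    \<Rightarrow> 'i filter \<Rightarrow> bool" where
  "L2_tendsto \<Omega> u v F \<longleftrightarrow> (\<forall>\<^sub>F i in F. Lp 2 \<Omega> (u i)) \<and> Lp 2 \<Omega> v \<and>
     ((\<lambda>i. L2_norm \<Omega> (\<lambda>x. u i x - v x)) \<longlongrightarrow> 0) F"

definition H1_tendsto :: "'a::euclidean_space set \<Rightarrow> ('i \<Rightarrow> 'a \<Rightarrow> 'b::euclidean_space) \<Rightarrow> ('a \<Rightarrow> 'b)
    \<Rightarrow> 'i filter \<Rightarrow> bool" where
  "H1_tendsto \<Omega> u v F \<longleftrightarrow> (\<forall>\<^sub>F i in F. H1 \<Omega> (u i)) \<and> H1 \<Omega> v \<and>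
     ((\<lambda>i. H1_norm \<Omega> (\<lambda>x. u i x - v x)) \<longlongrightarrow> 0) F"

text \<open>\<open>H\<^sub>0\<^sup>1(\<Omega>)\<close>: the closure of \<open>C\<^sub>c\<^sup>\<infinity>(\<Omega>)\<close> in \<open>H\<^sup>1(\<Omega>)\<close>. On a domain without boundary regularity
  this is the meaning of vanishing on \<open>\<partial>\<Omega>\<close>.\<close>

definition H10 :: "'a::euclidean_space set \<Rightarrow> ('a \<Rightarrow> 'b::euclidean_space) \<Rightarrow> bool" where
  "H10 \<Omega> u \<longleftrightarrow> (\<exists>\<psi>. (\<forall>n::nat. test_function \<Omega> (\<psi> n)) \<and> H1_tendsto \<Omega> \<psi> u sequentially)"

definition abs_sq :: "('a \<Rightarrow> complex) \<Rightarrow> 'a \<Rightarrow> real" where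
  "abs_sq \<phi> x = (cmod (\<phi> x))\<^sup>2"

definition energy ::
    "'a::euclidean_space set \<Rightarrow> real \<Rightarrow> real \<Rightarrow> ('a \<Rightarrow> complex) \<Rightarrow> real" where
  "energy \<Omega> \<beta> \<delta> \<phi> = (LINT x|lebesgue_on \<Omega>.
     1/2 * grad_sq \<Omega> \<phi> x + \<beta>/2 * cmod (\<phi> x) ^ 4 + \<delta>/2 * grad_sq \<Omega> (abs_sq \<phi>) x)"

text \<open>For \<open>\<phi>\<close> in \<open>H\<^sub>0\<^sup>1(\<Omega>)\<close> the Dirichlet term is finite, and \<open>\<bar>\<phi>\<bar>\<^sup>2\<close> is always weakly
  differentiable with integrable gradient; the real content of the last condition is that this
  gradient is square integrable.\<close>

definition finite_energy :: "'a::euclidean_space set \<Rightarrow> ('a \<Rightarrow> complex) \<Rightarrow> bool" where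
  "finite_energy \<Omega> \<phi> \<longleftrightarrow> integrable (lebesgue_on \<Omega>) (grad_sq \<Omega> \<phi>) \<and> Lp 4 \<Omega> \<phi> \<and>
     weakly_differentiable \<Omega> (abs_sq \<phi>) \<and> integrable (lebesgue_on \<Omega>) (grad_sq \<Omega> (abs_sq \<phi>))"

definition admissible :: "'a::euclidean_space set \<Rightarrow> ('a \<Rightarrow> complex) \<Rightarrow> bool" where
  "admissible \<Omega> \<phi> \<longleftrightarrow> H10 \<Omega> \<phi> \<and> L2_norm \<Omega> \<phi> = 1 \<and> finite_energy \<Omega> \<phi>"

definition ground_state ::
    "'a::euclidean_space set \<Rightarrow> real \<Rightarrow> real \<Rightarrow> ('a \<Rightarrow> complex) \<Rightarrow> bool" where
  "ground_state \<Omega> \<beta> \<delta> \<phi> \<longleftrightarrow> is_arg_min (energy \<Omega> \<beta> \<delta>) (admissible \<Omega>) \<phi>"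

definition positive_ground_state ::
    "'a::euclidean_space set \<Rightarrow> real \<Rightarrow> real \<Rightarrow> ('a \<Rightarrow> complex) \<Rightarrow> bool" where
  "positive_ground_state \<Omega> \<beta> \<delta> \<phi> \<longleftrightarrow> ground_state \<Omega> \<beta> \<delta> \<phi> \<and>
     (AE x in lebesgue_on \<Omega>. \<phi> x \<in> \<real> \<and> 0 < Re (\<phi> x))"

text \<open>\<open>u\<close> minimizes \<open>E\<close> over all functions satisfying the constraint \<open>P\<close>, and is up to null sets the
  only such minimizer with the additional property \<open>N\<close>; \<open>N\<close> does not restrict the competitors.\<close>

definition unique_minimizer :: "'a::euclidean_space set \<Rightarrow> (('a \<Rightarrow> 'b::euclidean_space) \<Rightarrow> real)
    \<Rightarrow> (('a \<Rightarrow> 'b) \<Rightarrow> bool) \<Rightarrow> (('a \<Rightarrow> 'b) \<Rightarrow> bool) \<Rightarrow> ('a \<Rightarrow> 'b) \<Rightarrow> bool" where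
  "unique_minimizer \<Omega> E P N u \<longleftrightarrow> is_arg_min E P u \<and> N u \<and>
     (\<forall>v. is_arg_min E P v \<and> N v \<longrightarrow> (AE x in lebesgue_on \<Omega>. v x = u x))"

definition nonneg_fun :: "'a::euclidean_space set \<Rightarrow> ('a \<Rightarrow> real) \<Rightarrow> bool" where
  "nonneg_fun \<Omega> \<rho> \<longleftrightarrow> (AE x in lebesgue_on \<Omega>. 0 \<le> \<rho> x)"

definition nonneg_wave :: "'a::euclidean_space set \<Rightarrow> ('a \<Rightarrow> complex) \<Rightarrow> bool" where
  "nonneg_wave \<Omega> \<phi> \<longleftrightarrow> (AE x in lebesgue_on \<Omega>. \<phi> x \<in> \<real> \<and> 0 \<le> Re (\<phi> x))"

definition E_b :: "'a::euclidean_space set \<Rightarrow> ('a \<Rightarrow> complex) \<Rightarrow> real" where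
  "E_b \<Omega> \<phi> = (LINT x|lebesgue_on \<Omega>. 1/2 * cmod (\<phi> x) ^ 4)"

definition admissible_b :: "'a::euclidean_space set \<Rightarrow> ('a \<Rightarrow> complex) \<Rightarrow> bool" where
  "admissible_b \<Omega> \<phi> \<longleftrightarrow> Lp 4 \<Omega> \<phi> \<and> Lp 2 \<Omega> \<phi> \<and> (L2_norm \<Omega> \<phi>)\<^sup>2 = 1"

text \<open>The next two are \<open>E\<^sub>b\<^sub>d\<^sup>+(\<surd>\<rho>)\<close> and \<open>E\<^sub>d(\<surd>\<rho>)\<close> as functionals of \<open>\<rho>\<close>.\<close>

definition E_bd_plus :: "'a::euclidean_space set \<Rightarrow> real \<Rightarrow> ('a \<Rightarrow> real) \<Rightarrow> real" where
  "E_bd_plus \<Omega> \<delta>_inf \<rho> = (LINT x|lebesgue_on \<Omega>. 1/2 * \<bar>\<rho> x\<bar>\<^sup>2 + \<delta>_inf/2 * grad_sq \<Omega> \<rho> x)"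

definition E_d :: "'a::euclidean_space set \<Rightarrow> ('a \<Rightarrow> real) \<Rightarrow> real" where
  "E_d \<Omega> \<rho> = (LINT x|lebesgue_on \<Omega>. 1/2 * grad_sq \<Omega> \<rho> x)"

definition admissible_density :: "'a::euclidean_space set \<Rightarrow> ('a \<Rightarrow> real) \<Rightarrow> bool" where
  "admissible_density \<Omega> \<rho> \<longleftrightarrow> H10 \<Omega> \<rho> \<and> nonneg_fun \<Omega> \<rho> \<and> (LINT x|lebesgue_on \<Omega>. \<rho> x) = 1"

end

theory Submission
  imports Defs
begin

text \<open>
  Write \<open>\<rho> = \<bar>\<phi>\<bar>\<^sup>2\<close>, so that the energy is \<open>1/2 \<integral> \<bar>\<nabla>\<phi>\<bar>\<^sup>2\<close> plus the quadratic form
  \<open>1/2 (\<beta> \<integral> \<rho>\<^sup>2 + \<delta> \<integral> \<bar>\<nabla>\<rho>\<bar>\<^sup>2)\<close> in \<open>\<rho>\<close>. Compare the ground state with a fixed trial function and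
  divide by the diverging parameter: the kinetic term of the trial function disappears, so the
  densities of the ground states are a minimizing sequence for the limit form
  \<open>Q(\<rho>) = s \<integral> \<rho>\<^sup>2 + t \<integral> \<bar>\<nabla>\<rho>\<bar>\<^sup>2\<close>, and for \<open>t > 0\<close> the parallelogram law turns this into convergence
  in \<open>H\<^sup>1\<close>. Here \<open>\<rho> \<in> H\<^sub>0\<^sup>1\<close> on any bounded open set: the saturated densities
  \<open>k (1 - exp (- \<rho> / k))\<close> are limits of test functions and tend to \<open>\<rho>\<close> as \<open>k \<rightarrow> \<infinity>\<close>.
  For \<open>s = 1\<close> and \<open>t = 0\<close> the infimum is \<open>1 / \<bar>\<Omega>\<bar>\<close>, approached by trial functions that tend to a constant.

  The limit \<open>w\<close> is obtained by minimizing \<open>Q\<close> over all signed \<open>\<rho> \<in> H\<^sub>0\<^sup>1\<close> of mass one, where the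
  Euler-Lagrange equation is linear. Both the sign of \<open>w\<close> and the absence of a gap between densities
  \<open>\<rho>\<close> and squares \<open>\<phi>\<^sup>2\<close> come from one smooth approximation: if test functions \<open>\<psi>\<close> tend to \<open>w\<close>, then
  \<open>\<phi> = \<psi> / \<surd>(\<surd>(\<psi>\<^sup>2 + \<epsilon>\<^sup>2) + \<epsilon>)\<close> is a test function, \<open>\<phi>\<^sup>2 = \<surd>(\<psi>\<^sup>2 + \<epsilon>\<^sup>2) - \<epsilon>\<close> has
  \<open>Q(\<phi>\<^sup>2) \<le> Q(\<psi>)\<close>, and its mass tends to \<open>\<integral> \<bar>w\<bar>\<close>; hence \<open>Q(w) (\<integral> \<bar>w\<bar>)\<^sup>2 \<le> Q(w)\<close>, which forces \<open>w \<ge> 0\<close>.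
\<close>

section \<open>Smooth functions and test functions\<close>

text \<open>The square root of a minimizing density may fail to have a square integrable gradient,
  so the limit density need not come from an admissible wave function. Trial states are therefore
  asked to approach it in mass and energy only. The naive choice, the root of a nonnegative test
  function, is not smooth at its zeros, which is why an explicit quotient takes its place. No weak
  compactness is used: the mass constraint is affine and the form quadratic, so minimizing sequences
  are Cauchy as soon as the form controls the norm. For \<open>s = 0\<close> this control is
  Poincare's inequality, which needs zero boundary values. Hence the effort to place densities of
  ground states in \<open>H\<^sub>0\<^sup>1\<close>, where finite energy by itself yields only
  \<open>H\<^sup>1\<close>. For \<open>t = 0\<close> the form sees no gradient and the constant
  limit lies outside \<open>H\<^sub>0\<^sup>1\<close>. With \<open>V\<close> the volume, the exact
  identity \<open>\<parallel>\<rho> - 1/V\<parallel>\<^sup>2 = \<parallel>\<rho>\<parallel>\<^sup>2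
  - 1/V\<close> for unit mass then replaces the parallelogram law.\<close>

lemma pd_eqI: "(f has_derivative f') (at x) \<Longrightarrow> pd b f x = f' b"
  unfolding pd_def using frechet_derivative_at by metis

lemma Ck_imp_continuous: "Ck k f \<Longrightarrow> continuous_on UNIV f"
  by (cases k) (auto simp: continuous_at_imp_continuous_on differentiable_imp_continuous_within)

lemma Ck_Suc_imp: "Ck (Suc k) f \<Longrightarrow> Ck k f"
proof (induction k arbitrary: f)
  case 0
  then show ?case using Ck_imp_continuous by (metis Ck.simps(1))
next
  case (Suc k)
  then show ?case using Ck.simps(2) by blast
qed

lemma Ck_const: "Ck k (\<lambda>x::'a::euclidean_space. c)"
proof (induction k arbitrary: c)
  case (Suc k)
  have "pd b (\<lambda>x::'a. c) = (\<lambda>x. 0)" for b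
    by (intro ext pd_eqI) auto
  with Suc show ?case by simp
qed simp

lemma Ck_linear:
  assumes "bounded_linear L"
  shows "Ck k L"
proof -
  have "(L has_derivative L) (at x)" for x
    by (rule bounded_linear_imp_has_derivative[OF assms])
  moreover from this have "pd b L = (\<lambda>x. L b)" for b
    by (intro ext pd_eqI)
  ultimately show ?thesis
    using assms by (cases k) (auto simp: Ck_const linear_continuous_on differentiable_def)
qed

lemma Ck_add:
  "Ck k u \<Longrightarrow> Ck k v \<Longrightarrow> Ck k (\<lambda>x. u x + v x)"
proof (induction k arbitrary: u v)
  case (Suc k)
  have du: "(u has_derivative frechet_derivative u (at x)) (at x)"
   and dv: "(v has_derivative frechet_derivative v (at x)) (at x)" for x
    using Suc.prems by (auto simp: frechet_derivative_works)
  have "pd b (\<lambda>x. u x + v x) = (\<lambda>x. pd b u x + pd b v x)" for b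
  proof
    show "pd b (\<lambda>x. u x + v x) x = pd b u x + pd b v x" for x
      using pd_eqI[OF has_derivative_add[OF du dv]] by (simp add: pd_def)
  qed
  with Suc show ?case by (auto intro: differentiable_add)
qed (auto intro: continuous_intros)

lemma pd_bilinear:
  assumes h: "bounded_bilinear h" and "u differentiable (at x)" "v differentiable (at x)"
  shows "pd b (\<lambda>x. h (u x) (v x)) x = h (u x) (pd b v x) + h (pd b u x) (v x)"
proof -
  have "(u has_derivative frechet_derivative u (at x)) (at x)"
   and "(v has_derivative frechet_derivative v (at x)) (at x)"
    using assms by (auto simp: frechet_derivative_works)
  from pd_eqI[OF bounded_bilinear.FDERIV[OF h this]] show ?thesis
    by (simp add: pd_def)
qed

lemma pd_lincomb:
  assumes "f differentiable (at x)" "g differentiable (at x)"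
  shows "pd b (\<lambda>x. r *\<^sub>R f x + s *\<^sub>R g x) x = r *\<^sub>R pd b f x + s *\<^sub>R pd b g x"
proof -
  have "(f has_derivative frechet_derivative f (at x)) (at x)"
    "(g has_derivative frechet_derivative g (at x)) (at x)"
    using assms by (auto simp: frechet_derivative_works)
  then have "((\<lambda>x. r *\<^sub>R f x + s *\<^sub>R g x) has_derivative
     (\<lambda>h. r *\<^sub>R frechet_derivative f (at x) h + s *\<^sub>R frechet_derivative g (at x) h)) (at x)"
    by (auto intro!: derivative_eq_intros)
  from pd_eqI[OF this] show ?thesis by (simp add: pd_def)
qed

text \<open>Stated for an arbitrary bounded bilinear map so that one induction on the product rule
  serves real products, \<open>scaleR\<close> and inner products.\<close>

lemma Ck_bilinear:
  assumes h: "bounded_bilinear h"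
  shows "Ck k u \<Longrightarrow> Ck k v \<Longrightarrow> Ck k (\<lambda>x. h (u x) (v x))"
proof (induction k arbitrary: u v)
  case (Suc k)
  have "pd b (\<lambda>x. h (u x) (v x)) = (\<lambda>x. h (u x) (pd b v x) + h (pd b u x) (v x))" for b
    using Suc.prems by (intro ext pd_bilinear[OF h]) auto
  moreover have "(\<lambda>x. h (u x) (v x)) differentiable (at x)" for x
    using Suc.prems bounded_bilinear.FDERIV[OF h] unfolding differentiable_def Ck.simps by blast
  ultimately show ?case
    using Suc Ck_Suc_imp[OF Suc.prems(1)] Ck_Suc_imp[OF Suc.prems(2)] by (auto intro: Ck_add)
qed (auto intro: bounded_bilinear.continuous_on[OF h])

text \<open>Smoothness of the outer function of a composition. It is relative to a set because roots
  are smooth on the positive reals only.\<close>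

primrec Cn_on :: "nat \<Rightarrow> real set \<Rightarrow> (real \<Rightarrow> real) \<Rightarrow> bool" where
  "Cn_on 0 S f \<longleftrightarrow> continuous_on S f"
| "Cn_on (Suc n) S f \<longleftrightarrow>
     (\<exists>f'. (\<forall>x\<in>S. (f has_real_derivative f' x) (at x)) \<and> Cn_on n S f')"

lemma Cn_on_lincomb:
  "Cn_on n S f \<Longrightarrow> Cn_on n S g \<Longrightarrow> Cn_on n S (\<lambda>x. a * f x + b * g x)"
proof (induction n arbitrary: f g)
  case (Suc n)
  then obtain f' g' where *: "\<forall>x\<in>S. (f has_real_derivative f' x) (at x)" "Cn_on n S f'"
     "\<forall>x\<in>S. (g has_real_derivative g' x) (at x)" "Cn_on n S g'" by auto
  have "\<forall>x\<in>S. ((\<lambda>x. a * f x + b * g x) has_real_derivative (a * f' x + b * g' x)) (at x)"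
    using * by (auto intro!: derivative_eq_intros)
  then show ?case using Suc.IH[OF *(2,4)] by auto
qed (auto intro!: continuous_intros)

lemma pd_compose:
  assumes "(f has_real_derivative f') (at (u x))" and "u differentiable (at x)"
  shows "pd b (\<lambda>x. f (u x)) x = f' * pd b u x"
proof -
  have u: "(u has_derivative frechet_derivative u (at x)) (at x)"
    using assms by (auto simp: frechet_derivative_works)
  from pd_eqI[OF has_derivative_compose[OF u has_field_derivative_imp_has_derivative[OF assms(1)]]]
  show ?thesis by (simp add: pd_def)
qed

lemma Ck_compose:
  "Cn_on k S f \<Longrightarrow> Ck k u \<Longrightarrow> (\<And>x. u x \<in> S) \<Longrightarrow> Ck k (\<lambda>x. f (u x))"
proof (induction k arbitrary: f)
  case 0
  have "continuous_on UNIV (f \<circ> u)"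
    using 0 by (intro continuous_on_compose) (auto intro: continuous_on_subset)
  then show ?case by (simp add: comp_def)
next
  case (Suc k)
  then obtain f' where f': "\<forall>x\<in>S. (f has_real_derivative f' x) (at x)" "Cn_on k S f'" by auto
  have "pd b (\<lambda>x. f (u x)) = (\<lambda>x. f' (u x) * pd b u x)" for b
    using f' Suc.prems by (intro ext pd_compose) auto
  moreover have "(\<lambda>x. f (u x)) differentiable (at x)" for x
  proof -
    obtain u' where "(u has_derivative u') (at x)"
      using Suc.prems(2) unfolding Ck.simps differentiable_def by blast
    from has_derivative_compose[OF this] f' Suc.prems
    show ?thesis unfolding differentiable_def has_field_derivative_def by blast
  qed
  moreover have "Ck k (\<lambda>x. f' (u x))"
    using Suc Ck_Suc_imp f' by blast
  ultimately show ?case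
    using Suc.prems by (auto intro!: Ck_bilinear[OF bounded_bilinear_mult])
qed

text \<open>The free coefficient \<open>a\<close> keeps the family closed under differentiation, so
  the induction needs no formula for higher derivatives; \<open>Cn_on_powr\<close> uses the same
  device.\<close>

lemma Cn_on_exp: "Cn_on n UNIV (\<lambda>x. a * exp (c * x))"
proof (induction n arbitrary: a)
  case (Suc n)
  have "((\<lambda>x. a * exp (c * x)) has_real_derivative (a * c) * exp (c * x)) (at x)" for x
    by (auto intro!: derivative_eq_intros)
  with Suc[of "a * c"] show ?case
    unfolding Cn_on.simps by (intro exI[of _ "\<lambda>x. a * c * exp (c * x)"]) blast
qed (auto intro!: continuous_intros)

lemma Cn_on_powr: "Cn_on n {0<..} (\<lambda>x. a * x powr p)"
proof (induction n arbitrary: a p)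
  case (Suc n)
  have "((\<lambda>x. a * x powr p) has_real_derivative (a * p) * x powr (p - 1)) (at x)"
    if "x \<in> {0<..}" for x
    using that by (auto intro!: derivative_eq_intros)
  with Suc[of "a * p" "p - 1"] show ?case
    unfolding Cn_on.simps by (intro exI[of _ "\<lambda>x. a * p * x powr (p - 1)"]) blast
qed (auto intro!: continuous_intros)

text \<open>The family is closed under differentiation up to linear combinations, which gives the
  smoothness of \<open>exp (- 1 / x)\<close> at \<open>0\<close> without computing its derivatives.\<close>

definition flat :: "nat \<Rightarrow> real \<Rightarrow> real" where
  "flat m x = (if 0 < x then exp (- (1 / x)) / x ^ m else 0)"

lemma flat_tendsto_0: "(flat m \<longlongrightarrow> 0) (at 0)"
proof -
  have r: "(flat m \<longlongrightarrow> 0) (at_right 0)"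
  proof -
    \<comment> \<open>With \<open>y = 1 / x\<close> the claim becomes that the exponential outgrows
      every power.\<close>
    have "((\<lambda>y. y ^ m / exp y) \<longlongrightarrow> 0) (at_top :: real filter)"
      by (rule tendsto_power_div_exp_0)
    then have "((\<lambda>x. inverse x ^ m / exp (inverse x)) \<longlongrightarrow> 0) (at_right (0::real))"
      by (rule filterlim_compose[OF _ filterlim_inverse_at_top_right])
    moreover have "\<forall>\<^sub>F x in at_right (0::real). inverse x ^ m / exp (inverse x) = flat m x"
      unfolding eventually_at_filter
      by (auto simp: flat_def exp_minus field_simps intro!: always_eventually)
    ultimately show ?thesis by (rule Lim_transform_eventually)
  qed
  moreover have "(flat m \<longlongrightarrow> 0) (at_left 0)"
    by (rule tendsto_eventually) (auto simp: eventually_at_filter flat_def intro!: always_eventually)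
  ultimately show ?thesis using filterlim_at_split by blast
qed

lemma flat_deriv:
  "(flat m has_real_derivative (- real m) * flat (Suc m) x + 1 * flat (m + 2) x) (at x)"
proof -
  consider "x > 0" | "x < 0" | "x = 0" by linarith
  then show ?thesis
  proof cases
    case 1
    have "((\<lambda>x. exp (- (1 / x)) / x ^ m) has_real_derivative
       (- real m) * flat (Suc m) x + 1 * flat (m + 2) x) (at x)"
    proof -
      \<comment> \<open>The exponent is truncated at \<open>m = 0\<close>; the factor
        \<open>real m\<close> makes the identity true there as well.\<close>
      have m: "real m * x ^ (m - Suc 0) = real m * x ^ m / x"
        using 1 by (cases m) auto
      show ?thesis
        by (rule DERIV_cong[OF DERIV_divide[OF DERIV_fun_exp[OF DERIV_minus[OF DERIV_divide[OF
          DERIV_const DERIV_ident]]] DERIV_pow]])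
           (use 1 m in \<open>auto simp: flat_def field_simps power2_eq_square\<close>)
    qed
    then show ?thesis
      by (rule has_field_derivative_transform_within_open[where S="{0<..}"])
         (use 1 in \<open>auto simp: flat_def\<close>)
  next
    case 2
    have "((\<lambda>x. 0) has_real_derivative (- real m) * flat (Suc m) x + 1 * flat (m + 2) x) (at x)"
      using 2 by (auto simp: flat_def)
    then show ?thesis
      by (rule has_field_derivative_transform_within_open[where S="{..<0}"])
         (use 2 in \<open>auto simp: flat_def\<close>)
  next
    case 3
    \<comment> \<open>At the origin the difference quotient of \<open>flat m\<close> is exactly
      \<open>flat (Suc m)\<close>.\<close>
    have "((\<lambda>h. (flat m h - flat m 0) / (h - 0)) \<longlongrightarrow> 0) (at 0)"
      using flat_tendsto_0[of "Suc m"]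
    proof (rule Lim_transform_eventually)
      show "\<forall>\<^sub>F x in at 0. flat (Suc m) x = (flat m x - flat m 0) / (x - 0)"
        by (auto simp: flat_def eventually_at_filter intro!: always_eventually)
    qed
    with 3 show ?thesis
      by (simp add: has_field_derivative_iff flat_def[of _ 0])
  qed
qed

lemma Cn_on_flat: "Cn_on n UNIV (flat m)"
proof (induction n arbitrary: m)
  case 0
  show ?case
    using flat_deriv by (auto intro!: continuous_at_imp_continuous_on intro: DERIV_isCont)
next
  case (Suc n)
  show ?case unfolding Cn_on.simps
    by (rule exI[of _ "\<lambda>x. (- real m) * flat (Suc m) x + 1 * flat (m + 2) x"])
       (use flat_deriv Cn_on_lincomb[OF Suc Suc] in blast)
qed

lemma Ck_prod:
  assumes "finite A" "\<And>i. i \<in> A \<Longrightarrow> Ck k (f i)"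
  shows "Ck k (\<lambda>x. \<Prod>i\<in>A. f i x :: real)"
  using assms
proof (induction A rule: finite_induct)
  case (insert i A)
  then show ?case by (auto intro: Ck_bilinear[OF bounded_bilinear_mult])
qed (simp add: Ck_const)

section \<open>Closure properties and construction of test functions\<close>

lemma test_functionI:
  assumes "\<And>k. Ck k f" "compact K" "K \<subseteq> \<Omega>" "\<And>x. x \<notin> K \<Longrightarrow> f x = 0"
  shows "test_function \<Omega> f"
proof -
  have "closure {x. f x \<noteq> 0} \<subseteq> K"
    using assms by (intro closure_minimal compact_imp_closed) auto
  moreover from this have "compact (closure {x. f x \<noteq> 0})"
    using assms(2) by (meson compact_imp_bounded bounded_subset closed_closure compact_eq_bounded_closed)
  ultimately show ?thesis using assms by (auto simp: test_function_def)
qed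

lemma test_functionE:
  assumes "test_function \<Omega> f"
  obtains K where "compact K" "K \<subseteq> \<Omega>" "\<And>x. x \<notin> K \<Longrightarrow> f x = 0"
proof (rule that)
  show "f x = 0" if "x \<notin> closure {x. f x \<noteq> 0}" for x
    using that closure_subset[of "{x. f x \<noteq> 0}"] by auto
qed (use assms in \<open>auto simp: test_function_def\<close>)

lemma test_Ck: "test_function \<Omega> f \<Longrightarrow> Ck k f"
  by (simp add: test_function_def)

lemma test_differentiable: "test_function \<Omega> f \<Longrightarrow> f differentiable (at x)"
  using test_Ck[of \<Omega> f "Suc 0"] by simp

lemma test_continuous: "test_function \<Omega> f \<Longrightarrow> continuous_on UNIV f"
  using test_Ck Ck_imp_continuous by blast

text \<open>Products, linear images and compositions inherit compact support through this single
  criterion; only their smoothness remains to be checked.\<close>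

lemma test_zero_imp:
  assumes "test_function \<Omega> f" "\<And>k. Ck k g" "\<And>x. f x = 0 \<Longrightarrow> g x = 0"
  shows "test_function \<Omega> g"
proof -
  obtain K where "compact K" "K \<subseteq> \<Omega>" "\<And>x. x \<notin> K \<Longrightarrow> f x = 0"
    using test_functionE[OF assms(1)] by blast
  then show ?thesis using assms by (intro test_functionI[of g K]) auto
qed

lemma test_pd:
  assumes "test_function \<Omega> f" "b \<in> Basis"
  shows "test_function \<Omega> (pd b f)"
proof -
  obtain K where K: "compact K" "K \<subseteq> \<Omega>" "\<And>x. x \<notin> K \<Longrightarrow> f x = 0"
    using test_functionE[OF assms(1)] by blast
  show ?thesis
  proof (rule test_functionI[OF _ K(1,2)])
    show "Ck k (pd b f)" for k
      using test_Ck[OF assms(1), of "Suc k"] assms(2) by simp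
    show "pd b f x = 0" if "x \<notin> K" for x
    proof -
      have "((\<lambda>x. 0) has_derivative (\<lambda>x. 0)) (at x)" by simp
      then have "(f has_derivative (\<lambda>x. 0)) (at x)"
        by (rule has_derivative_transform_within_open[where s="- K"])
           (use K that in \<open>auto intro: compact_imp_closed\<close>)
      then show ?thesis by (rule pd_eqI)
    qed
  qed
qed

lemma test_add:
  assumes "test_function \<Omega> f" "test_function \<Omega> g"
  shows "test_function \<Omega> (\<lambda>x. f x + g x)"
proof -
  obtain K where K: "compact K" "K \<subseteq> \<Omega>" "\<And>x. x \<notin> K \<Longrightarrow> f x = 0"
    using test_functionE[OF assms(1)] by blast
  obtain K' where K': "compact K'" "K' \<subseteq> \<Omega>" "\<And>x. x \<notin> K' \<Longrightarrow> g x = 0"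
    using test_functionE[OF assms(2)] by blast
  show ?thesis
    using K K' assms by (intro test_functionI[of _ "K \<union> K'"])
      (auto intro!: Ck_add test_Ck[OF assms(1)] test_Ck[OF assms(2)])
qed

lemma test_bilinear:
  assumes "bounded_bilinear h" "test_function \<Omega> f" "\<And>k. Ck k g"
  shows "test_function \<Omega> (\<lambda>x. h (f x) (g x))"
  by (rule test_zero_imp[OF assms(2)])
     (simp_all add: Ck_bilinear[OF assms(1) test_Ck[OF assms(2)] assms(3)]
       bounded_bilinear.zero_left[OF assms(1)])

lemma test_linear:
  assumes "bounded_linear L" "test_function \<Omega> f"
  shows "test_function \<Omega> (\<lambda>x. L (f x))"
proof -
  \<comment> \<open>\<open>L\<close> is read as the bilinear map
    \<open>(y, c) \<mapsto> c *\<^sub>R L y\<close> at the constant \<open>c = 1\<close>, so the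
    product rule applies.\<close>
  have "Ck k (\<lambda>x. L (f x))" for k
    using Ck_bilinear[OF bounded_bilinear.comp1[OF bounded_bilinear.flip[OF bounded_bilinear_scaleR]
      assms(1)]
        test_Ck[OF assms(2)] Ck_const[of k "1::real"]] by simp
  then show ?thesis
    by (rule test_zero_imp[OF assms(2)]) (simp add: linear_0 bounded_linear.linear[OF assms(1)])
qed

lemma test_0: "test_function \<Omega> (\<lambda>x. 0)"
  by (rule test_functionI[of _ "{}"]) (auto simp: Ck_const)

lemma test_sum:
  assumes "finite A" "\<And>i. i \<in> A \<Longrightarrow> test_function \<Omega> (f i)"
  shows "test_function \<Omega> (\<lambda>x. \<Sum>i\<in>A. f i x)"
  using assms
  by (induction A rule: finite_induct) (auto simp: test_0 intro: test_add)

lemma test_compose: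
  assumes "test_function \<Omega> u" "\<And>k. Cn_on k S f" "\<And>x. u x \<in> S" "f 0 = 0"
  shows "test_function \<Omega> (\<lambda>x. f (u x))"
  by (rule test_zero_imp[OF assms(1)])
     (auto intro!: Ck_compose[OF assms(2)] assms test_Ck[OF assms(1)])

text \<open>This bump has no plateau. Its positivity on exactly the open box suffices, since
  \<open>1 - exp (- n * box_bump a b x)\<close> tends to the indicator of that box.\<close>

definition box_bump :: "'a::euclidean_space \<Rightarrow> 'a \<Rightarrow> 'a \<Rightarrow> real" where
  "box_bump a b x = (\<Prod>i\<in>Basis. flat 0 (x \<bullet> i - a \<bullet> i) * flat 0 (b \<bullet> i - x \<bullet> i))"

lemma flat_nonneg: "0 \<le> flat m x"
  by (simp add: flat_def)

lemma flat_pos_iff: "0 < flat m x \<longleftrightarrow> 0 < x"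
  by (simp add: flat_def)

lemma box_bump_nonneg: "0 \<le> box_bump a b x"
  by (simp add: box_bump_def prod_nonneg flat_nonneg)

lemma box_bump_pos_iff: "0 < box_bump a b x \<longleftrightarrow> x \<in> box a b"
proof
  assume "x \<in> box a b"
  then show "0 < box_bump a b x"
    by (auto simp: box_bump_def flat_pos_iff mem_box intro!: prod_pos)
next
  assume "0 < box_bump a b x"
  then have "\<forall>i\<in>Basis. flat 0 (x \<bullet> i - a \<bullet> i) \<noteq> 0 \<and> flat 0 (b \<bullet> i - x \<bullet> i) \<noteq> 0"
    unfolding box_bump_def using prod_zero_iff[OF finite_Basis]
    by (metis (mono_tags, lifting) less_irrefl mult_eq_0_iff)
  then show "x \<in> box a b"
    by (auto simp: mem_box flat_def split: if_splits)
qed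

lemma Ck_affine: "Ck k (\<lambda>x. c * (x \<bullet> i) + d :: real)"
  by (rule Ck_add[OF Ck_linear Ck_const])
     (rule bounded_linear_const_mult[OF bounded_linear_inner_left])

lemma test_box_bump:
  assumes "cbox a b \<subseteq> \<Omega>"
  shows "test_function \<Omega> (box_bump a b)"
proof (rule test_functionI[OF _ compact_cbox assms])
  have 1: "Ck k (\<lambda>x. flat 0 (x \<bullet> i - a \<bullet> i))" for k i
    using Ck_compose[OF Cn_on_flat Ck_affine[of k 1 i "- (a \<bullet> i)"]] by simp
  have 2: "Ck k (\<lambda>x. flat 0 (b \<bullet> i - x \<bullet> i))" for k i
    using Ck_compose[OF Cn_on_flat Ck_affine[of k "-1" i "b \<bullet> i"]] by simp
  show "Ck k (box_bump a b)" for k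
    unfolding box_bump_def [abs_def]
    by (intro Ck_prod Ck_bilinear[OF bounded_bilinear_mult] 1 2) auto
  show "box_bump a b x = 0" if "x \<notin> cbox a b" for x
    using that box_bump_pos_iff[of a b x] box_bump_nonneg[of a b x] box_subset_cbox[of a b]
    by (metis in_mono less_eq_real_def)
qed

text \<open>Used twice: with \<open>k = 1\<close> and large \<open>c\<close> it turns bumps into
  approximate indicators, and with \<open>c = 1 / k\<close> it truncates densities smoothly.\<close>

lemma test_saturate:
  fixes k c :: real
  assumes "test_function \<Omega> f"
  shows "test_function \<Omega> (\<lambda>x. k * (1 - exp (- (c * f x))))"
proof -
  \<comment> \<open>The constant is written as \<open>k * exp (0 * x)\<close> so that both summands
    belong to the family of \<open>Cn_on_exp\<close>.\<close>
  have "Cn_on n UNIV (\<lambda>x::real. 1 * (k * exp (0 * x)) + (-1) * (k * exp ((- c) * x)))" for n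
    by (intro Cn_on_lincomb Cn_on_exp)
  then have "Cn_on n UNIV (\<lambda>x::real. k * (1 - exp (- (c * x))))" for n
    by (simp add: algebra_simps)
  from test_compose[OF assms this] show ?thesis by simp
qed

text \<open>With \<open>r = sqrt ((\<psi> x)\<^sup>2 + e\<^sup>2)\<close> the identity
  \<open>(r - e) * (r + e) = (\<psi> x)\<^sup>2\<close> moves all zeros of \<open>r - e\<close> into
  a perfect square. The remaining divisor \<open>r + e\<close> is at least \<open>2 * e\<close>, so
  its root is smooth and invertible.\<close>

lemma test_sqrt_sq:
  fixes \<psi> :: "'a::euclidean_space \<Rightarrow> real"
  assumes \<psi>: "test_function \<Omega> \<psi>" and e: "0 < e"
  obtains \<phi> where "test_function \<Omega> \<phi>" "\<And>x. (\<phi> x)\<^sup>2 = sqrt ((\<psi> x)\<^sup>2 + e\<^sup>2) - e"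
proof -
  have p: "0 < (\<psi> x)\<^sup>2 + e\<^sup>2" for x using e by (simp add: add_nonneg_pos)
  define y where "y x = 1 * ((\<psi> x)\<^sup>2 + e\<^sup>2) powr (1/2) + e" for x
  have ysq: "y x = sqrt ((\<psi> x)\<^sup>2 + e\<^sup>2) + e" for x
    by (simp add: y_def powr_half_sqrt)
  have y: "0 < y x" for x
    using e by (simp add: ysq add_nonneg_pos)
  have "Ck k (\<lambda>x. (\<psi> x)\<^sup>2 + e\<^sup>2)" for k
    unfolding power2_eq_square
    by (intro Ck_add Ck_bilinear[OF bounded_bilinear_mult] test_Ck[OF \<psi>] Ck_const)
  then have "Ck k (\<lambda>x. 1 * ((\<psi> x)\<^sup>2 + e\<^sup>2) powr (1/2))" for k
    by (rule Ck_compose[OF Cn_on_powr]) (use p in auto)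
  then have "Ck k y" for k
    unfolding y_def by (rule Ck_add[OF _ Ck_const])
  then have "Ck k (\<lambda>x. 1 * y x powr (-1/2))" for k
    by (rule Ck_compose[OF Cn_on_powr]) (use y in auto)
  then have "test_function \<Omega> (\<lambda>x. \<psi> x * (1 * y x powr (-1/2)))"
    by (rule test_bilinear[OF bounded_bilinear_mult \<psi>])
  moreover have "(\<psi> x * (1 * y x powr (-1/2)))\<^sup>2 = sqrt ((\<psi> x)\<^sup>2 + e\<^sup>2) - e" for x
  proof -
    have "(y x powr (-1/2))\<^sup>2 = inverse (y x)"
    proof -
      have "(y x powr (-1/2))\<^sup>2 = y x powr (-1/2 + -1/2)"
        by (simp only: powr_add power2_eq_square)
      also have "\<dots> = inverse (y x)" using powr_neg_one[OF y[of x]] by (simp add: inverse_eq_divide)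
      finally show ?thesis .
    qed
    then have h1: "(\<psi> x * (1 * y x powr (-1/2)))\<^sup>2 = (\<psi> x)\<^sup>2 / y x"
      by (simp only: power_mult_distrib mult_1 divide_inverse[of "_ ^ 2"])
    have *: "(\<psi> x)\<^sup>2 = (sqrt ((\<psi> x)\<^sup>2 + e\<^sup>2) - e) * y x"
    proof -
      have "(sqrt ((\<psi> x)\<^sup>2 + e\<^sup>2) - e) * y x = (sqrt ((\<psi> x)\<^sup>2 + e\<^sup>2))\<^sup>2 - e\<^sup>2"
        unfolding ysq by (simp only: power2_eq_square[of "sqrt _"] power2_eq_square[of e]
          square_diff_square_factored mult.commute)
      then show ?thesis using p[of x] by simp
    qed
    have h2: "(\<psi> x)\<^sup>2 / y x = sqrt ((\<psi> x)\<^sup>2 + e\<^sup>2) - e"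
      by (rule iffD2[OF nonzero_divide_eq_eq]) (use y[of x] in simp, rule *)
    show ?thesis by (rule trans[OF h1 h2])
  qed
  ultimately show ?thesis by (rule that)
qed

section \<open>The space \<open>L\<^sup>2(\<Omega>)\<close>\<close>

lemma tendsto_0_power2_iff:
  fixes f :: "'i \<Rightarrow> real"
  shows "((\<lambda>i. (f i)\<^sup>2) \<longlongrightarrow> 0) F \<longleftrightarrow> (f \<longlongrightarrow> 0) F"
  using tendsto_null_power[of f F 2] tendsto_real_sqrt[of "\<lambda>i. (f i)\<^sup>2" 0 F]
  by (auto simp: tendsto_rabs_zero_iff)

locale bounded_open =
  fixes \<Omega> :: "'a::euclidean_space set"
  assumes open_\<Omega>: "open \<Omega>" and bounded_\<Omega>: "bounded \<Omega>"
begin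

abbreviation M :: "'a measure" where
  "M \<equiv> lebesgue_on \<Omega>"

abbreviation L2 :: "('a \<Rightarrow> 'b::euclidean_space) \<Rightarrow> bool" where
  "L2 \<equiv> Lp 2 \<Omega>"

abbreviation test :: "('a \<Rightarrow> 'b::euclidean_space) \<Rightarrow> bool" where
  "test \<equiv> test_function \<Omega>"

abbreviation nrm :: "('a \<Rightarrow> 'b::euclidean_space) \<Rightarrow> real" where
  "nrm \<equiv> L2_norm \<Omega>"

abbreviation D :: "'a \<Rightarrow> ('a \<Rightarrow> 'b::euclidean_space) \<Rightarrow> 'a \<Rightarrow> 'b" where
  "D \<equiv> weak_pd \<Omega>"

abbreviation L2_lim :: "(nat \<Rightarrow> 'a \<Rightarrow> 'b::euclidean_space) \<Rightarrow> ('a \<Rightarrow> 'b) \<Rightarrow> bool" where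
  "L2_lim u v \<equiv> (\<lambda>n. L2_norm \<Omega> (\<lambda>x. u n x - v x)) \<longlonglongrightarrow> 0"

lemma lmeasurable_\<Omega>: "\<Omega> \<in> lmeasurable"
  using bounded_\<Omega> open_\<Omega> by (rule lmeasurable_open)

lemma sets_\<Omega>: "\<Omega> \<in> sets lebesgue"
  using lmeasurable_\<Omega> by auto

lemma finite_measure_\<Omega>: "finite_measure M"
  using lmeasurable_\<Omega> by (rule finite_measure_lebesgue_on)

lemma integrable_const_\<Omega>: "integrable M (\<lambda>x. c)"
  using finite_measure_\<Omega> by (rule finite_measure.integrable_const)

lemma measure_\<Omega>: "measure M \<Omega> = measure lebesgue \<Omega>"
  using sets_\<Omega> by (simp add: measure_restrict_space)

lemma Lp2D:
  assumes "L2 u"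
  shows "u \<in> borel_measurable M" "integrable M (\<lambda>x. (norm (u x))\<^sup>2)"
  using assms by (auto simp: Lp_def)

lemma Lp2I:
  fixes v :: "'a \<Rightarrow> 'b::euclidean_space"
  assumes "integrable M g" "AE x in M. (norm (v x))\<^sup>2 \<le> g x"
    and "v \<in> borel_measurable M"
  shows "L2 v"
  unfolding Lp_def
proof
  show "integrable M (\<lambda>x. (norm (v x))\<^sup>2)"
  proof (rule Bochner_Integration.integrable_bound[OF assms(1)])
    show "AE x in M. norm ((norm (v x))\<^sup>2) \<le> norm (g x)"
      using assms(2) by eventually_elim simp
  qed (use assms(3) in auto)
qed (rule assms(3))

lemma Lp2_bound:
  fixes u :: "'a \<Rightarrow> 'b::euclidean_space" and v :: "'a \<Rightarrow> 'c::euclidean_space"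
  assumes u: "L2 u" and v: "v \<in> borel_measurable M"
    and le: "AE x in M. norm (v x) \<le> C * norm (u x)"
  shows "L2 v"
proof (rule Lp2I)
  show "integrable M (\<lambda>x. C\<^sup>2 * (norm (u x))\<^sup>2)"
    using Lp2D[OF u] by simp
  show "AE x in M. (norm (v x))\<^sup>2 \<le> C\<^sup>2 * (norm (u x))\<^sup>2"
    using le
  proof eventually_elim
    case (elim x)
    from power_mono[OF elim norm_ge_zero, of 2] show ?case by (simp add: power_mult_distrib)
  qed
qed (use v in auto)

lemma Lp2_bounded:
  fixes v :: "'a \<Rightarrow> 'c::euclidean_space"
  assumes v: "v \<in> borel_measurable M"
    and le: "AE x in M. norm (v x) \<le> C"
  shows "L2 v"
proof (rule Lp2_bound[of "\<lambda>x. 1::real" v C])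
  show "L2 (\<lambda>x. 1::real)" by (simp add: Lp_def integrable_const_\<Omega>)
qed (use assms in auto)

lemma Lp2_scaleR:
  assumes "L2 u" shows "L2 (\<lambda>x. c *\<^sub>R u x)"
  by (rule Lp2_bound[OF assms, of _ "\<bar>c\<bar>"]) (use Lp2D[OF assms] in auto)

lemma Lp2_add:
  fixes u v :: "'a \<Rightarrow> 'b::euclidean_space"
  assumes u: "L2 u" and v: "L2 v"
  shows "L2 (\<lambda>x. u x + v x)"
proof (rule Lp2I)
  show "integrable M (\<lambda>x. 2 * (norm (u x))\<^sup>2 + 2 * (norm (v x))\<^sup>2)"
    using Lp2D[OF u] Lp2D[OF v] by simp
  have "(norm (u x + v x))\<^sup>2 \<le> 2 * (norm (u x))\<^sup>2 + 2 * (norm (v x))\<^sup>2" for x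
  proof -
    have "(norm (u x + v x))\<^sup>2 \<le> (norm (u x) + norm (v x))\<^sup>2"
      by (intro power_mono norm_triangle_ineq) auto
    also have "\<dots> \<le> 2 * (norm (u x))\<^sup>2 + 2 * (norm (v x))\<^sup>2"
      using zero_le_power2[of "norm (u x) - norm (v x)"] by (simp add: power2_eq_square algebra_simps)
    finally show ?thesis .
  qed
  then show "AE x in M. (norm (u x + v x))\<^sup>2
      \<le> 2 * (norm (u x))\<^sup>2 + 2 * (norm (v x))\<^sup>2"
    by simp
qed (use Lp2D[OF u] Lp2D[OF v] in auto)

lemma Lp2_diff:
  assumes "L2 u" and "L2 v"
  shows "L2 (\<lambda>x. u x - v x)"
  using Lp2_add[OF assms(1) Lp2_scaleR[OF assms(2), of "-1"]] by simp

lemma Lp2_norm: "L2 u \<Longrightarrow> L2 (\<lambda>x. norm (u x))"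
  by (auto simp: Lp_def)

lemma integrable_prod_bound:
  fixes u :: "'a \<Rightarrow> 'b::euclidean_space" and v :: "'a \<Rightarrow> 'c::euclidean_space"
    and f :: "'a \<Rightarrow> 'd::euclidean_space"
  assumes u: "L2 u" and v: "L2 v" and f: "f \<in> borel_measurable M"
    and le: "AE x in M. norm (f x) \<le> C * (norm (u x) * norm (v x))"
  shows "integrable M f"
proof (rule Bochner_Integration.integrable_bound[OF _ f])
  show "integrable M (\<lambda>x. \<bar>C\<bar> * ((norm (u x))\<^sup>2 + (norm (v x))\<^sup>2))"
    using Lp2D[OF u] Lp2D[OF v] by simp
  show "AE x in M. norm (f x) \<le> norm (\<bar>C\<bar> * ((norm (u x))\<^sup>2 + (norm (v x))\<^sup>2))"
    using le
  proof eventually_elim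
    case (elim x)
    have "2 * (norm (u x) * norm (v x)) \<le> (norm (u x))\<^sup>2 + (norm (v x))\<^sup>2"
      using zero_le_power2[of "norm (u x) - norm (v x)"] by (simp add: power2_eq_square algebra_simps)
    then have "norm (u x) * norm (v x) \<le> (norm (u x))\<^sup>2 + (norm (v x))\<^sup>2"
      using mult_nonneg_nonneg[OF norm_ge_zero[of "u x"] norm_ge_zero[of "v x"]] by linarith
    then have "C * (norm (u x) * norm (v x)) \<le> \<bar>C\<bar> * ((norm (u x))\<^sup>2 + (norm (v x))\<^sup>2)"
      by (intro mult_mono) auto
    with elim show ?case by simp
  qed
qed

lemma Lp2_integrable:
  fixes u :: "'a \<Rightarrow> 'b::euclidean_space"
  assumes "L2 u" shows "integrable M u"
  by (rule integrable_prod_bound[OF assms Lp2_bounded[of "\<lambda>x. 1::real" 1], of _ 1])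
     (use Lp2D[OF assms] in auto)

lemma L2_norm_sq: "(nrm u)\<^sup>2 = (LINT x|M. (norm (u x))\<^sup>2)"
  by (simp add: L2_norm_def)

lemma L2_norm_nonneg: "0 \<le> nrm u"
  by (simp add: L2_norm_def)

lemma L2_norm_zero: "nrm (\<lambda>x. 0) = 0"
  by (simp add: L2_norm_def)

lemma L2_norm_mono:
  assumes u: "L2 u"
    and le: "AE x in M. norm (v x) \<le> norm (u x)"
  shows "nrm v \<le> nrm u"
  unfolding L2_norm_def real_sqrt_le_iff
proof (rule integral_mono_AE')
  show "AE x in M. (norm (v x))\<^sup>2 \<le> (norm (u x))\<^sup>2"
    using le by eventually_elim (simp add: power_mono)
qed (use Lp2D[OF u] in auto)

lemma L2_norm_cong_AE:
  assumes "AE x in M. norm (u x) = norm (v x)"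
    "u \<in> borel_measurable M" "v \<in> borel_measurable M"
  shows "nrm u = nrm v"
  unfolding L2_norm_def
  by (intro arg_cong[where f=sqrt] integral_cong_AE) (use assms in auto)

lemma L2_norm_scaleR: "nrm (\<lambda>x. c *\<^sub>R u x) = \<bar>c\<bar> * nrm u"
  by (simp add: L2_norm_def power_mult_distrib real_sqrt_mult)

lemma L2_norm_minus: "nrm (\<lambda>x. u x - v x) = nrm (\<lambda>x. v x - u x)"
  by (simp add: L2_norm_def norm_minus_commute)

lemma L2_cauchy_schwarz:
  fixes u :: "'a \<Rightarrow> 'b::euclidean_space" and v :: "'a \<Rightarrow> 'c::euclidean_space"
  assumes u: "L2 u" and v: "L2 v"
  shows "(LINT x|M. norm (u x) * norm (v x)) \<le> nrm u * nrm v"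
proof -
  note [measurable] = Lp2D(1)[OF u] Lp2D(1)[OF v]
  have i: "integrable M (\<lambda>x. norm (u x) * norm (v x))"
    by (rule integrable_prod_bound[OF u v, of _ 1]) auto
  have "(\<integral>\<^sup>+x. ennreal (norm (u x)) * ennreal (norm (v x)) \<partial>M)\<^sup>2
      \<le> (\<integral>\<^sup>+x. ennreal (norm (u x)) ^ 2 \<partial>M) * (\<integral>\<^sup>+x. ennreal (norm (v x)) ^ 2 \<partial>M)"
    by (rule Cauchy_Schwarz_nn_integral) measurable
  also have "(\<integral>\<^sup>+x. ennreal (norm (u x)) * ennreal (norm (v x)) \<partial>M)
      = ennreal (LINT x|M. norm (u x) * norm (v x))"
    by (simp add: ennreal_mult[symmetric] nn_integral_eq_integral[OF i])
  also have "(\<integral>\<^sup>+x. ennreal (norm (u x)) ^ 2 \<partial>M) = ennreal ((nrm u)\<^sup>2)"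
    by (simp add: ennreal_power nn_integral_eq_integral[OF Lp2D(2)[OF u]] L2_norm_sq)
  also have "(\<integral>\<^sup>+x. ennreal (norm (v x)) ^ 2 \<partial>M) = ennreal ((nrm v)\<^sup>2)"
    by (simp add: ennreal_power nn_integral_eq_integral[OF Lp2D(2)[OF v]] L2_norm_sq)
  finally have "(LINT x|M. norm (u x) * norm (v x))\<^sup>2 \<le> (nrm u * nrm v)\<^sup>2"
    by (simp add: ennreal_power ennreal_mult[symmetric] power_mult_distrib)
  then show ?thesis
    by (rule power2_le_imp_le) (simp add: L2_norm_nonneg)
qed

lemma L2_norm_triangle:
  fixes u v :: "'a \<Rightarrow> 'b::euclidean_space"
  assumes u: "L2 u" and v: "L2 v"
  shows "nrm (\<lambda>x. u x + v x) \<le> nrm u + nrm v"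
proof (rule power2_le_imp_le)
  note [measurable] = Lp2D(1)[OF u] Lp2D(1)[OF v]
  have i: "integrable M (\<lambda>x. norm (u x) * norm (v x))"
    by (rule integrable_prod_bound[OF u v, of _ 1]) auto
  have "(nrm (\<lambda>x. u x + v x))\<^sup>2
      \<le> (LINT x|M. (norm (u x))\<^sup>2 + 2 * (norm (u x) * norm (v x)) + (norm (v x))\<^sup>2)"
    unfolding L2_norm_sq
  proof (rule integral_mono)
    show "(norm (u x + v x))\<^sup>2 \<le> (norm (u x))\<^sup>2 + 2 * (norm (u x) * norm (v x)) + (norm (v x))\<^sup>2" for x
      using power_mono[OF norm_triangle_ineq[of "u x" "v x"] norm_ge_zero, of 2]
      by (simp add: power2_eq_square algebra_simps)
  qed (use Lp2D[OF u] Lp2D[OF v] i Lp2D[OF Lp2_add[OF u v]] in auto)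
  also have "\<dots> = (nrm u)\<^sup>2 + 2 * (LINT x|M. norm (u x) * norm (v x)) + (nrm v)\<^sup>2"
    using Lp2D[OF u] Lp2D[OF v] i by (simp add: L2_norm_sq)
  also have "\<dots> \<le> (nrm u + nrm v)\<^sup>2"
    using L2_cauchy_schwarz[OF u v] by (simp add: power2_eq_square algebra_simps)
  finally show "(nrm (\<lambda>x. u x + v x))\<^sup>2 \<le> (nrm u + nrm v)\<^sup>2" .
qed (simp add: L2_norm_nonneg)

lemma L2_norm_triangle_diff:
  fixes u v w :: "'a \<Rightarrow> 'b::euclidean_space"
  assumes "L2 u" "L2 v" "L2 w"
  shows "nrm (\<lambda>x. u x - w x) \<le> nrm (\<lambda>x. u x - v x) + nrm (\<lambda>x. v x - w x)"
  using L2_norm_triangle[OF Lp2_diff[OF assms(1,2)] Lp2_diff[OF assms(2,3)]] by simp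

section \<open>Convergence and completeness in mean square\<close>

lemma L2_conv_norm:
  fixes u :: "nat \<Rightarrow> 'a \<Rightarrow> 'b::euclidean_space"
  assumes un: "\<And>n. L2 (u n)" and u: "L2 u'"
    and cu: "L2_lim u u'"
  shows "(\<lambda>n. nrm (u n)) \<longlonglongrightarrow> nrm u'"
proof -
  have "\<bar>nrm (u n) - nrm u'\<bar> \<le> nrm (\<lambda>x. u n x - u' x)" for n
    using L2_norm_triangle[OF Lp2_diff[OF un u] u, of n] L2_norm_triangle[OF Lp2_diff[OF u un[of n]]
      un[of n]]
      L2_norm_minus[of u' "u n"] by simp
  then have "(\<lambda>n. nrm (u n) - nrm u') \<longlonglongrightarrow> 0"
    by (intro Lim_null_comparison[OF _ cu]) auto
  then show ?thesis by (simp add: LIM_zero_iff)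
qed

lemma integrable_bilinear:
  fixes u :: "'a \<Rightarrow> 'b::euclidean_space" and v :: "'a \<Rightarrow> 'c::euclidean_space"
    and h :: "'b \<Rightarrow> 'c \<Rightarrow> 'd::euclidean_space"
  assumes h: "bounded_bilinear h" and u: "L2 u" and v: "L2 v"
  shows "integrable M (\<lambda>x. h (u x) (v x))"
proof -
  obtain K where K: "\<And>a b. norm (h a b) \<le> norm a * norm b * K"
    using bounded_bilinear.bounded[OF h] by blast
  show ?thesis
  proof (rule integrable_prod_bound[OF u v, of _ K])
    show "(\<lambda>x. h (u x) (v x)) \<in> borel_measurable M"
      using borel_measurable_continuous_on[OF bounded_bilinear.continuous_on[OF h
          continuous_on_fst[OF continuous_on_id] continuous_on_snd[OF continuous_on_id]]
        borel_measurable_Pair[OF Lp2D(1)[OF u] Lp2D(1)[OF v]]] by simp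
  qed (use K in \<open>auto simp: mult.commute mult.left_commute\<close>)
qed

lemma L2_conv_bilinear:
  fixes u :: "nat \<Rightarrow> 'a \<Rightarrow> 'b::euclidean_space" and v :: "nat \<Rightarrow> 'a \<Rightarrow> 'c::euclidean_space"
    and h :: "'b \<Rightarrow> 'c \<Rightarrow> 'd::euclidean_space"
  assumes h: "bounded_bilinear h"
    and un: "\<And>n. L2 (u n)" and u: "L2 u'"
    and cu: "L2_lim u u'"
    and vn: "\<And>n. L2 (v n)" and v: "L2 v'"
    and cv: "L2_lim v v'"
  shows "(\<lambda>n. LINT x|M. h (u n x) (v n x)) \<longlonglongrightarrow> (LINT x|M. h (u' x) (v' x))"
proof -
  obtain K where K: "0 \<le> K" "\<And>a b. norm (h a b) \<le> norm a * norm b * K"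
    using bounded_bilinear.nonneg_bounded[OF h] by blast
  have bd: "norm (LINT x|M. h (f x) (g x)) \<le> K * (nrm f * nrm g)"
    if f: "L2 f" and g: "L2 g" for f g
  proof -
    note [measurable] = Lp2D(1)[OF f] Lp2D(1)[OF g]
    have i: "integrable M (\<lambda>x. norm (f x) * norm (g x))"
      by (rule integrable_prod_bound[OF f g, of _ 1]) auto
    have "norm (LINT x|M. h (f x) (g x)) \<le> (LINT x|M. norm (h (f x) (g x)))"
      by simp
    also have "\<dots> \<le> (LINT x|M. K * (norm (f x) * norm (g x)))"
      using integrable_bilinear[OF h f g] i K(2) by (intro integral_mono) (auto simp: mult.commute)
    also have "\<dots> \<le> K * (nrm f * nrm g)"
      using L2_cauchy_schwarz[OF f g] K(1) by (simp add: mult_left_mono)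
    finally show ?thesis .
  qed
  \<comment> \<open>Bound for the two terms of \<open>h (u n - u') (v n) + h u' (v n - v')\<close>;
    the norms of \<open>v n\<close> converge, so each product tends to zero.\<close>
  define B where "B n = K * (nrm (\<lambda>x. u n x - u' x) * nrm (v n))
     + K * (nrm u' * nrm (\<lambda>x. v n x - v' x))" for n
  have "B \<longlonglongrightarrow> K * (0 * nrm v') + K * (nrm u' * 0)"
    unfolding B_def by (intro tendsto_intros cu cv L2_conv_norm[OF vn v cv])
  then have B: "B \<longlonglongrightarrow> 0" by simp
  have "norm ((LINT x|M. h (u n x) (v n x)) - (LINT x|M. h (u' x) (v' x))) \<le> B n" for n
  proof -
    have "(LINT x|M. h (u n x) (v n x)) - (LINT x|M. h (u' x) (v' x))
       = (LINT x|M. h (u n x - u' x) (v n x)) + (LINT x|M. h (u' x) (v n x - v' x))"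
      using integrable_bilinear[OF h un vn] integrable_bilinear[OF h u v]
        integrable_bilinear[OF h u vn]
      by (simp add: bounded_bilinear.diff_left[OF h] bounded_bilinear.diff_right[OF h])
    then show ?thesis
      unfolding B_def
      by (simp only:) (rule order_trans[OF norm_triangle_ineq add_mono[OF
          bd[OF Lp2_diff[OF un u] vn] bd[OF u Lp2_diff[OF vn v]]]])
  qed
  then have "(\<lambda>n. (LINT x|M. h (u n x) (v n x)) - (LINT x|M. h (u' x) (v' x))) \<longlonglongrightarrow> 0"
    by (intro Lim_null_comparison[OF _ B]) auto
  then show ?thesis by (simp add: LIM_zero_iff)
qed

lemma L2_conv_integral:
  fixes u :: "nat \<Rightarrow> 'a \<Rightarrow> 'b::euclidean_space"
  assumes un: "\<And>n. L2 (u n)" and u: "L2 u'"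
    and cu: "L2_lim u u'"
  shows "(\<lambda>n. LINT x|M. u n x) \<longlonglongrightarrow> (LINT x|M. u' x)"
proof -
  have 1: "L2 (\<lambda>x. 1::real)" by (rule Lp2_bounded[of _ 1]) auto
  from L2_conv_bilinear[OF bounded_bilinear_scaleR 1 1 _ un u cu] show ?thesis
    by (simp add: L2_norm_zero)
qed

text \<open>On a set of finite measure convergence in mean square gives convergence in mean, and
  hence almost everywhere along a subsequence.\<close>

lemma L2_conv_AE_subseq:
  fixes u :: "nat \<Rightarrow> 'a \<Rightarrow> 'b::euclidean_space"
  assumes un: "\<And>n. L2 (u n)" and u: "L2 u'"
    and cu: "L2_lim u u'"
  obtains r where "strict_mono r" "AE x in M. (\<lambda>n. u (r n) x) \<longlonglongrightarrow> u' x"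
proof -
  have nn: "L2 (\<lambda>x. norm (u n x - u' x))" for n
    by (rule Lp2_norm[OF Lp2_diff[OF un u]])
  have "(\<lambda>n. LINT x|M. norm (u n x - u' x)) \<longlonglongrightarrow> (LINT x|M. (0::real))"
    by (rule L2_conv_integral[OF nn]) (use cu in \<open>auto simp: L2_norm_def Lp_def\<close>)
  then have "(\<lambda>n. LINT x|M. norm (u n x - u' x)) \<longlonglongrightarrow> 0" by simp
  from tendsto_L1_AE_subseq[OF Lp2_integrable[OF Lp2_diff[OF un u]] this]
  obtain r where "strict_mono r" "AE x in M. (\<lambda>n. u (r n) x - u' x) \<longlonglongrightarrow> 0"
    by blast
  then show ?thesis by (intro that[of r]) (simp_all add: LIM_zero_iff)
qed

text \<open>The majorant bounds the difference to the limit, which is what smooth truncations of a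
  fixed function provide directly.\<close>

lemma L2_conv_dominated:
  fixes u :: "nat \<Rightarrow> 'a \<Rightarrow> 'b::euclidean_space" and g :: "'a \<Rightarrow> 'c::euclidean_space"
  assumes un: "\<And>n. u n \<in> borel_measurable M" and u: "u' \<in> borel_measurable M"
    and ae: "AE x in M. (\<lambda>n. u n x) \<longlonglongrightarrow> u' x"
    and g: "L2 g"
    and le: "\<And>n. AE x in M. norm (u n x - u' x) \<le> norm (g x)"
  shows "L2_lim u u'"
proof -
  have "(\<lambda>n. LINT x|M. (norm (u n x - u' x))\<^sup>2) \<longlonglongrightarrow> (LINT x|M. 0)"
  proof (rule integral_dominated_convergence)
    show "integrable M (\<lambda>x. (norm (g x))\<^sup>2)" by (rule Lp2D[OF g])
    show "AE x in M. (\<lambda>n. (norm (u n x - u' x))\<^sup>2) \<longlonglongrightarrow> 0"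
      using ae
    proof eventually_elim
      case (elim x)
      then have "(\<lambda>n. (norm (u n x - u' x))\<^sup>2) \<longlonglongrightarrow> (norm (u' x - u' x))\<^sup>2"
        by (intro tendsto_intros)
      then show ?case by simp
    qed
    show "AE x in M. norm ((norm (u n x - u' x))\<^sup>2) \<le> (norm (g x))\<^sup>2" for n
      using le[of n] by eventually_elim (simp add: power_mono)
  qed (use un u in auto)
  then show ?thesis unfolding L2_norm_def using tendsto_real_sqrt by fastforce
qed

text \<open>The Riesz-Fischer argument: the sequence is also Cauchy in mean, a subsequence converges
  almost everywhere, and Fatou's lemma carries the Cauchy estimate over to the limit.\<close>

lemma L2_complete:
  fixes u :: "nat \<Rightarrow> 'a \<Rightarrow> 'b::euclidean_space"
  assumes un: "\<And>n. L2 (u n)"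
    and cauchy: "\<And>e. e > 0 \<Longrightarrow> \<exists>N. \<forall>m\<ge>N. \<forall>n\<ge>N. nrm (\<lambda>x. u m x - u n x) < e"
  obtains u' where "L2 u'" "L2_lim u u'"
proof -
  note [measurable] = Lp2D(1)[OF un]
  have 1: "L2 (\<lambda>x. 1::real)" by (rule Lp2_bounded[of _ 1]) auto
  \<comment> \<open>The Cauchy-Schwarz constant for comparison with the mean norm; the added
    \<open>1\<close> makes it positive also when \<Omega> is empty.\<close>
  define c where "c = nrm (\<lambda>x. 1::real) + 1"
  have c: "c > 0" using L2_norm_nonneg[of "\<lambda>x. 1::real"] by (simp add: c_def)
  have L1: "(LINT x|M. norm (u m x - u n x)) \<le> c * nrm (\<lambda>x. u m x - u n x)" for m n
    using L2_cauchy_schwarz[OF 1 Lp2_diff[OF un un], of m n] L2_norm_nonneg[of "\<lambda>x. u m x - u n x"]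
    by (simp add: c_def algebra_simps)
  have "\<exists>N. \<forall>m\<ge>N. \<forall>n\<ge>N. (LINT x|M. norm (u m x - u n x)) < e" if "e > 0" for e
  proof -
    obtain N where N: "\<And>m n. m \<ge> N \<Longrightarrow> n \<ge> N \<Longrightarrow> nrm (\<lambda>x. u m x - u n x) < e / c"
      using cauchy[OF divide_pos_pos[OF \<open>e > 0\<close> c]] by blast
    have "(LINT x|M. norm (u m x - u n x)) < e" if "m \<ge> N" "n \<ge> N" for m n
      using N[OF that] L1[of m n] c by (simp add: field_simps)
    then show ?thesis by blast
  qed
  from cauchy_L1_AE_cauchy_subseq[OF Lp2_integrable[OF un] this]
  obtain r where r: "strict_mono r" and ae: "AE x in M. Cauchy (\<lambda>i. u (r i) x)" by auto
  define u' where "u' x = lim (\<lambda>i. u (r i) x)" for x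
  have [measurable]: "u' \<in> borel_measurable M"
    unfolding u'_def by measurable
  have lim: "AE x in M. (\<lambda>i. u (r i) x) \<longlonglongrightarrow> u' x"
    using ae by eventually_elim (auto simp: u'_def Cauchy_convergent convergent_LIMSEQ_iff[symmetric])
  \<comment> \<open>Here \<open>n\<close> is fixed and only the second index runs along the
    subsequence, so the bound concerns the whole sequence and no subsequence remains in the
    conclusion.\<close>
  have fatou: "(\<integral>\<^sup>+x. ennreal ((norm (u n x - u' x))\<^sup>2) \<partial>M) \<le> ennreal (e\<^sup>2)"
    if e: "\<And>m. m \<ge> N \<Longrightarrow> nrm (\<lambda>x. u n x - u m x) < e" for n N e
  proof -
    have "(\<integral>\<^sup>+x. ennreal ((norm (u n x - u' x))\<^sup>2) \<partial>M)
      = (\<integral>\<^sup>+x. liminf (\<lambda>i. ennreal ((norm (u n x - u (r i) x))\<^sup>2)) \<partial>M)"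
    proof (rule nn_integral_cong_AE)
      show "AE x in M. ennreal ((norm (u n x - u' x))\<^sup>2)
          = liminf (\<lambda>i. ennreal ((norm (u n x - u (r i) x))\<^sup>2))"
        using lim
      proof eventually_elim
        case (elim x)
        have "(\<lambda>i. ennreal ((norm (u n x - u (r i) x))\<^sup>2)) \<longlonglongrightarrow> ennreal ((norm (u n x - u' x))\<^sup>2)"
          by (intro tendsto_ennrealI tendsto_intros elim)
        from lim_imp_Liminf[OF sequentially_bot this] show ?case by (rule sym)
      qed
    qed
    also have "\<dots> \<le> liminf (\<lambda>i. \<integral>\<^sup>+x. ennreal ((norm (u n x - u (r i) x))\<^sup>2) \<partial>M)"
      by (rule nn_integral_liminf) measurable
    also have "\<dots> \<le> ennreal (e\<^sup>2)"
    proof (rule Liminf_le)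
      show "\<forall>\<^sub>F i in sequentially. (\<integral>\<^sup>+x. ennreal ((norm (u n x - u (r i) x))\<^sup>2) \<partial>M) \<le> ennreal (e\<^sup>2)"
        using eventually_ge_at_top[of N]
      proof eventually_elim
        case (elim i)
        then have "nrm (\<lambda>x. u n x - u (r i) x) < e"
          using e seq_suble[OF r, of i] by simp
        then have "(nrm (\<lambda>x. u n x - u (r i) x))\<^sup>2 \<le> e\<^sup>2"
          by (intro power_mono L2_norm_nonneg) simp
        then show ?case
          unfolding L2_norm_sq
          by (simp add: nn_integral_eq_integral[OF Lp2D(2)[OF Lp2_diff[OF un un]]])
      qed
    qed simp
    finally show ?thesis .
  qed
  have Lpd: "L2 (\<lambda>x. u n x - u' x)" and bound: "nrm (\<lambda>x. u n x - u' x) \<le> e"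
    if e: "\<And>m. m \<ge> N \<Longrightarrow> nrm (\<lambda>x. u n x - u m x) < e" for n N e
  proof -
    have e0: "0 \<le> e"
      using e[of N] L2_norm_nonneg[of "\<lambda>x. u n x - u N x"] by simp
    have "(\<integral>\<^sup>+x. ennreal (norm ((norm (u n x - u' x))\<^sup>2)) \<partial>M) < \<infinity>"
      using fatou[OF e] by (simp add: less_top[symmetric]) (metis ennreal_less_top le_less_trans
        top.not_eq_extremum)
    then have i: "integrable M (\<lambda>x. (norm (u n x - u' x))\<^sup>2)"
      by (intro integrableI_bounded) measurable
    then show "L2 (\<lambda>x. u n x - u' x)" by (simp add: Lp_def)
    have "(nrm (\<lambda>x. u n x - u' x))\<^sup>2 \<le> e\<^sup>2"
      using fatou[OF e] by (simp add: L2_norm_sq nn_integral_eq_integral[OF i])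
    then show "nrm (\<lambda>x. u n x - u' x) \<le> e"
      using e0 by (rule power2_le_imp_le)
  qed
  show ?thesis
  proof (rule that)
    obtain N where "\<forall>m\<ge>N. \<forall>n\<ge>N. nrm (\<lambda>x. u m x - u n x) < 1" using cauchy[of 1] by auto
    then have "L2 (\<lambda>x. u N x - u' x)" by (intro Lpd[of N]) auto
    from Lp2_diff[OF un[of N] this] show "L2 u'" by simp
    show "L2_lim u u'"
    proof (rule LIMSEQ_I)
      fix e :: real assume "0 < e"
      then obtain N where N: "\<forall>m\<ge>N. \<forall>n\<ge>N. nrm (\<lambda>x. u m x - u n x) < e / 2"
        using cauchy[of "e / 2"] by auto
      have "norm (nrm (\<lambda>x. u n x - u' x) - 0) < e" if "n \<ge> N" for n
        using bound[of N n "e / 2"] N that \<open>0 < e\<close> L2_norm_nonneg[of "\<lambda>x. u n x - u' x"] by simp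
      then show "\<exists>no. \<forall>n\<ge>no. norm (nrm (\<lambda>x. u n x - u' x) - 0) < e" by blast
    qed
  qed
qed

end

section \<open>Integration by parts and uniqueness of weak derivatives\<close>

lemma test_bounded:
  assumes "test_function \<Omega> f"
  obtains C where "0 \<le> C" "\<And>x. norm (f x) \<le> C"
proof -
  obtain K where K: "compact K" "\<And>x. x \<notin> K \<Longrightarrow> f x = 0"
    using test_functionE[OF assms] by metis
  have "compact (f ` K)"
    using K(1) test_continuous[OF assms] by (auto intro: compact_continuous_image continuous_on_subset)
  then obtain C where C: "C > 0" "\<forall>y\<in>f ` K. norm y \<le> C"
    using compact_imp_bounded bounded_pos by metis
  have "norm (f x) \<le> C" for x
    using C K(2)[of x] by (cases "x \<in> K") auto
  with C show ?thesis by (intro that[of C]) auto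
qed

lemma test_measurable:
  fixes f :: "'a::euclidean_space \<Rightarrow> 'b::euclidean_space"
  assumes "test_function \<Omega> f" "S \<in> sets lebesgue"
  shows "f \<in> borel_measurable (lebesgue_on S)"
  using test_continuous[OF assms(1)] assms(2)
  by (auto intro: continuous_imp_measurable_on_sets_lebesgue continuous_on_subset)

lemma pd_scaleR:
  assumes "f differentiable (at x)"
  shows "frechet_derivative f (at x) (s *\<^sub>R b) = s *\<^sub>R pd b f x"
  using assms unfolding pd_def frechet_derivative_works
  by (metis has_derivative_bounded_linear linear_simps(5))

text \<open>The difference quotients have integral zero by translation invariance and converge to
  the partial derivative under a common majorant. This avoids Fubini and any boundary term.\<close>

lemma integral_pd_eq_0:
  fixes f :: "'a::euclidean_space \<Rightarrow> 'b::euclidean_space"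
  assumes \<Omega>: "\<Omega> \<in> sets lebesgue" and f: "test_function \<Omega> f" and b: "b \<in> Basis"
  shows "(LINT x|lebesgue_on \<Omega>. pd b f x) = 0"
proof -
  obtain K where K: "compact K" "K \<subseteq> \<Omega>" "\<And>x. x \<notin> K \<Longrightarrow> f x = 0"
    using test_functionE[OF f] by blast
  obtain K' where K': "compact K'" "K' \<subseteq> \<Omega>" "\<And>x. x \<notin> K' \<Longrightarrow> pd b f x = 0"
    using test_functionE[OF test_pd[OF f b]] by blast
  obtain C where C: "0 \<le> C" "\<And>x. norm (pd b f x) \<le> C"
    using test_bounded[OF test_pd[OF f b]] by blast
  obtain R where R: "\<And>x. x \<in> K \<Longrightarrow> norm x \<le> R"
    using K(1) compact_imp_bounded bounded_iff by metis
  have cf: "continuous_on UNIV f" and cp: "continuous_on UNIV (pd b f)"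
    using f test_pd[OF f b] by (auto intro: test_continuous)
  have [measurable]: "f \<in> borel_measurable borel" "pd b f \<in> borel_measurable borel"
    using cf cp by (auto intro: borel_measurable_continuous_onI)
  have d: "f differentiable (at x)" for x
    by (rule test_differentiable[OF f])
  have line: "((\<lambda>s. f (x + s *\<^sub>R b)) has_derivative (\<lambda>h. h *\<^sub>R pd b f (x + s *\<^sub>R b))) (at s within A)"
    for x s A
  proof -
    have "(f has_derivative frechet_derivative f (at (x + s *\<^sub>R b))) (at (x + s *\<^sub>R b))"
      using d frechet_derivative_works by blast
    moreover have "((\<lambda>s. x + s *\<^sub>R b) has_derivative (\<lambda>h. h *\<^sub>R b)) (at s)"
      by (auto intro!: derivative_eq_intros)
    ultimately have "((\<lambda>s. f (x + s *\<^sub>R b)) has_derivative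
        (\<lambda>h. frechet_derivative f (at (x + s *\<^sub>R b)) (h *\<^sub>R b))) (at s)"
      by (rule has_derivative_compose[rotated])
    then show ?thesis
      by (auto simp: pd_scaleR[OF d] intro: has_derivative_at_withinI)
  qed
  define t where "t n = inverse (real (Suc n))" for n
  have t: "0 < t n" "t n \<le> 1" for n
    by (auto simp: t_def inverse_le_1_iff)
  have t0: "t \<longlonglongrightarrow> 0" unfolding t_def by (rule LIMSEQ_inverse_real_of_nat)
  define D where "D n x = (f (x + t n *\<^sub>R b) - f x) /\<^sub>R t n" for n x
  have Dlim: "(\<lambda>n. D n x) \<longlonglongrightarrow> pd b f x" for x
  proof -
    have "(\<lambda>s. norm (f (x + s *\<^sub>R b) - f x - s *\<^sub>R pd b f x) / \<bar>s\<bar>) \<midarrow>0\<rightarrow> 0"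
      using line[of x 0 UNIV] by (simp add: has_derivative_at)
    moreover have "\<forall>\<^sub>F s in at 0. norm (f (x + s *\<^sub>R b) - f x - s *\<^sub>R pd b f x) / \<bar>s\<bar>
        = norm ((f (x + s *\<^sub>R b) - f x) /\<^sub>R s - pd b f x)"
    proof -
      have "norm (f (x + s *\<^sub>R b) - f x - s *\<^sub>R pd b f x) / \<bar>s\<bar>
        = norm ((f (x + s *\<^sub>R b) - f x) /\<^sub>R s - pd b f x)" if "s \<noteq> 0" for s :: real
      proof -
        have "(f (x + s *\<^sub>R b) - f x) /\<^sub>R s - pd b f x
            = inverse s *\<^sub>R (f (x + s *\<^sub>R b) - f x - s *\<^sub>R pd b f x)"
          using that by (simp add: scaleR_diff_right)
        then show ?thesis by (simp add: divide_inverse mult.commute)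
      qed
      then show ?thesis by (simp add: eventually_at_filter)
    qed
    ultimately have "((\<lambda>s. (f (x + s *\<^sub>R b) - f x) /\<^sub>R s) \<longlongrightarrow> pd b f x) (at 0)"
      by (subst LIM_zero_iff[symmetric], subst tendsto_norm_zero_iff[symmetric])
         (rule Lim_transform_eventually)
    moreover have "filterlim t (at 0) sequentially"
      unfolding filterlim_at using t0 t(1) by (auto simp: less_imp_neq[symmetric] intro!: always_eventually)
    ultimately show ?thesis
      unfolding D_def by (rule filterlim_compose)
  qed
  \<comment> \<open>The radius \<open>R + 1\<close> leaves room for a shift by
    \<open>t n \<le> 1\<close> in a unit direction: outside that ball both points of the quotient
    miss \<open>K\<close>. Inside it the mean value inequality along the line gives
    \<open>C\<close>.\<close>
  have Dbd: "norm (D n x) \<le> C * indicator (cball 0 (R + 1)) x" for n x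
  proof (cases "x \<in> cball 0 (R + 1)")
    case True
    have "norm (f (x + t n *\<^sub>R b) - f (x + 0 *\<^sub>R b)) \<le> C * norm (t n - 0)"
    proof (rule differentiable_bound[of "{0..t n}"])
      show "onorm (\<lambda>h. h *\<^sub>R pd b f (x + s *\<^sub>R b)) \<le> C" for s
        by (rule onorm_le) (use C in \<open>simp add: mult.commute[of C] mult_left_mono\<close>)
    qed (use t in \<open>auto intro: line less_imp_le\<close>)
    moreover have "norm (D n x) = norm (f (x + t n *\<^sub>R b) - f x) / t n"
      using t(1)[of n] by (simp add: D_def divide_inverse mult.commute)
    ultimately show ?thesis
      using t(1)[of n] True by (simp add: pos_divide_le_eq)
  next
    case False
    then have "x \<notin> K" using R by fastforce
    moreover have "norm (x + t n *\<^sub>R b) > R"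
    proof -
      have "norm x \<le> norm (x + t n *\<^sub>R b) + norm (t n *\<^sub>R b)"
        using norm_triangle_ineq4[of "x + t n *\<^sub>R b" "t n *\<^sub>R b"] by simp
      with False t[of n] b show ?thesis by (simp add: dist_norm)
    qed
    then have "x + t n *\<^sub>R b \<notin> K" using R by fastforce
    ultimately show ?thesis using K False by (simp add: D_def)
  qed
  have intf: "integrable lborel f"
  proof -
    have "f = (\<lambda>x. indicator K x *\<^sub>R f x)" using K(3) by (auto simp: indicator_def)
    then show ?thesis
      using borel_integrable_compact[OF K(1) continuous_on_subset[OF cf]] by (simp add: set_integrable_def)
  qed
  have plus: "distr lborel borel ((+) c) = (lborel :: 'a measure)" for c :: 'a
    by (rule lborel_distr_plus)
  have intD: "(LINT x|lborel. D n x) = 0" for n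
  proof -
    have eq: "(LINT x|lborel. f (t n *\<^sub>R b + x)) = (LINT x|lborel. f x)"
      using integral_distr[of "(+) (t n *\<^sub>R b)" lborel borel f] by (simp add: plus)
    have i: "integrable lborel (\<lambda>x. f (t n *\<^sub>R b + x))"
      using integrable_distr[of "(+) (t n *\<^sub>R b)" lborel borel f] intf by (simp add: plus)
    show ?thesis
      unfolding D_def using eq i intf by (simp add: add.commute)
  qed
  have "(\<lambda>n. LINT x|lborel. D n x) \<longlonglongrightarrow> (LINT x|lborel. pd b f x)"
  proof (rule integral_dominated_convergence)
    show "integrable lborel (\<lambda>x. C * indicator (cball 0 (R + 1)) x)"
      using emeasure_lborel_cball_finite[of 0 "R + 1"]
      by (intro integrable_mult_right integrable_real_indicator) (auto simp: less_top)
  qed (use Dlim Dbd in \<open>auto simp: D_def\<close>)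
  then have "(LINT x|lborel. pd b f x) = 0"
    using intD by (simp add: LIMSEQ_const_iff)
  \<comment> \<open>The derivative vanishes outside a compact part of \<Omega>, so its integral may
    be taken over the whole space, where translations act.\<close>
  moreover have "(LINT x|lebesgue_on \<Omega>. pd b f x) = (LINT x|lebesgue. pd b f x)"
  proof -
    have "(\<lambda>x. if x \<in> \<Omega> then pd b f x else 0) = pd b f" using K' by fastforce
    then show ?thesis using Lebesgue_Measure.integral_restrict_UNIV[OF \<Omega>, of "pd b f"] by simp
  qed
  ultimately show ?thesis by (simp add: integral_completion)
qed

lemma loc_integrable_bounded_mult:
  fixes g :: "'a::euclidean_space \<Rightarrow> 'b::euclidean_space" and \<psi> :: "'a \<Rightarrow> real"
  assumes \<Omega>: "\<Omega> \<in> sets lebesgue" and g: "loc_integrable \<Omega> g" and \<psi>: "test_function \<Omega> \<psi>"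
  shows "integrable (lebesgue_on \<Omega>) (\<lambda>x. \<psi> x *\<^sub>R g x)"
proof -
  obtain K where K: "compact K" "K \<subseteq> \<Omega>" "\<And>x. x \<notin> K \<Longrightarrow> \<psi> x = 0"
    using test_functionE[OF \<psi>] by blast
  obtain C where C: "0 \<le> C" "\<And>x. norm (\<psi> x) \<le> C"
    using test_bounded[OF \<psi>] by blast
  have sK: "K \<in> sets lebesgue" using K(1) by (simp add: compact_imp_closed borel_closed)
  have gK: "integrable (lebesgue_on K) g" using g K by (auto simp: loc_integrable_def)
  have "integrable (lebesgue_on K) (\<lambda>x. \<psi> x *\<^sub>R g x)"
  proof (rule Bochner_Integration.integrable_bound)
    show "integrable (lebesgue_on K) (\<lambda>x. C *\<^sub>R g x)" using gK by simp
    show "AE x in lebesgue_on K. norm (\<psi> x *\<^sub>R g x) \<le> norm (C *\<^sub>R g x)"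
      using C by (auto intro!: mult_right_mono)
  qed (use gK test_measurable[OF \<psi> sK] in \<open>auto intro: borel_measurable_scaleR\<close>)
  then have "integrable lebesgue (\<lambda>x. if x \<in> K then \<psi> x *\<^sub>R g x else 0)"
    by (simp add: Lebesgue_Measure.integrable_restrict_UNIV sK)
  moreover have "(\<lambda>x. if x \<in> K then \<psi> x *\<^sub>R g x else 0) = (\<lambda>x. if x \<in> \<Omega> then \<psi> x *\<^sub>R g x else 0)"
    using K by (intro ext) auto
  ultimately show ?thesis by (simp add: Lebesgue_Measure.integrable_restrict_UNIV[OF \<Omega>, symmetric])
qed

text \<open>Lebesgue differentiation: outside a null set the averages over small cubes with lower
  corner \<open>x\<close> converge to \<open>g x\<close>, and for \<open>x\<close> in the open box
  these averages vanish. The faces of the box form a null set.\<close>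

lemma AE_0_of_integral_boxes_0:
  fixes g :: "'a::euclidean_space \<Rightarrow> 'b::euclidean_space"
  assumes i: "integrable (lebesgue_on (cbox c d)) g"
    and 0: "\<And>a b. cbox a b \<subseteq> cbox c d \<Longrightarrow> (LINT x|lebesgue_on (cbox a b). g x) = 0"
  shows "negligible {x \<in> cbox c d. g x \<noteq> 0}"
proof -
  define f where "f x = (if x \<in> cbox c d then g x else 0)" for x
  have "integrable lebesgue f"
    unfolding f_def using i by (simp add: Lebesgue_Measure.integrable_restrict_UNIV)
  then have f: "integrable (lebesgue_on (cbox a b)) f" for a b
    by (simp add: integrable_restrict_space integrable_mult_indicator)
  then have "f integrable_on cbox a b" for a b
    by (intro integrable_on_lebesgue_on) auto
  then obtain N where N: "negligible N" "\<And>x e. \<lbrakk>x \<notin> N; 0 < e\<rbrakk> \<Longrightarrow>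
      \<exists>r>0. \<forall>h. 0 < h \<and> h < r \<longrightarrow> norm (integral (cbox x (x + h *\<^sub>R One)) f /\<^sub>R h ^ DIM('a) - f x) < e"
    using integrable_ccontinuous_explicit by blast
  have "g x = 0" if x: "x \<in> box c d" "x \<notin> N" for x
  proof (rule ccontr)
    assume "g x \<noteq> 0"
    then obtain r where r: "r > 0" "\<And>h. 0 < h \<Longrightarrow> h < r \<Longrightarrow>
        norm (integral (cbox x (x + h *\<^sub>R One)) f /\<^sub>R h ^ DIM('a) - f x) < norm (g x)"
      using N(2)[of x "norm (g x)"] x by auto
    obtain s where s: "s > 0" "\<And>i. i \<in> Basis \<Longrightarrow> s \<le> d \<bullet> i - x \<bullet> i"
    proof
      show "0 < Min ((\<lambda>i. d \<bullet> i - x \<bullet> i) ` Basis)"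
        using x by (subst Min_gr_iff) (auto simp: mem_box)
    qed auto
    \<comment> \<open>\<open>r / 2\<close> keeps \<open>h\<close> strictly below \<open>r\<close>,
      and \<open>s\<close> keeps the cube below the upper faces of the box.\<close>
    define h where "h = min (r / 2) s"
    have h: "0 < h" "h < r" "h \<le> s" using r s by (auto simp: h_def)
    have sub: "cbox x (x + h *\<^sub>R One) \<subseteq> cbox c d"
      using x s(2) h by (force simp: subset_box mem_box inner_add_left)
    have "integral (cbox x (x + h *\<^sub>R One)) f = (LINT y|lebesgue_on (cbox x (x + h *\<^sub>R One)). f y)"
      by (rule lebesgue_integral_eq_integral[symmetric]) (use f in auto)
    also have "\<dots> = (LINT y|lebesgue_on (cbox x (x + h *\<^sub>R One)). g y)"
      using sub by (intro Bochner_Integration.integral_cong) (auto simp: f_def)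
    also have "\<dots> = 0" by (rule 0[OF sub])
    finally show False
      using r(2)[of h] h x box_subset_cbox[of c d] by (auto simp: f_def split: if_splits)
  qed
  then have "{x \<in> cbox c d. g x \<noteq> 0} \<subseteq> (cbox c d - box c d) \<union> N" by auto
  then show ?thesis
    using negligible_frontier_interval N(1) negligible_subset negligible_Un by blast
qed

text \<open>The fundamental lemma of the calculus of variations. Saturated bumps converge boundedly
  to the indicator of a box, so all integrals of \<open>g\<close> over boxes inside \<Omega> vanish,
  and countably many boxes cover \<Omega>.\<close>

lemma AE_0_of_test_integrals_0:
  fixes g :: "'a::euclidean_space \<Rightarrow> 'b::euclidean_space"
  assumes \<Omega>: "open \<Omega>" and g: "loc_integrable \<Omega> g"
    and 0: "\<And>\<psi>::'a \<Rightarrow> real. test_function \<Omega> \<psi> \<Longrightarrow> (LINT x|lebesgue_on \<Omega>. \<psi> x *\<^sub>R g x) = 0"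
  shows "AE x in lebesgue_on \<Omega>. g x = 0"
proof -
  have s\<Omega>: "\<Omega> \<in> sets lebesgue" using \<Omega> by auto
  have box0: "(LINT x|lebesgue_on (cbox a b). g x) = 0" if ab: "cbox a b \<subseteq> \<Omega>" for a b
  proof -
    define \<psi> where "\<psi> n x = 1 * (1 - exp (- (real n * box_bump a b x)))" for n x
    let ?F = "\<lambda>n x. if x \<in> \<Omega> then \<psi> n x *\<^sub>R g x else 0" and ?G = "\<lambda>x. if x \<in> cbox a b then g x else 0"
    have \<psi>: "test_function \<Omega> (\<psi> n)" for n
      unfolding \<psi>_def by (intro test_saturate test_box_bump ab)
    have gK: "integrable (lebesgue_on (cbox a b)) g"
      using g ab by (auto simp: loc_integrable_def)
    then have iK: "integrable lebesgue (\<lambda>x. ?G x)"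
      by (simp add: Lebesgue_Measure.integrable_restrict_UNIV)
    have \<psi>bd: "0 \<le> \<psi> n x" "\<psi> n x \<le> 1" for n x
      using box_bump_nonneg[of a b x] by (auto simp: \<psi>_def)
    have "\<psi> n x = 0" if "x \<notin> box a b" for n x
      using that box_bump_pos_iff[of a b x] box_bump_nonneg[of a b x] by (simp add: \<psi>_def)
    then have \<psi>0: "\<psi> n x = 0" if "x \<notin> cbox a b" for n x
      using that box_subset_cbox by blast
    have \<psi>1: "(\<lambda>n. \<psi> n x) \<longlonglongrightarrow> 1" if "x \<in> box a b" for x
    proof -
      have "0 < box_bump a b x" using that by (simp add: box_bump_pos_iff)
      then have "(\<lambda>n. 1 * (1 - exp (- box_bump a b x) ^ n)) \<longlonglongrightarrow> 1 * (1 - 0)"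
        by (intro tendsto_intros LIMSEQ_realpow_zero) auto
      then show ?thesis by (simp add: \<psi>_def exp_of_nat_mult[symmetric])
    qed
    have "(\<lambda>n. LINT x|lebesgue. ?F n x)
       \<longlonglongrightarrow> (LINT x|lebesgue. ?G x)"
    proof (rule integral_dominated_convergence)
      show "integrable lebesgue (\<lambda>x. norm (?G x))"
        using iK by (rule integrable_norm)
      show "(\<lambda>x. ?F n x) \<in> borel_measurable lebesgue" for n
        using loc_integrable_bounded_mult[OF s\<Omega> g \<psi>] by (simp add:
          Lebesgue_Measure.integrable_restrict_UNIV[OF s\<Omega>, symmetric] borel_measurable_integrable)
      show "(\<lambda>x. ?G x) \<in> borel_measurable lebesgue"
        using iK by (rule borel_measurable_integrable)
      show "AE x in lebesgue. norm (?F n x)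
          \<le> norm (?G x)" for n
        using \<psi>bd[of n] \<psi>0[of _ n] by (intro always_eventually) (auto intro: mult_left_le_one_le)
      have "cbox a b - box a b \<in> null_sets lebesgue"
        using negligible_frontier_interval by (simp add: negligible_iff_null_sets)
      then show "AE x in lebesgue. (\<lambda>n. ?F n x)
          \<longlonglongrightarrow> ?G x"
      proof (rule eventually_mono[OF AE_not_in])
        fix x assume "x \<notin> cbox a b - box a b"
        moreover have "(\<lambda>n. ?F n x) \<longlonglongrightarrow> ?G x"
          if "x \<notin> cbox a b"
          using that \<psi>0 by (auto intro!: tendsto_eventually)
        moreover have "(\<lambda>n. ?F n x) \<longlonglongrightarrow> ?G x"
          if "x \<in> box a b"
          using tendsto_scaleR[OF \<psi>1[OF that] tendsto_const[of "g x"]] that ab box_subset_cbox[of a b]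
            by auto
        ultimately show "(\<lambda>n. ?F n x)
          \<longlonglongrightarrow> ?G x" by blast
      qed
    qed
    moreover have "(LINT x|lebesgue. ?F n x) = 0" for n
      using 0[OF \<psi>] by (simp add: Lebesgue_Measure.integral_restrict_UNIV s\<Omega>)
    ultimately have "(LINT x|lebesgue. ?G x) = 0"
      by (simp add: LIMSEQ_const_iff)
    then show ?thesis by (simp add: Lebesgue_Measure.integral_restrict_UNIV)
  qed
  obtain \<D> where D: "countable \<D>" "\<D> \<subseteq> Pow \<Omega>" "\<And>X. X \<in> \<D> \<Longrightarrow> \<exists>a b. X = cbox a b" "\<Union>\<D> = \<Omega>"
    using open_countable_Union_open_cbox[OF \<Omega>] by metis
  have "negligible {x \<in> X. g x \<noteq> 0}" if X: "X \<in> \<D>" for X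
  proof -
    obtain c d where cd: "X = cbox c d" "cbox c d \<subseteq> \<Omega>" using D X by blast
    show ?thesis
      unfolding cd(1)
      by (rule AE_0_of_integral_boxes_0) (use g cd box0 in \<open>auto simp: loc_integrable_def\<close>)
  qed
  then have "negligible (\<Union>X\<in>\<D>. {x \<in> X. g x \<noteq> 0})"
    using D(1) by (intro negligible_countable_Union) auto
  moreover have "(\<Union>X\<in>\<D>. {x \<in> X. g x \<noteq> 0}) = {x \<in> \<Omega>. g x \<noteq> 0}" using D(4) by auto
  ultimately have "{x \<in> \<Omega>. g x \<noteq> 0} \<in> null_sets lebesgue" by (simp add: negligible_iff_null_sets)
  then have "AE x in lebesgue. x \<in> \<Omega> \<longrightarrow> g x = 0" by (rule AE_I') auto
  then show ?thesis using s\<Omega> by (simp add: AE_restrict_space_iff)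
qed

lemma loc_integrable_diff:
  "loc_integrable \<Omega> u \<Longrightarrow> loc_integrable \<Omega> v \<Longrightarrow> loc_integrable \<Omega> (\<lambda>x. u x - v x)"
  by (auto simp: loc_integrable_def)

text \<open>Every computation with the representative chosen by \<open>weak_pd\<close> rests on
  this: it may be exchanged, up to a null set, for any derivative found by hand.\<close>

lemma weak_pd_unique:
  fixes u :: "'a::euclidean_space \<Rightarrow> 'b::euclidean_space"
  assumes \<Omega>: "open \<Omega>" and g: "has_weak_pd \<Omega> b u g" and g': "has_weak_pd \<Omega> b u g'"
  shows "AE x in lebesgue_on \<Omega>. g x = g' x"
proof -
  have s\<Omega>: "\<Omega> \<in> sets lebesgue" using \<Omega> by auto
  have l: "loc_integrable \<Omega> g" "loc_integrable \<Omega> g'" using g g' by (auto simp: has_weak_pd_def)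
  have "AE x in lebesgue_on \<Omega>. g x - g' x = 0"
  proof (rule AE_0_of_test_integrals_0[OF \<Omega> loc_integrable_diff[OF l]])
    fix \<psi> :: "'a \<Rightarrow> real" assume \<psi>: "test_function \<Omega> \<psi>"
    have "(LINT x|lebesgue_on \<Omega>. \<psi> x *\<^sub>R g x) = (LINT x|lebesgue_on \<Omega>. \<psi> x *\<^sub>R g' x)"
      using g g' \<psi> unfolding has_weak_pd_def by (metis add.inverse_inverse)
    then show "(LINT x|lebesgue_on \<Omega>. \<psi> x *\<^sub>R (g x - g' x)) = 0"
      using loc_integrable_bounded_mult[OF s\<Omega> l(1) \<psi>] loc_integrable_bounded_mult[OF s\<Omega> l(2) \<psi>]
      by (simp add: scaleR_diff_right)
  qed
  then show ?thesis by eventually_elim simp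
qed

section \<open>The spaces \<open>H\<^sup>1\<close> and \<open>H\<^sub>0\<^sup>1\<close>\<close>

context bounded_open begin

lemma integrable_on_subset_\<Omega>:
  fixes u :: "'a \<Rightarrow> 'b::euclidean_space"
  assumes u: "integrable M u" and K: "K \<in> sets lebesgue" "K \<subseteq> \<Omega>"
  shows "integrable (lebesgue_on K) u"
proof -
  have "integrable lebesgue (\<lambda>x. indicator K x *\<^sub>R (indicator \<Omega> x *\<^sub>R u x))"
    by (rule integrable_mult_indicator) (use u K in \<open>auto simp: integrable_restrict_space sets_\<Omega>\<close>)
  moreover have "(\<lambda>x. indicator K x *\<^sub>R (indicator \<Omega> x *\<^sub>R u x)) = (\<lambda>x. indicator K x *\<^sub>R u x)"
    using K by (intro ext) (auto simp: indicator_def)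
  ultimately show ?thesis using K by (simp add: integrable_restrict_space)
qed

lemma integrable_imp_loc_integrable:
  fixes u :: "'a \<Rightarrow> 'b::euclidean_space"
  assumes "integrable M u"
  shows "loc_integrable \<Omega> u"
  unfolding loc_integrable_def
proof (intro allI impI; elim conjE)
  show "integrable (lebesgue_on K) u" if "compact K" "K \<subseteq> \<Omega>" for K
    using integrable_on_subset_\<Omega>[OF assms, of K] that by (simp add: compact_imp_closed borel_closed)
qed

lemma Lp2_loc_integrable:
  fixes u :: "'a \<Rightarrow> 'b::euclidean_space"
  assumes "L2 u"
  shows "loc_integrable \<Omega> u"
  by (rule integrable_imp_loc_integrable[OF Lp2_integrable[OF assms]])

lemma test_Lp:
  fixes f :: "'a \<Rightarrow> 'b::euclidean_space"
  assumes "test_function \<Omega>' f" shows "Lp p \<Omega> f"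
proof -
  have m: "f \<in> borel_measurable M"
    by (rule test_measurable[OF assms sets_\<Omega>])
  obtain C where C: "\<And>x. norm (f x) \<le> C" using test_bounded[OF assms] by blast
  have "integrable M (\<lambda>x. norm (f x) ^ p)"
    by (rule Bochner_Integration.integrable_bound[OF integrable_const_\<Omega>[of "C ^ p"]])
       (use m C in \<open>auto intro!: power_mono order_trans[OF _ abs_ge_self]\<close>)
  with m show ?thesis by (simp add: Lp_def)
qed

text \<open>Integration by parts is \<open>integral_pd_eq_0\<close> applied to the product with the
  second test function.\<close>

lemma test_has_weak_pd:
  fixes f :: "'a \<Rightarrow> 'b::euclidean_space"
  assumes f: "test f" and b: "b \<in> Basis"
  shows "has_weak_pd \<Omega> b f (pd b f)"
  unfolding has_weak_pd_def
proof (intro conjI allI impI)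
  show "loc_integrable \<Omega> f" "loc_integrable \<Omega> (pd b f)"
    using test_Lp[OF f] test_Lp[OF test_pd[OF f b]]
    by (auto intro: Lp2_loc_integrable)
  fix \<psi> :: "'a \<Rightarrow> real" assume \<psi>: "test \<psi>"
  have t: "test (\<lambda>x. \<psi> x *\<^sub>R f x)"
    by (rule test_bilinear[OF bounded_bilinear_scaleR \<psi> test_Ck[OF f]])
  have "pd b (\<lambda>x. \<psi> x *\<^sub>R f x) = (\<lambda>x. \<psi> x *\<^sub>R pd b f x + pd b \<psi> x *\<^sub>R f x)"
    by (intro ext pd_bilinear[OF bounded_bilinear_scaleR] test_differentiable[OF \<psi>]
        test_differentiable[OF f])
  with integral_pd_eq_0[OF sets_\<Omega> t b]
  have "0 = (LINT x|M. \<psi> x *\<^sub>R pd b f x + pd b \<psi> x *\<^sub>R f x)"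
    by simp
  also have "\<dots> = (LINT x|M. \<psi> x *\<^sub>R pd b f x) + (LINT x|M. pd b \<psi> x *\<^sub>R f x)"
    by (intro Bochner_Integration.integral_add integrable_bilinear[OF bounded_bilinear_scaleR]
      test_Lp[OF \<psi>] test_Lp[OF f] test_Lp[OF test_pd[OF f b]]
      test_Lp[OF test_pd[OF \<psi> b]])
  finally show "(LINT x|M. pd b \<psi> x *\<^sub>R f x) = - (LINT x|M. \<psi> x *\<^sub>R pd b f x)"
    by (simp add: eq_neg_iff_add_eq_0 add.commute)
qed

lemma weak_pd_AE:
  fixes u :: "'a \<Rightarrow> 'b::euclidean_space"
  assumes "has_weak_pd \<Omega> b u g"
  shows "AE x in M. D b u x = g x"
  unfolding weak_pd_def by (rule weak_pd_unique[OF open_\<Omega> someI[of "has_weak_pd \<Omega> b u"]]) (fact assms)+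

lemma has_weak_pd_weak_pd:
  fixes u :: "'a \<Rightarrow> 'b::euclidean_space"
  assumes "has_weak_pd \<Omega> b u g"
  shows "has_weak_pd \<Omega> b u (D b u)"
  unfolding weak_pd_def by (rule someI[of "has_weak_pd \<Omega> b u"]) (fact assms)

text \<open>A chosen weak derivative is known to be integrable on compact subsets only;
  measurability on \<Omega> is assembled from a countable cover by boxes.\<close>

lemma loc_integrable_measurable:
  fixes g :: "'a \<Rightarrow> 'b::euclidean_space"
  assumes g: "loc_integrable \<Omega> g"
  shows "g \<in> borel_measurable M"
proof -
  obtain \<D> where D: "countable \<D>" "\<D> \<subseteq> Pow \<Omega>" "\<And>X. X \<in> \<D> \<Longrightarrow> \<exists>a b. X = cbox a b" "\<Union>\<D> = \<Omega>"
    using open_countable_Union_open_cbox[OF open_\<Omega>] by metis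
  show ?thesis
  proof (rule measurable_piecewise_restrict[OF D(1)])
    show "X \<inter> space M \<in> sets M" if "X \<in> \<D>" for X
      using D(3)[OF that] D(2) that sets_\<Omega> by (auto simp: sets_restrict_space)
    show "space M \<subseteq> \<Union>\<D>" using D(4) by simp
    show "g \<in> borel_measurable (restrict_space M X)" if X: "X \<in> \<D>" for X
    proof -
      obtain a b where ab: "X = cbox a b" "X \<subseteq> \<Omega>" using D X by blast
      then have "restrict_space M X = lebesgue_on X"
        using ab(2) sets_\<Omega> by (subst restrict_restrict_space) (auto simp: Int_absorb1 ab(1))
      moreover have "integrable (lebesgue_on X) g" using g ab by (auto simp: loc_integrable_def)
      ultimately show ?thesis by (simp add: borel_measurable_integrable)
    qed
  qed
qed

lemma weak_pd_Lp2:
  fixes u :: "'a \<Rightarrow> 'b::euclidean_space"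
  assumes "has_weak_pd \<Omega> b u g" "L2 g"
  shows "L2 (D b u)"
proof (rule Lp2_bound[OF assms(2), of _ 1])
  show "D b u \<in> borel_measurable M"
    using has_weak_pd_weak_pd[OF assms(1)] by (auto simp: has_weak_pd_def intro: loc_integrable_measurable)
  show "AE x in M. norm (D b u x) \<le> 1 * norm (g x)"
    using weak_pd_AE[OF assms(1)] by eventually_elim simp
qed

lemma H1D:
  assumes "H1 \<Omega> u"
  shows "L2 u" "\<And>b. b \<in> Basis \<Longrightarrow> L2 (D b u)"
    "\<And>b. b \<in> Basis \<Longrightarrow> has_weak_pd \<Omega> b u (D b u)"
  using assms by (auto simp: H1_def intro: weak_pd_Lp2 has_weak_pd_weak_pd)

lemma has_weak_pd_lincomb:
  fixes u v :: "'a \<Rightarrow> 'b::euclidean_space"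
  assumes u: "has_weak_pd \<Omega> b u g" and v: "has_weak_pd \<Omega> b v h" and b: "b \<in> Basis"
  shows "has_weak_pd \<Omega> b (\<lambda>x. r *\<^sub>R u x + s *\<^sub>R v x) (\<lambda>x. r *\<^sub>R g x + s *\<^sub>R h x)"
  unfolding has_weak_pd_def
proof (intro conjI allI impI)
  have l: "loc_integrable \<Omega> u" "loc_integrable \<Omega> v" "loc_integrable \<Omega> g" "loc_integrable \<Omega> h"
    using u v by (auto simp: has_weak_pd_def)
  then show "loc_integrable \<Omega> (\<lambda>x. r *\<^sub>R u x + s *\<^sub>R v x)" "loc_integrable \<Omega> (\<lambda>x. r *\<^sub>R g x + s *\<^sub>R h x)"
    by (auto simp: loc_integrable_def)
  fix \<psi> :: "'a \<Rightarrow> real" assume \<psi>: "test \<psi>"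
  note i = loc_integrable_bounded_mult[OF sets_\<Omega>, OF _ \<psi>]
    loc_integrable_bounded_mult[OF sets_\<Omega>, OF _ test_pd[OF \<psi> b]]
  have lc: "(LINT x|M. \<eta> x *\<^sub>R (r *\<^sub>R f x + s *\<^sub>R k x)) =
     r *\<^sub>R (LINT x|M. \<eta> x *\<^sub>R f x) + s *\<^sub>R (LINT x|M. \<eta> x *\<^sub>R k x)"
    if "integrable M (\<lambda>x. \<eta> x *\<^sub>R f x)" "integrable M (\<lambda>x. \<eta> x *\<^sub>R k x)"
    for \<eta> :: "'a \<Rightarrow> real" and f k :: "'a \<Rightarrow> 'b"
  proof -
    have "(\<lambda>x. \<eta> x *\<^sub>R (r *\<^sub>R f x + s *\<^sub>R k x)) = (\<lambda>x. r *\<^sub>R (\<eta> x *\<^sub>R f x) + s *\<^sub>R (\<eta> x *\<^sub>R k x))"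
      by (simp add: scaleR_add_right mult.commute)
    then show ?thesis using that by (simp del: scaleR_scaleR)
  qed
  show "(LINT x|M. pd b \<psi> x *\<^sub>R (r *\<^sub>R u x + s *\<^sub>R v x)) =
       - (LINT x|M. \<psi> x *\<^sub>R (r *\<^sub>R g x + s *\<^sub>R h x))"
    using u v \<psi> unfolding lc[OF i(1)[OF l(3)] i(1)[OF l(4)]] lc[OF i(2)[OF l(1)] i(2)[OF l(2)]]
    by (simp add: has_weak_pd_def)
qed

lemma H1_lincomb:
  assumes u: "H1 \<Omega> u" and v: "H1 \<Omega> v"
  shows "H1 \<Omega> (\<lambda>x. r *\<^sub>R u x + s *\<^sub>R v x)"
  unfolding H1_def
proof (intro conjI ballI)
  show "L2 (\<lambda>x. r *\<^sub>R u x + s *\<^sub>R v x)"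
    by (intro Lp2_add Lp2_scaleR H1D u v)
  show "\<exists>g. L2 g \<and> has_weak_pd \<Omega> b (\<lambda>x. r *\<^sub>R u x + s *\<^sub>R v x) g" if b: "b \<in> Basis" for b
    using has_weak_pd_lincomb[OF H1D(3)[OF u b] H1D(3)[OF v b] b]
      Lp2_add[OF Lp2_scaleR[OF H1D(2)[OF u b]] Lp2_scaleR[OF H1D(2)[OF v b]]] by blast
qed

lemma weak_pd_lincomb_AE:
  assumes "H1 \<Omega> u" "H1 \<Omega> v" "b \<in> Basis"
  shows "AE x in M. D b (\<lambda>x. r *\<^sub>R u x + s *\<^sub>R v x) x
     = r *\<^sub>R D b u x + s *\<^sub>R D b v x"
  by (rule weak_pd_AE[OF has_weak_pd_lincomb[OF H1D(3)[OF assms(1,3)] H1D(3)[OF assms(2,3)] assms(3)]])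

lemma H1_diff: "H1 \<Omega> u \<Longrightarrow> H1 \<Omega> v \<Longrightarrow> H1 \<Omega> (\<lambda>x. u x - v x)"
  using H1_lincomb[of u v 1 "-1"] by simp

lemma weak_pd_diff_AE:
  assumes "H1 \<Omega> u" "H1 \<Omega> v" "b \<in> Basis"
  shows "AE x in M. D b (\<lambda>x. u x - v x) x
     = D b u x - D b v x"
  using weak_pd_lincomb_AE[OF assms, of 1 "-1"] by simp

lemma integral_grad_sq:
  assumes "\<And>b. b \<in> Basis \<Longrightarrow> L2 (D b u)"
  shows "integrable M (grad_sq \<Omega> u)"
    "(LINT x|M. grad_sq \<Omega> u x) = (\<Sum>b\<in>Basis. (nrm (D b u))\<^sup>2)"
  using assms by (simp_all add: grad_sq_def[abs_def] L2_norm_sq Lp2D)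

lemma L2_norm_weak_pd_diff:
  assumes u: "H1 \<Omega> u" and v: "H1 \<Omega> v" and b: "b \<in> Basis"
  shows "nrm (D b (\<lambda>x. u x - v x)) = nrm (\<lambda>x. D b u x - D b v x)"
proof (rule L2_norm_cong_AE)
  show "AE x in M. norm (D b (\<lambda>x. u x - v x) x) = norm (D b u x - D b v x)"
    using weak_pd_diff_AE[OF u v b] by eventually_elim simp
qed (use H1D(2)[OF H1_diff[OF u v] b] H1D(2)[OF u b] H1D(2)[OF v b] in \<open>auto simp: Lp_def\<close>)

lemma H1_norm_diff_sq:
  assumes u: "H1 \<Omega> u" and v: "H1 \<Omega> v"
  shows "(H1_norm \<Omega> (\<lambda>x. u x - v x))\<^sup>2 = (nrm (\<lambda>x. u x - v x))\<^sup>2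
    + (\<Sum>b\<in>Basis. (nrm (\<lambda>x. D b u x - D b v x))\<^sup>2)"
proof -
  note d = H1_diff[OF u v]
  show ?thesis
    unfolding H1_norm_def
    by (subst real_sqrt_pow2) (auto simp: integral_grad_sq(2)[OF H1D(2)[OF d]] L2_norm_weak_pd_diff[OF u v]
        L2_norm_sq[symmetric] sum_nonneg)
qed

text \<open>The norm involves the weak derivative of a difference, which agrees only almost
  everywhere with the difference of weak derivatives. The equivalence reduces all later convergence
  proofs to one mean square limit per component.\<close>

lemma H1_tendsto_iff:
  assumes u: "\<forall>\<^sub>F i in F. H1 \<Omega> (u i)" and v: "H1 \<Omega> v"
  shows "H1_tendsto \<Omega> u v F \<longleftrightarrow> ((\<lambda>i. nrm (\<lambda>x. u i x - v x)) \<longlongrightarrow> 0) F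
    \<and> (\<forall>b\<in>Basis. ((\<lambda>i. nrm (\<lambda>x. D b (u i) x - D b v x)) \<longlongrightarrow> 0) F)"
  (is "_ \<longleftrightarrow> (?A \<longlongrightarrow> 0) F \<and> (\<forall>b\<in>Basis. (?B b \<longlongrightarrow> 0) F)")
proof -
  have eq: "\<forall>\<^sub>F i in F. (H1_norm \<Omega> (\<lambda>x. u i x - v x))\<^sup>2 = (?A i)\<^sup>2 + (\<Sum>b\<in>Basis. (?B b i)\<^sup>2)"
    using u by eventually_elim (rule H1_norm_diff_sq[OF _ v])
  have "H1_tendsto \<Omega> u v F \<longleftrightarrow> ((\<lambda>i. (H1_norm \<Omega> (\<lambda>x. u i x - v x))\<^sup>2) \<longlongrightarrow> 0) F"
    using u v by (simp add: H1_tendsto_def tendsto_0_power2_iff)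
  also have "\<dots> \<longleftrightarrow> ((\<lambda>i. (?A i)\<^sup>2 + (\<Sum>b\<in>Basis. (?B b i)\<^sup>2)) \<longlongrightarrow> 0) F"
    by (rule tendsto_cong[OF eq])
  also have "\<dots> \<longleftrightarrow> (?A \<longlongrightarrow> 0) F \<and> (\<forall>b\<in>Basis. (?B b \<longlongrightarrow> 0) F)"
  proof safe
    assume t: "((\<lambda>i. (?A i)\<^sup>2 + (\<Sum>b\<in>Basis. (?B b i)\<^sup>2)) \<longlongrightarrow> 0) F"
    have "((\<lambda>i. (?A i)\<^sup>2) \<longlongrightarrow> 0) F"
      by (rule tendsto_sandwich[OF _ _ tendsto_const t]) (auto intro!: always_eventually sum_nonneg)
    then show "(?A \<longlongrightarrow> 0) F" by (simp only: tendsto_0_power2_iff)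
    fix b :: 'a assume b: "b \<in> Basis"
    have "(?B b i)\<^sup>2 \<le> (\<Sum>b\<in>Basis. (?B b i)\<^sup>2)" for i
      using b by (intro member_le_sum) auto
    then have "(?B b i)\<^sup>2 \<le> (?A i)\<^sup>2 + (\<Sum>b\<in>Basis. (?B b i)\<^sup>2)" for i
      by (meson add_increasing zero_le_power2)
    then have "((\<lambda>i. (?B b i)\<^sup>2) \<longlongrightarrow> 0) F"
      by (intro tendsto_sandwich[OF _ _ tendsto_const t]) (auto intro!: always_eventually)
    then show "(?B b \<longlongrightarrow> 0) F" by (simp only: tendsto_0_power2_iff)
  next
    assume "(?A \<longlongrightarrow> 0) F" "\<forall>b\<in>Basis. (?B b \<longlongrightarrow> 0) F"
    then have "((\<lambda>i. (?A i)\<^sup>2 + (\<Sum>b\<in>Basis. (?B b i)\<^sup>2)) \<longlongrightarrow> 0\<^sup>2 + (\<Sum>b::'a\<in>Basis. 0\<^sup>2)) F"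
      by (intro tendsto_intros) auto
    then show "((\<lambda>i. (?A i)\<^sup>2 + (\<Sum>b\<in>Basis. (?B b i)\<^sup>2)) \<longlongrightarrow> 0) F" by simp
  qed
  finally show ?thesis .
qed

text \<open>The weak derivative is a closed operator: both sides of its defining identity are
  continuous in mean square for a fixed test function.\<close>

lemma weak_pd_L2_limit:
  fixes u :: "nat \<Rightarrow> 'a \<Rightarrow> 'b::euclidean_space"
  assumes b: "b \<in> Basis" and w: "\<And>n. has_weak_pd \<Omega> b (u n) (g n)"
    and u: "\<And>n. L2 (u n)" "L2 u'" "L2_lim u u'"
    and g: "\<And>n. L2 (g n)" "L2 g'" "L2_lim g g'"
  shows "has_weak_pd \<Omega> b u' g'"
  unfolding has_weak_pd_def
proof (intro conjI allI impI Lp2_loc_integrable u(2) g(2))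
  fix \<psi> :: "'a \<Rightarrow> real" assume \<psi>: "test \<psi>"
  have z: "L2_lim (\<lambda>n x. f x) f" for f :: "'a \<Rightarrow> real"
    by (simp add: L2_norm_zero)
  note L = test_Lp[OF \<psi>, of 2] test_Lp[OF test_pd[OF \<psi> b], of 2]
  have "(\<lambda>n. LINT x|M. pd b \<psi> x *\<^sub>R u n x) \<longlonglongrightarrow> (LINT x|M. pd b \<psi> x *\<^sub>R u' x)"
    by (rule L2_conv_bilinear[OF bounded_bilinear_scaleR L(2) L(2) z u])
  moreover have "(\<lambda>n. LINT x|M. \<psi> x *\<^sub>R g n x) \<longlonglongrightarrow> (LINT x|M. \<psi> x *\<^sub>R g' x)"
    by (rule L2_conv_bilinear[OF bounded_bilinear_scaleR L(1) L(1) z g])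
  then have "(\<lambda>n. LINT x|M. pd b \<psi> x *\<^sub>R u n x) \<longlonglongrightarrow> - (LINT x|M. \<psi> x *\<^sub>R g' x)"
    using w \<psi> by (simp add: has_weak_pd_def tendsto_minus)
  ultimately show "(LINT x|M. pd b \<psi> x *\<^sub>R u' x) = - (LINT x|M. \<psi> x *\<^sub>R g' x)"
    by (rule LIMSEQ_unique)
qed

lemma test_H1: 
  fixes f :: "'a \<Rightarrow> 'b::euclidean_space"
  shows "test f \<Longrightarrow> H1 \<Omega> f"
  unfolding H1_def using test_Lp test_has_weak_pd test_pd by blast

lemma test_L2_norm_weak_pd:
  fixes f :: "'a \<Rightarrow> 'b::euclidean_space"
  assumes f: "test f" and b: "b \<in> Basis" and g: "L2 g"
  shows "nrm (\<lambda>x. D b f x - g x) = nrm (\<lambda>x. pd b f x - g x)"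
proof (rule L2_norm_cong_AE)
  show "AE x in M. norm (D b f x - g x) = norm (pd b f x - g x)"
    using weak_pd_AE[OF test_has_weak_pd[OF f b]] by eventually_elim simp
qed (use H1D(2)[OF test_H1[OF f] b] g test_Lp[OF test_pd[OF f b], of 2]
     in \<open>auto simp: Lp_def\<close>)

text \<open>The candidate gradient \<open>G\<close> is prescribed without knowing that
  \<open>u\<close> is weakly differentiable; its being a weak gradient is part of the
  conclusion.\<close>

lemma H10I:
  fixes u :: "'a \<Rightarrow> 'b::euclidean_space"
  assumes \<psi>: "\<And>n::nat. test (\<psi> n)"
    and u: "L2 u" "L2_lim \<psi> u"
    and G: "\<And>b. b \<in> Basis \<Longrightarrow> L2 (G b)"
      "\<And>b. b \<in> Basis \<Longrightarrow> L2_lim (\<lambda>n. pd b (\<psi> n)) (G b)"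
  shows "H10 \<Omega> u" "b \<in> Basis \<Longrightarrow> has_weak_pd \<Omega> b u (G b)"
proof -
  have w: "has_weak_pd \<Omega> b u (G b)" if b: "b \<in> Basis" for b
    by (rule weak_pd_L2_limit[OF b test_has_weak_pd[OF \<psi> b] test_Lp[OF \<psi>] u
        test_Lp[OF test_pd[OF \<psi> b]] G(1)[OF b] G(2)[OF b]])
  then show "b \<in> Basis \<Longrightarrow> has_weak_pd \<Omega> b u (G b)" .
  have H1u: "H1 \<Omega> u" unfolding H1_def using u(1) w G(1) by blast
  have "L2_lim (\<lambda>n. D b (\<psi> n)) (D b u)" if b: "b \<in> Basis" for b
  proof -
    have "nrm (\<lambda>x. D b (\<psi> n) x - D b u x) = nrm (\<lambda>x. pd b (\<psi> n) x - G b x)" for n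
      unfolding test_L2_norm_weak_pd[OF \<psi> b H1D(2)[OF H1u b]]
    proof (rule L2_norm_cong_AE)
      show "AE x in M. norm (pd b (\<psi> n) x - D b u x) = norm (pd b (\<psi> n) x - G b x)"
        using weak_pd_AE[OF w[OF b]] by eventually_elim simp
    qed (use H1D(2)[OF H1u b] G(1)[OF b] test_Lp[OF test_pd[OF \<psi> b], of 2 n]
         in \<open>auto simp: Lp_def\<close>)
    then show ?thesis using G(2)[OF b] by simp
  qed
  then have "H1_tendsto \<Omega> \<psi> u sequentially"
    using u(2) by (simp add: H1_tendsto_iff[OF always_eventually[OF allI[OF test_H1[OF \<psi>]]] H1u])
  with \<psi> show "H10 \<Omega> u" by (auto simp: H10_def)
qed

lemma H10_imp_H1: "H10 \<Omega> u \<Longrightarrow> H1 \<Omega> u"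
  by (auto simp: H10_def H1_tendsto_def)

lemma H10E:
  fixes u :: "'a \<Rightarrow> 'b::euclidean_space"
  assumes "H10 \<Omega> u"
  obtains \<psi> where "\<And>n::nat. test (\<psi> n)" "L2_lim \<psi> u"
    "\<And>b. b \<in> Basis \<Longrightarrow> L2_lim (\<lambda>n. pd b (\<psi> n)) (D b u)"
proof -
  obtain \<psi> where \<psi>: "\<And>n::nat. test (\<psi> n)" "H1_tendsto \<Omega> \<psi> u sequentially"
    using assms by (auto simp: H10_def)
  note u = H10_imp_H1[OF assms]
  have "L2_lim \<psi> u"
    "\<And>b. b \<in> Basis \<Longrightarrow> L2_lim (\<lambda>n. pd b (\<psi> n)) (D b u)"
    using \<psi>(2) test_L2_norm_weak_pd[OF \<psi>(1) _ H1D(2)[OF u]]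
    by (simp_all add: H1_tendsto_iff[OF always_eventually[OF allI[OF test_H1[OF \<psi>(1)]]] u])
  then show ?thesis using \<psi>(1) by (intro that)
qed

lemma test_H10:
  fixes f :: "'a \<Rightarrow> 'b::euclidean_space"
  assumes f: "test f" shows "H10 \<Omega> f"
  by (rule H10I(1)[of "\<lambda>_. f" f "\<lambda>b. pd b f"])
     (auto simp: f test_Lp[OF f] L2_norm_zero test_Lp[OF test_pd[OF f]])

lemma L2_norm_lincomb:
  fixes u v :: "'a \<Rightarrow> 'b::euclidean_space"
  assumes "L2 u" "L2 v"
  shows "nrm (\<lambda>x. r *\<^sub>R u x + s *\<^sub>R v x) \<le> \<bar>r\<bar> * nrm u + \<bar>s\<bar> * nrm v"
  using L2_norm_triangle[OF Lp2_scaleR[OF assms(1), of r] Lp2_scaleR[OF assms(2), of s]]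
  by (simp add: L2_norm_scaleR)

lemma L2_conv_lincomb:
  fixes u :: "nat \<Rightarrow> 'a \<Rightarrow> 'b::euclidean_space"
  assumes un: "\<And>n. L2 (u n)" and u: "L2 u'"
    and cu: "L2_lim u u'"
    and vn: "\<And>n. L2 (v n)" and v: "L2 v'"
    and cv: "L2_lim v v'"
  shows "L2_lim (\<lambda>n x. r *\<^sub>R u n x + s *\<^sub>R v n x) (\<lambda>x. r *\<^sub>R u' x + s *\<^sub>R v' x)"
proof (rule Lim_null_comparison)
  have "nrm (\<lambda>x. (r *\<^sub>R u n x + s *\<^sub>R v n x) - (r *\<^sub>R u' x + s *\<^sub>R v' x))
     \<le> \<bar>r\<bar> * nrm (\<lambda>x. u n x - u' x) + \<bar>s\<bar> * nrm (\<lambda>x. v n x - v' x)" for n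
    using L2_norm_lincomb[OF Lp2_diff[OF un u] Lp2_diff[OF vn v], of r n s n]
    by (simp add: algebra_simps)
  then show "\<forall>\<^sub>F n in sequentially.
      norm (nrm (\<lambda>x. (r *\<^sub>R u n x + s *\<^sub>R v n x) - (r *\<^sub>R u' x + s *\<^sub>R v' x)))
      \<le> \<bar>r\<bar> * nrm (\<lambda>x. u n x - u' x) + \<bar>s\<bar> * nrm (\<lambda>x. v n x - v' x)"
    by (simp add: L2_norm_nonneg)
  have "(\<lambda>n. \<bar>r\<bar> * nrm (\<lambda>x. u n x - u' x) + \<bar>s\<bar> * nrm (\<lambda>x. v n x - v' x))
    \<longlonglongrightarrow> \<bar>r\<bar> * 0 + \<bar>s\<bar> * 0"
    by (intro tendsto_intros cu cv)
  then show "(\<lambda>n. \<bar>r\<bar> * nrm (\<lambda>x. u n x - u' x) + \<bar>s\<bar> * nrm (\<lambda>x. v n x - v' x))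
    \<longlonglongrightarrow> 0" by simp
qed

lemma H10_lincomb:
  fixes u v :: "'a \<Rightarrow> 'b::euclidean_space"
  assumes u: "H10 \<Omega> u" and v: "H10 \<Omega> v"
  shows "H10 \<Omega> (\<lambda>x. r *\<^sub>R u x + s *\<^sub>R v x)"
proof -
  obtain \<psi> where \<psi>: "\<And>n::nat. test (\<psi> n)" "L2_lim \<psi> u"
    "\<And>b. b \<in> Basis \<Longrightarrow> L2_lim (\<lambda>n. pd b (\<psi> n)) (D b u)"
    using H10E[OF u] by blast
  obtain \<eta> where \<eta>: "\<And>n::nat. test (\<eta> n)" "L2_lim \<eta> v"
    "\<And>b. b \<in> Basis \<Longrightarrow> L2_lim (\<lambda>n. pd b (\<eta> n)) (D b v)"
    using H10E[OF v] by blast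
  note hu = H1D[OF H10_imp_H1[OF u]] and hv = H1D[OF H10_imp_H1[OF v]]
  have pd: "pd b (\<lambda>x. r *\<^sub>R \<psi> n x + s *\<^sub>R \<eta> n x) = (\<lambda>x. r *\<^sub>R pd b (\<psi> n) x + s *\<^sub>R pd b (\<eta> n) x)" for n b
    by (intro ext pd_lincomb test_differentiable[OF \<psi>(1)] test_differentiable[OF \<eta>(1)])
  show ?thesis
  proof (rule H10I(1)[of "\<lambda>n x. r *\<^sub>R \<psi> n x + s *\<^sub>R \<eta> n x" _ "\<lambda>b x. r *\<^sub>R D b u x + s *\<^sub>R D b v x"])
    show "test (\<lambda>x. r *\<^sub>R \<psi> n x + s *\<^sub>R \<eta> n x)" for n
      by (intro test_add test_linear[OF bounded_linear_scaleR_right] \<psi> \<eta>)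
    show "L2_lim (\<lambda>n x. r *\<^sub>R \<psi> n x + s *\<^sub>R \<eta> n x) (\<lambda>x. r *\<^sub>R u x + s *\<^sub>R v x)"
      by (rule L2_conv_lincomb[OF test_Lp[OF \<psi>(1)] hu(1) \<psi>(2) test_Lp[OF \<eta>(1)] hv(1) \<eta>(2)])
    show "L2_lim (\<lambda>n x. pd b (\<lambda>x. r *\<^sub>R \<psi> n x + s *\<^sub>R \<eta> n x) x) (\<lambda>x. r *\<^sub>R D b u x + s *\<^sub>R D b v x)" if
      b: "b \<in> Basis" for b
      unfolding pd
      by (rule L2_conv_lincomb[OF test_Lp[OF test_pd[OF \<psi>(1) b]] hu(2)[OF b] \<psi>(3)[OF b]
            test_Lp[OF test_pd[OF \<eta>(1) b]] hv(2)[OF b] \<eta>(3)[OF b]])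
  qed (intro Lp2_add Lp2_scaleR hu hv; assumption)+
qed

text \<open>A diagonal choice: each \<open>u n\<close> is replaced by a test function within
  \<open>1 / (n + 1)\<close> of it, in value and in every derivative.\<close>

lemma H10_closed:
  fixes u :: "nat \<Rightarrow> 'a \<Rightarrow> 'b::euclidean_space"
  assumes un: "\<And>n. H10 \<Omega> (u n)"
    and u: "L2 u'" "L2_lim u u'"
    and G: "\<And>b. b \<in> Basis \<Longrightarrow> L2 (G b)"
      "\<And>b. b \<in> Basis \<Longrightarrow> L2_lim (\<lambda>n. D b (u n)) (G b)"
  shows "H10 \<Omega> u'" "b \<in> Basis \<Longrightarrow> has_weak_pd \<Omega> b u' (G b)"
proof -
  define e where "e n = inverse (real (Suc n))" for n
  have e: "e n > 0" for n by (simp add: e_def)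
  have e0: "e \<longlonglongrightarrow> 0" unfolding e_def by (rule LIMSEQ_inverse_real_of_nat)
  have "\<exists>\<psi>. test \<psi> \<and> nrm (\<lambda>x. \<psi> x - u n x) < e n
     \<and> (\<forall>b\<in>Basis. nrm (\<lambda>x. pd b \<psi> x - D b (u n) x) < e n)" for n
  proof -
    obtain \<psi> where \<psi>: "\<And>m::nat. test (\<psi> m)" "(\<lambda>m. nrm (\<lambda>x. \<psi> m x - u n x)) \<longlonglongrightarrow> 0"
      "\<And>b. b \<in> Basis \<Longrightarrow> (\<lambda>m. nrm (\<lambda>x. pd b (\<psi> m) x - D b (u n) x)) \<longlonglongrightarrow> 0"
      using H10E[OF un] by blast
    have "\<forall>\<^sub>F m in sequentially. nrm (\<lambda>x. \<psi> m x - u n x) < e n"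
      by (rule order_tendstoD(2)[OF \<psi>(2) e])
    moreover have "\<forall>\<^sub>F m in sequentially. \<forall>b\<in>Basis. nrm (\<lambda>x. pd b (\<psi> m) x - D b (u n) x) < e n"
      by (auto intro!: eventually_ball_finite order_tendstoD(2)[OF \<psi>(3) e])
    ultimately have "\<forall>\<^sub>F m in sequentially. nrm (\<lambda>x. \<psi> m x - u n x) < e n
       \<and> (\<forall>b\<in>Basis. nrm (\<lambda>x. pd b (\<psi> m) x - D b (u n) x) < e n)"
      by (rule eventually_conj)
    then show ?thesis using \<psi>(1) eventually_happens'[OF sequentially_bot] by blast
  qed
  then obtain \<psi> where \<psi>: "\<And>n. test (\<psi> n)" "\<And>n. nrm (\<lambda>x. \<psi> n x - u n x) < e n"
     "\<And>n b. b \<in> Basis \<Longrightarrow> nrm (\<lambda>x. pd b (\<psi> n) x - D b (u n) x) < e n"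
    by metis
  have c: "L2_lim f h"
    if "\<And>n. L2 (f n)" "\<And>n. L2 (g n)" "L2 h" "\<And>n. nrm (\<lambda>x. f n x - g n x) < e n"
      "L2_lim g h" for f g :: "nat \<Rightarrow> 'a \<Rightarrow> 'b" and h
  proof (rule Lim_null_comparison)
    have "nrm (\<lambda>x. f n x - h x) \<le> e n + nrm (\<lambda>x. g n x - h x)" for n
      using L2_norm_triangle_diff[OF that(1)[of n] that(2)[of n] that(3)] that(4)[of n] by simp
    then show "\<forall>\<^sub>F n in sequentially. norm (nrm (\<lambda>x. f n x - h x)) \<le> e n + nrm (\<lambda>x. g n x - h x)"
      by (simp add: L2_norm_nonneg)
    show "(\<lambda>n. e n + nrm (\<lambda>x. g n x - h x)) \<longlonglongrightarrow> 0"
      using tendsto_add[OF e0 that(5)] by simp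
  qed
  note h = H1D[OF H10_imp_H1[OF un]]
  note * = \<psi>(1) u(1) c[OF test_Lp[OF \<psi>(1)] h(1) u(1) \<psi>(2) u(2)] G(1)
    c[OF test_Lp[OF test_pd[OF \<psi>(1)]] h(2) G(1) \<psi>(3) G(2)]
  show "H10 \<Omega> u'" by (rule H10I(1)[of \<psi> u' G]) (use * in auto)
  show "b \<in> Basis \<Longrightarrow> has_weak_pd \<Omega> b u' (G b)" by (rule H10I(2)[of \<psi> u' G]) (use * in auto)
qed

section \<open>The quadratic form and Poincare's inequality\<close>

text \<open>Kept bilinear because the parallelogram law and the Euler-Lagrange equation need the
  polarization. The coefficients enter linearly, so dividing the energy by a parameter only changes
  \<open>s\<close> and \<open>t\<close>.\<close>

definition form :: "real \<Rightarrow> real \<Rightarrow> ('a \<Rightarrow> real) \<Rightarrow> ('a \<Rightarrow> real) \<Rightarrow> real" where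
  "form s t u v = s * (LINT x|M. u x * v x) +
     t * (\<Sum>b\<in>Basis. LINT x|M. D b u x * D b v x)"

abbreviation Q :: "real \<Rightarrow> real \<Rightarrow> ('a \<Rightarrow> real) \<Rightarrow> real" where
  "Q s t u \<equiv> form s t u u"

lemma form_commute: "form s t u v = form s t v u"
  by (simp add: form_def mult.commute)

lemma form_lincomb_left:
  assumes u: "H1 \<Omega> u" and v: "H1 \<Omega> v" and w: "H1 \<Omega> w"
  shows "form s t (\<lambda>x. r * u x + q * v x) w = r * form s t u w + q * form s t v w"
proof -
  have i: "integrable M (\<lambda>x. f x * g x)"
    if "L2 f" "L2 g" for f g :: "'a \<Rightarrow> real"
    by (rule integrable_bilinear[OF bounded_bilinear_mult that])
  have lc: "(LINT x|M. (r * f x + q * g x) * h x)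
      = r * (LINT x|M. f x * h x) + q * (LINT x|M. g x * h x)"
    if "L2 f" "L2 g" "L2 h" for f g h :: "'a \<Rightarrow> real"
    using i[OF that(1,3)] i[OF that(2,3)] by (simp add: distrib_right mult.assoc)
  have "(LINT x|M. D b (\<lambda>x. r * u x + q * v x) x * D b w x)
     = r * (LINT x|M. D b u x * D b w x)
       + q * (LINT x|M. D b v x * D b w x)" if b: "b \<in> Basis" for b
    unfolding lc[OF H1D(2)[OF u b] H1D(2)[OF v b] H1D(2)[OF w b], symmetric]
  proof (rule integral_cong_AE)
    show "AE x in M. D b (\<lambda>x. r * u x + q * v x) x * D b w x
       = (r * D b u x + q * D b v x) * D b w x"
      using weak_pd_lincomb_AE[OF u v b, of r q] by eventually_elim simp
  qed (use Lp2D(1)[OF H1D(2)[OF u b]] Lp2D(1)[OF H1D(2)[OF v b]] Lp2D(1)[OF H1D(2)[OF w b]]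
      Lp2D(1)[OF H1D(2)[OF H1_lincomb[OF u v, of r q] b]] in \<open>auto\<close>)
  then have D: "(\<Sum>b\<in>Basis. LINT x|M. D b (\<lambda>x. r * u x + q * v x) x * D b w x)
     = r * (\<Sum>b\<in>Basis. LINT x|M. D b u x * D b w x)
       + q * (\<Sum>b\<in>Basis. LINT x|M. D b v x * D b w x)"
    by (simp add: sum.distrib sum_distrib_left)
  show ?thesis
    unfolding form_def D lc[OF H1D(1)[OF u] H1D(1)[OF v] H1D(1)[OF w]] by (simp add: algebra_simps)
qed

lemma form_lincomb_right:
  assumes "H1 \<Omega> u" "H1 \<Omega> v" "H1 \<Omega> w"
  shows "form s t w (\<lambda>x. r * u x + q * v x) = r * form s t w u + q * form s t w v"
  using form_lincomb_left[OF assms] by (simp add: form_commute)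

lemma form_lincomb_same:
  assumes u: "H1 \<Omega> u" and v: "H1 \<Omega> v"
  shows "Q s t (\<lambda>x. r * u x + q * v x)
    = r\<^sup>2 * Q s t u + 2 * r * q * form s t u v + q\<^sup>2 * Q s t v"
proof -
  have uv: "H1 \<Omega> (\<lambda>x. r * u x + q * v x)" using H1_lincomb[OF u v, of r q] by simp
  then show ?thesis
    unfolding form_lincomb_left[OF u v uv] form_lincomb_right[OF u v u] form_lincomb_right[OF u v v]
      form_commute[of s t v u]
    by (simp add: power2_eq_square algebra_simps)
qed

lemma form_same:
  "Q s t u = s * (nrm u)\<^sup>2 + t * (\<Sum>b\<in>Basis. (nrm (D b u))\<^sup>2)"
  unfolding form_def L2_norm_sq by (simp add: power2_eq_square)

lemma form_nonneg: "0 \<le> s \<Longrightarrow> 0 \<le> t \<Longrightarrow> 0 \<le> Q s t u"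
  by (simp add: form_same sum_nonneg)

lemma form_test_function:
  assumes f: "test f"
  shows "Q s t f = s * (nrm f)\<^sup>2 + t * (\<Sum>b\<in>Basis. (nrm (pd b f))\<^sup>2)"
proof -
  have "nrm (D b f) = nrm (pd b f)" if b: "b \<in> Basis" for b
    using test_L2_norm_weak_pd[OF f b, of "\<lambda>_. 0"] by (simp add: Lp_def)
  then show ?thesis by (simp add: form_same)
qed

text \<open>The derivative of \<open>f\<^sup>2 * (x \<bullet> b)\<close> in direction
  \<open>b\<close> has integral zero, which gives \<open>\<integral> f\<^sup>2 = - 2 \<integral> (x
  \<bullet> b) * f * pd b f\<close>. With \<open>\<bar>x \<bullet> b\<bar> \<le> R\<close> and
  Cauchy-Schwarz one factor of the norm of \<open>f\<close> cancels, leaving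
  \<open>2 * R\<close>.\<close>

lemma poincare_test_function:
  assumes R: "\<And>x. x \<in> \<Omega> \<Longrightarrow> norm x \<le> R" and f: "test f" and b: "b \<in> Basis"
  shows "nrm f \<le> 2 * R * nrm (pd b f :: 'a \<Rightarrow> real)"
\<comment> \<open>On the empty set the bound on norms does not force \<open>0 \<le> R\<close>, but
  both sides are zero.\<close>
proof (cases "\<Omega> = {}")
  case True
  then show ?thesis by (simp add: L2_norm_def)
next
  case False
  then have R0: "0 \<le> R" using R norm_ge_zero order_trans by blast
  define N P where "N = nrm f" and "P = nrm (pd b f)"
  note pf = test_pd[OF f b]
  have df: "f differentiable (at x)" for x by (rule test_differentiable[OF f])
  have ff: "test (\<lambda>x. f x * f x)"
    by (rule test_bilinear[OF bounded_bilinear_mult f test_Ck[OF f]])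
  have Ckb: "Ck k (\<lambda>x. x \<bullet> b)" for k by (rule Ck_linear[OF bounded_linear_inner_left])
  then have g: "test (\<lambda>x. f x * f x * (x \<bullet> b))"
    by (rule test_bilinear[OF bounded_bilinear_mult ff])
  have db: "(\<lambda>x::'a. x \<bullet> b) differentiable (at x)" for x
    using Ckb[of "Suc 0"] by simp
  have pdb: "pd b (\<lambda>x. x \<bullet> b) x = 1" for x
    using pd_eqI[OF bounded_linear_imp_has_derivative[OF bounded_linear_inner_left[of b]], of b x] b by simp
  have "pd b (\<lambda>x. f x * f x * (x \<bullet> b)) x = (f x)\<^sup>2 + 2 * ((x \<bullet> b) * (f x * pd b f x))" for x
    by (subst pd_bilinear[OF bounded_bilinear_mult test_differentiable[OF ff] db])
       (simp add: pdb pd_bilinear[OF bounded_bilinear_mult df df] power2_eq_square algebra_simps)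
  then have "0 = (LINT x|M. (f x)\<^sup>2 + 2 * ((x \<bullet> b) * (f x * pd b f x)))"
    using integral_pd_eq_0[OF sets_\<Omega> g b] by simp
  moreover have i1: "integrable M (\<lambda>x. (f x)\<^sup>2)"
    using Lp2D(2)[OF test_Lp[OF f]] by simp
  moreover have ip: "integrable M (\<lambda>x. norm (f x) * norm (pd b f x))"
    by (rule integrable_prod_bound[OF test_Lp[OF f] test_Lp[OF pf], of _ 1])
      (use Lp2D(1)[OF test_Lp[OF f]] Lp2D(1)[OF test_Lp[OF pf]] in auto)
  moreover have i2: "integrable M (\<lambda>x. (x \<bullet> b) * (f x * pd b f x))"
  proof -
    have "test (\<lambda>x. f x * pd b f x * (x \<bullet> b))"
      by (rule test_bilinear[OF bounded_bilinear_mult test_bilinear[OF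
          bounded_bilinear_mult f test_Ck[OF pf]] Ckb])
    from Lp2_integrable[OF test_Lp[OF this]] show ?thesis by (simp add: mult.commute)
  qed
  ultimately have "N\<^sup>2 = - 2 * (LINT x|M. (x \<bullet> b) * (f x * pd b f x))"
    by (simp add: N_def L2_norm_sq)
  also have "\<dots> \<le> 2 * (LINT x|M. R * (norm (f x) * norm (pd b f x)))"
  proof -
    have "- (LINT x|M. (x \<bullet> b) * (f x * pd b f x)) \<le> norm (LINT x|M. (x \<bullet> b) * (f x * pd b f x))"
      by simp
    also have "\<dots> \<le> (LINT x|M. R * (norm (f x) * norm (pd b f x)))"
    proof (rule Bochner_Integration.integral_norm_bound_integral[OF i2])
      fix x assume "x \<in> space M"
      then have "\<bar>x \<bullet> b\<bar> \<le> R"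
        using R[of x] Basis_le_norm[OF b, of x] by simp
      then show "norm ((x \<bullet> b) * (f x * pd b f x)) \<le> R * (norm (f x) * norm (pd b f x))"
        by (simp add: abs_mult mult_right_mono)
    qed (use ip in simp)
    finally show ?thesis by simp
  qed
  also have "\<dots> \<le> 2 * (R * (N * P))"
    using L2_cauchy_schwarz[OF test_Lp[OF f] test_Lp[OF pf]] R0
    by (simp add: N_def P_def mult_left_mono)
  finally have "N * N \<le> (2 * R * P) * N" by (simp add: power2_eq_square algebra_simps)
  moreover have "0 \<le> N" "0 \<le> P" by (simp_all add: N_def P_def L2_norm_nonneg)
  ultimately have "N \<le> 2 * R * P"
    using R0 by (cases "N = 0") (auto simp: mult_le_cancel_right)
  then show ?thesis by (simp add: N_def P_def)
qed

lemma poincare: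
  assumes R: "\<And>x. x \<in> \<Omega> \<Longrightarrow> norm x \<le> R" and u: "H10 \<Omega> u" and b: "b \<in> Basis"
  shows "nrm u \<le> 2 * R * nrm (D b u :: 'a \<Rightarrow> real)"
proof -
  obtain \<psi> where \<psi>: "\<And>n::nat. test (\<psi> n)" "L2_lim \<psi> u"
    "\<And>b. b \<in> Basis \<Longrightarrow> L2_lim (\<lambda>n. pd b (\<psi> n)) (D b u)"
    using H10E[OF u] by blast
  note h = H1D[OF H10_imp_H1[OF u]]
  show ?thesis
  proof (rule LIMSEQ_le)
    show "(\<lambda>n. nrm (\<psi> n)) \<longlonglongrightarrow> nrm u"
      by (rule L2_conv_norm[OF test_Lp[OF \<psi>(1)] h(1) \<psi>(2)])
    show "(\<lambda>n. 2 * R * nrm (pd b (\<psi> n))) \<longlonglongrightarrow> 2 * R * nrm (D b u)"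
      by (intro tendsto_intros L2_conv_norm[OF test_Lp[OF test_pd[OF \<psi>(1) b]] h(2)[OF b] \<psi>(3)[OF b]])
  qed (use poincare_test_function[OF R \<psi>(1) b] in auto)
qed

text \<open>Since \<open>s\<close> may be zero, the function itself is controlled through Poincare's
  inequality in a single direction, and so only on \<open>H\<^sub>0\<^sup>1\<close>; the derivatives
  are controlled by \<open>t\<close> alone.\<close>

lemma form_coercive:
  assumes s: "0 \<le> s" and t: "0 < t"
  obtains C where "0 < C" "\<And>u. H10 \<Omega> u \<Longrightarrow> (nrm u)\<^sup>2 \<le> C * Q s t u"
    "\<And>u b. b \<in> Basis \<Longrightarrow> (nrm (D b u))\<^sup>2 \<le> C * Q s t u"
proof -
  obtain R where R: "R > 0" "\<And>x. x \<in> \<Omega> \<Longrightarrow> norm x \<le> R"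
    using bounded_\<Omega> bounded_pos by metis
  have g: "(nrm (D b u))\<^sup>2 \<le> inverse t * Q s t u" if b: "b \<in> Basis" for b and u :: "'a \<Rightarrow> real"
  proof -
    have "(nrm (D b u))\<^sup>2 \<le> (\<Sum>b\<in>Basis. (nrm (D b u))\<^sup>2)"
      using b by (intro member_le_sum) auto
    then have "t * (nrm (D b u))\<^sup>2 \<le> Q s t u"
      using s t by (simp add: form_same add_increasing)
    then show ?thesis using t by (simp add: field_simps)
  qed
  have p: "(nrm u)\<^sup>2 \<le> (2 * R)\<^sup>2 * (inverse t * Q s t u)" if u: "H10 \<Omega> u" for u :: "'a \<Rightarrow> real"
  proof -
    obtain b :: 'a where b: "b \<in> Basis" using nonempty_Basis by blast
    have "(nrm u)\<^sup>2 \<le> (2 * R * nrm (D b u))\<^sup>2"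
      by (intro power_mono poincare R u b L2_norm_nonneg)
    also have "\<dots> \<le> (2 * R)\<^sup>2 * (inverse t * Q s t u)"
      unfolding power_mult_distrib[of "2 * R"] by (intro mult_left_mono g b) auto
    finally show ?thesis .
  qed
  let ?C = "inverse t * (1 + (2 * R)\<^sup>2)"
  have F: "0 \<le> inverse t * Q s t u" for u :: "'a \<Rightarrow> real"
    using s t by (simp add: form_nonneg)
  show ?thesis
  proof (rule that[of ?C])
    show "0 < ?C" using t by (simp add: add_pos_nonneg)
    show "(nrm u)\<^sup>2 \<le> ?C * Q s t u" if "H10 \<Omega> u" for u
      using p[OF that] F[of u] by (simp add: algebra_simps)
    show "(nrm (D b u))\<^sup>2 \<le> ?C * Q s t u" if "b \<in> Basis" for b u
      using g[OF that, of u] mult_nonneg_nonneg[OF zero_le_power2[of "2 * R"] F[of u]]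
      by (simp add: algebra_simps)
  qed
qed

lemma form_tendsto:
  assumes un: "\<And>n. L2 (u n)" and u: "L2 u'"
    and cu: "L2_lim u u'"
    and gn: "\<And>b n. b \<in> Basis \<Longrightarrow> L2 (g b n)" and g: "\<And>b. b \<in> Basis \<Longrightarrow> L2 (g' b)"
    and cg: "\<And>b. b \<in> Basis \<Longrightarrow> L2_lim (g b) (g' b)"
  shows "(\<lambda>n. s * (nrm (u n))\<^sup>2 + t * (\<Sum>b\<in>Basis. (nrm (g b n))\<^sup>2))
     \<longlonglongrightarrow> s * (nrm u')\<^sup>2 + t * (\<Sum>b\<in>Basis. (nrm (g' b))\<^sup>2)"
  by (intro tendsto_intros L2_conv_norm[OF un u cu] L2_conv_norm[OF gn g cg])

lemma H10_real_lincomb: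
  fixes u v :: "'a \<Rightarrow> real"
  shows "H10 \<Omega> u \<Longrightarrow> H10 \<Omega> v \<Longrightarrow> H10 \<Omega> (\<lambda>x. r * u x + q * v x)"
  using H10_lincomb[of u v r q] by simp

lemma H10_integrable:
  "H10 \<Omega> u \<Longrightarrow> integrable M u"
  using H1D(1)[OF H10_imp_H1] by (rule Lp2_integrable)

section \<open>Test functions tending to the constant one\<close>

lemma measure_pos:
  assumes "\<Omega> \<noteq> {}" shows "0 < measure lebesgue \<Omega>"
proof -
  have "\<not> negligible \<Omega>"
    by (rule open_not_negligible[OF open_\<Omega> assms])
  then have "measure lebesgue \<Omega> \<noteq> 0"
    using lmeasurable_\<Omega> by (simp add: negligible_iff_measure)
  then show ?thesis using measure_nonneg[of lebesgue \<Omega>] by linarith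
qed

text \<open>Countably many open boxes with closure inside \<Omega> cover it. The saturated partial
  sums of their bumps tend to one at every point while staying between zero and one, as dominated
  convergence requires.\<close>

lemma test_functions_tendsto_one:
  obtains \<psi> :: "nat \<Rightarrow> 'a \<Rightarrow> real" where "\<And>n. test (\<psi> n)"
    "\<And>n x. 0 \<le> \<psi> n x" "\<And>n x. \<psi> n x \<le> 1" "\<And>x. x \<in> \<Omega> \<Longrightarrow> (\<lambda>n. \<psi> n x) \<longlonglongrightarrow> 1"
proof (cases "\<Omega> = {}")
  case True
  then show ?thesis by (intro that[of "\<lambda>n x. 0"]) (auto simp: test_0)
next
  case False
  define \<F> where "\<F> = {box a b | a b. cbox a b \<subseteq> \<Omega>}"
  have "openin (top_of_set UNIV) S" if "S \<in> \<F>" for S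
    using that open_box by (auto simp: \<F>_def)
  then obtain \<F>' where F': "\<F>' \<subseteq> \<F>" "countable \<F>'" "\<Union>\<F>' = \<Union>\<F>"
    using Lindelof_openin[of \<F> UNIV] by blast
  have "\<Union>\<F> = \<Omega>"
  proof
    show "\<Union>\<F> \<subseteq> \<Omega>"
    proof (rule Union_least)
      fix X assume "X \<in> \<F>"
      then obtain a b where "X = box a b" "cbox a b \<subseteq> \<Omega>" by (auto simp: \<F>_def)
      then show "X \<subseteq> \<Omega>" using box_subset_cbox[of a b] by simp
    qed
    show "\<Omega> \<subseteq> \<Union>\<F>"
    proof
      fix x assume "x \<in> \<Omega>"
      then obtain a b where "cbox a b \<subseteq> \<Omega>" "x \<in> box a b"
        by (rule open_contains_cbox[OF open_\<Omega>])
      then have "box a b \<in> \<F>" unfolding \<F>_def by blast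
      then show "x \<in> \<Union>\<F>" using \<open>x \<in> box a b\<close> by (rule UnionI)
    qed
  qed
  with F' have U: "\<Union>\<F>' = \<Omega>" and ne: "\<F>' \<noteq> {}" using False by auto
  have "\<exists>a b. from_nat_into \<F>' i = box a b \<and> cbox a b \<subseteq> \<Omega>" for i
    using from_nat_into[OF ne, of i] F'(1) by (auto simp: \<F>_def)
  then obtain a b where ab: "\<And>i. from_nat_into \<F>' i = box (a i) (b i)" "\<And>i. cbox (a i) (b i) \<subseteq> \<Omega>"
    by metis
  define S where "S n x = (\<Sum>i<n. box_bump (a i) (b i) x)" for n x
  \<comment> \<open>At a point with bump value \<open>c > 0\<close> in box \<open>j\<close> the
    exponent is at most \<open>- n * c\<close> once \<open>n > j\<close>.\<close>
  define \<psi> where "\<psi> n x = 1 * (1 - exp (- (real n * S n x)))" for n x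
  have S0: "0 \<le> S n x" for n x by (simp add: S_def sum_nonneg box_bump_nonneg)
  show ?thesis
  proof (rule that[of \<psi>])
    show "test (\<psi> n)" for n
      unfolding \<psi>_def S_def
      by (intro test_saturate test_sum test_box_bump ab) auto
    show "0 \<le> \<psi> n x" "\<psi> n x \<le> 1" for n x using S0[of n x] by (auto simp: \<psi>_def)
    fix x assume "x \<in> \<Omega>"
    then obtain X where "X \<in> \<F>'" "x \<in> X" using U by blast
    then obtain j where "from_nat_into \<F>' j = X"
      using from_nat_into_surj[OF F'(2)] by blast
    then have "x \<in> box (a j) (b j)" using \<open>x \<in> X\<close> ab(1)[of j] by simp
    define c where "c = box_bump (a j) (b j) x"
    have c: "0 < c" using \<open>x \<in> box (a j) (b j)\<close> by (simp add: c_def box_bump_pos_iff)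
    have "(\<lambda>n. 1 - exp (- c) ^ n) \<longlonglongrightarrow> 1 - 0"
      using c by (intro tendsto_intros LIMSEQ_realpow_zero) auto
    then have l: "(\<lambda>n. 1 - exp (- c) ^ n) \<longlonglongrightarrow> 1" by simp
    show "(\<lambda>n. \<psi> n x) \<longlonglongrightarrow> 1"
    proof (rule tendsto_sandwich[OF _ _ l tendsto_const])
      show "\<forall>\<^sub>F n in sequentially. 1 - exp (- c) ^ n \<le> \<psi> n x"
        using eventually_gt_at_top[of j]
      proof eventually_elim
        case (elim n)
        have "c \<le> S n x" unfolding c_def S_def
          using elim by (intro member_le_sum box_bump_nonneg) auto
        then have "real n * c \<le> real n * S n x" by (rule mult_left_mono) simp
        then show ?case by (simp add: \<psi>_def exp_of_nat_mult[symmetric])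
      qed
      show "\<forall>\<^sub>F n in sequentially. \<psi> n x \<le> 1" using S0[of _ x] by (simp add: \<psi>_def)
    qed
  qed
qed

section \<open>Minimizers of the quadratic form with unit mass\<close>

text \<open>The map \<open>y \<mapsto> sqrt (y\<^sup>2 + e\<^sup>2) - e\<close> fixes zero and has
  slope at most one in absolute value, so neither the function nor any partial derivative grows
  pointwise.\<close>

lemma form_sqrt_sq_le:
  assumes \<psi>: "test \<psi>" and e: "0 < e" and s: "0 \<le> s" and t: "0 \<le> t"
    and f: "test f" "\<And>x. f x = sqrt ((\<psi> x)\<^sup>2 + e\<^sup>2) - e"
  shows "Q s t f \<le> Q s t \<psi>"
proof -
  have bd: "\<bar>sqrt (x\<^sup>2 + e\<^sup>2) - e\<bar> \<le> \<bar>x\<bar>" for x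
    using e sqrt_add_le_add_sqrt[of "x\<^sup>2" "e\<^sup>2"] real_sqrt_le_mono[of "e\<^sup>2" "x\<^sup>2 + e\<^sup>2"] by auto
  have p: "0 < x\<^sup>2 + e\<^sup>2" for x using e by (simp add: add_nonneg_pos)
  have feq: "f = (\<lambda>x. sqrt ((\<psi> x)\<^sup>2 + e\<^sup>2) - e)" by (rule ext) (rule f(2))
  have pd: "pd b f x = \<psi> x / sqrt ((\<psi> x)\<^sup>2 + e\<^sup>2) * pd b \<psi> x" for b x
  proof -
    have "((\<lambda>y. sqrt (y\<^sup>2 + e\<^sup>2) - e) has_real_derivative \<psi> x / sqrt ((\<psi> x)\<^sup>2 + e\<^sup>2)) (at (\<psi> x))"
      using p[of "\<psi> x"] by (auto intro!: derivative_eq_intros simp: field_simps)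
    from pd_compose[OF this test_differentiable[OF \<psi>]]
    show ?thesis by (simp only: feq)
  qed
  have r: "\<bar>x / sqrt (x\<^sup>2 + e\<^sup>2)\<bar> \<le> 1" for x
    using p[of x] real_sqrt_le_mono[of "x\<^sup>2" "x\<^sup>2 + e\<^sup>2"] by (simp add: abs_divide divide_le_eq_1)
  have "nrm f \<le> nrm \<psi>"
    by (rule L2_norm_mono[OF test_Lp[OF \<psi>]], rule AE_I2) (unfold f(2) real_norm_def, rule bd)
  moreover have "nrm (pd b f) \<le> nrm (pd b \<psi>)" if b: "b \<in> Basis" for b
  proof (rule L2_norm_mono[OF test_Lp[OF test_pd[OF \<psi> b]]])
    have "norm (pd b f x) \<le> norm (pd b \<psi> x)" for x
      unfolding pd using mult_right_mono[OF r abs_ge_zero, of "\<psi> x" "pd b \<psi> x"] by (simp only: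
        real_norm_def abs_mult mult_1)
    then show "AE x in M. norm (pd b f x) \<le> norm (pd b \<psi> x)" by (intro AE_I2)
  qed
  ultimately show ?thesis
    unfolding form_test_function[OF f(1)] form_test_function[OF \<psi>] using s t
    by (intro add_mono mult_left_mono sum_mono power_mono L2_norm_nonneg)
qed

text \<open>Signed \<open>u\<close> are allowed: only the energy of the squares is controlled, not their distance
  to \<open>\<bar>u\<bar>\<close> in \<open>H\<^sup>1\<close>.\<close>

lemma H10_square_approx:
  assumes u: "H10 \<Omega> u" and s: "0 \<le> s" and t: "0 \<le> t"
  obtains \<phi> q where "\<And>n::nat. test (\<phi> n)"
    "(\<lambda>n. LINT x|M. (\<phi> n x)\<^sup>2) \<longlonglongrightarrow> (LINT x|M. \<bar>u x\<bar> :: real)"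
    "\<And>n. Q s t (\<lambda>x. (\<phi> n x)\<^sup>2) \<le> q n" "q \<longlonglongrightarrow> Q s t u"
proof -
  obtain \<psi> where \<psi>: "\<And>n::nat. test (\<psi> n)" "L2_lim \<psi> u"
    "\<And>b. b \<in> Basis \<Longrightarrow> L2_lim (\<lambda>n. pd b (\<psi> n)) (D b u)"
    using H10E[OF u] by blast
  note h = H1D[OF H10_imp_H1[OF u]]
  define e where "e n = inverse (real (Suc n))" for n
  have e: "e n > 0" for n by (simp add: e_def)
  have e0: "e \<longlonglongrightarrow> 0" unfolding e_def by (rule LIMSEQ_inverse_real_of_nat)
  have "\<exists>\<phi>. test \<phi> \<and> (\<forall>x. (\<phi> x)\<^sup>2 = sqrt ((\<psi> n x)\<^sup>2 + (e n)\<^sup>2) - e n)" for n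
    using test_sqrt_sq[OF \<psi>(1) e, of n n] by blast
  then obtain \<phi> where \<phi>: "\<And>n. test (\<phi> n)"
    "\<And>n x. (\<phi> n x)\<^sup>2 = sqrt ((\<psi> n x)\<^sup>2 + (e n)\<^sup>2) - e n" by metis
  have \<phi>2: "test (\<lambda>x. (\<phi> n x)\<^sup>2)" for n
    unfolding power2_eq_square
    by (rule test_bilinear[OF bounded_bilinear_mult \<phi>(1) test_Ck[OF \<phi>(1)]])
  show ?thesis
  proof (rule that[of \<phi> "\<lambda>n. Q s t (\<psi> n)"])
    show "(\<lambda>n. Q s t (\<psi> n)) \<longlonglongrightarrow> Q s t u"
      unfolding form_test_function[OF \<psi>(1)] form_same[of _ _ u]
      by (rule form_tendsto[OF test_Lp[OF \<psi>(1)] h(1) \<psi>(2)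
            test_Lp[OF test_pd[OF \<psi>(1)]] h(2) \<psi>(3)])
    show "Q s t (\<lambda>x. (\<phi> n x)\<^sup>2) \<le> Q s t (\<psi> n)" for n
      by (rule form_sqrt_sq_le[OF \<psi>(1) e s t \<phi>2 \<phi>(2)])
    have au: "L2 (\<lambda>x. \<bar>u x\<bar>)" using Lp2_norm[OF h(1)] by simp
    have 1: "L2 (\<lambda>x. 1::real)" by (rule Lp2_bounded[of _ 1]) auto
    \<comment> \<open>The regularized modulus lies between
      \<open>\<bar>\<psi> n x\<bar> - e n\<close> and \<open>\<bar>\<psi> n x\<bar>\<close>.\<close>
    have bd: "\<bar>(\<phi> n x)\<^sup>2 - \<bar>u x\<bar>\<bar> \<le> \<bar>\<psi> n x - u x\<bar> + e n" for n x
    proof -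
      have "sqrt ((\<psi> n x)\<^sup>2 + (e n)\<^sup>2) \<le> \<bar>\<psi> n x\<bar> + e n"
        using sqrt_add_le_add_sqrt[of "(\<psi> n x)\<^sup>2" "(e n)\<^sup>2"] e[of n] by simp
      moreover have "\<bar>\<psi> n x\<bar> \<le> sqrt ((\<psi> n x)\<^sup>2 + (e n)\<^sup>2)"
        using real_sqrt_le_mono[of "(\<psi> n x)\<^sup>2" "(\<psi> n x)\<^sup>2 + (e n)\<^sup>2"] by simp
      ultimately show ?thesis unfolding \<phi>(2) using e[of n] by linarith
    qed
    have "nrm (\<lambda>x. (\<phi> n x)\<^sup>2 - \<bar>u x\<bar>) \<le> nrm (\<lambda>x. \<psi> n x - u x) + e n * nrm (\<lambda>x. 1::real)" for n
    proof -
      note d = Lp2_norm[OF Lp2_diff[OF test_Lp[OF \<psi>(1)[of n]] h(1)]]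
      have "nrm (\<lambda>x. (\<phi> n x)\<^sup>2 - \<bar>u x\<bar>) \<le> nrm (\<lambda>x. norm (\<psi> n x - u x) + e n *\<^sub>R 1)"
        by (rule L2_norm_mono[OF Lp2_add[OF d Lp2_scaleR[OF 1]]]) (use order_trans[OF bd abs_ge_self] in
          auto)
      also have "\<dots> \<le> nrm (\<lambda>x. norm (\<psi> n x - u x)) + nrm (\<lambda>x. e n *\<^sub>R (1::real))"
        by (rule L2_norm_triangle[OF d Lp2_scaleR[OF 1]])
      finally show ?thesis
        unfolding L2_norm_scaleR using e[of n] by (simp add: L2_norm_def)
    qed
    then have "\<forall>\<^sub>F n in sequentially. norm (nrm (\<lambda>x. (\<phi> n x)\<^sup>2 - \<bar>u x\<bar>))
        \<le> nrm (\<lambda>x. \<psi> n x - u x) + e n * nrm (\<lambda>x. 1::real)"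
      by (simp add: L2_norm_nonneg)
    moreover have "(\<lambda>n. nrm (\<lambda>x. \<psi> n x - u x) + e n * nrm (\<lambda>x. 1::real)) \<longlonglongrightarrow> 0"
      using tendsto_add[OF \<psi>(2) tendsto_mult_left_zero[OF e0, of "nrm (\<lambda>x. 1::real)"]] by simp
    ultimately have "L2_lim (\<lambda>n x. (\<phi> n x)\<^sup>2) (\<lambda>x. \<bar>u x\<bar>)"
      by (rule Lim_null_comparison)
    then show "(\<lambda>n. LINT x|M. (\<phi> n x)\<^sup>2) \<longlonglongrightarrow> (LINT x|M. \<bar>u x\<bar>)"
      by (rule L2_conv_integral[OF test_Lp[OF \<phi>2] au])
  qed (rule \<phi>(1))
qed

text \<open>Without a sign condition the competitors form an affine space, so midpoints and
  perturbations in both directions stay admissible.\<close>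

definition unit_minimizer :: "real \<Rightarrow> real \<Rightarrow> ('a \<Rightarrow> real) \<Rightarrow> bool" where
  "unit_minimizer s t w \<longleftrightarrow> H10 \<Omega> w \<and> (LINT x|M. w x) = 1 \<and>
     (\<forall>u. H10 \<Omega> u \<and> (LINT x|M. u x) = 1 \<longrightarrow> Q s t w \<le> Q s t u)"

text \<open>The midpoint of \<open>u\<close> and \<open>v\<close> again has unit mass, so the form
  there is at least \<open>m\<close>. Allowing any lower bound \<open>m\<close> covers minimizing
  sequences, with \<open>m\<close> the infimum, as well as the distance to a minimizer.\<close>

lemma form_parallelogram:
  assumes u: "H10 \<Omega> u" "(LINT x|M. u x) = 1"
    and v: "H10 \<Omega> v" "(LINT x|M. v x) = 1"
    and m: "\<And>w. H10 \<Omega> w \<Longrightarrow> (LINT x|M. w x) = 1 \<Longrightarrow> m \<le> Q s t w"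
  shows "Q s t (\<lambda>x. u x - v x) \<le> 2 * (Q s t u - m) + 2 * (Q s t v - m)"
proof -
  note h = H10_imp_H1[OF u(1)] H10_imp_H1[OF v(1)]
  have "m \<le> Q s t (\<lambda>x. 1/2 * u x + 1/2 * v x)"
    using H10_integrable[OF u(1)] H10_integrable[OF v(1)] u v
    by (intro m H10_real_lincomb) auto
  then show ?thesis
    using form_lincomb_same[OF h, of s t "1/2" "1/2"] form_lincomb_same[OF h, of s t 1 "-1"]
    by (simp add: power2_eq_square field_simps)
qed

lemma unit_minimizer_gap:
  assumes w: "unit_minimizer s t w" and u: "H10 \<Omega> u" "(LINT x|M. u x) = 1"
  shows "Q s t (\<lambda>x. u x - w x) \<le> 2 * (Q s t u - Q s t w)"
  using form_parallelogram[OF u, of w "Q s t w" s t] w by (simp add: unit_minimizer_def)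

lemma exists_unit_mass:
  assumes "\<Omega> \<noteq> {}"
  obtains f where "H10 \<Omega> f" "(LINT x|M. f x) = (1::real)"
proof -
  obtain \<psi> :: "nat \<Rightarrow> 'a \<Rightarrow> real" where \<psi>: "\<And>n. test (\<psi> n)"
    "\<And>n x. 0 \<le> \<psi> n x" "\<And>n x. \<psi> n x \<le> 1" "\<And>x. x \<in> \<Omega> \<Longrightarrow> (\<lambda>n. \<psi> n x) \<longlonglongrightarrow> 1"
    using test_functions_tendsto_one by blast
  have "(\<lambda>n. LINT x|M. \<psi> n x) \<longlonglongrightarrow> (LINT x|M. 1)"
  proof (rule integral_dominated_convergence)
    show "integrable M (\<lambda>x. 1::real)" by (rule integrable_const_\<Omega>)
    show "\<psi> n \<in> borel_measurable M" for n
      by (rule test_measurable[OF \<psi>(1) sets_\<Omega>])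
    show "AE x in M. (\<lambda>n. \<psi> n x) \<longlonglongrightarrow> 1"
      by (rule AE_I2) (use \<psi>(4) in auto)
    show "AE x in M. norm (\<psi> n x) \<le> 1" for n
      using \<psi>(2,3) by auto
  qed auto
  moreover have "(LINT x|M. (1::real)) > 0"
    using measure_pos[OF assms] by (simp add: measure_\<Omega>)
  ultimately have "\<forall>\<^sub>F n in sequentially. (LINT x|M. \<psi> n x) > 0"
    by (rule order_tendstoD(1))
  then obtain n where n: "(LINT x|M. \<psi> n x) > 0"
    using eventually_happens'[OF sequentially_bot] by blast
  let ?c = "1 / (LINT x|M. \<psi> n x)"
  \<comment> \<open>The zero summand below gives a mere rescaling the shape of
    \<open>H10_real_lincomb\<close>.\<close>
  show ?thesis
  proof (rule that[of "\<lambda>x. ?c * \<psi> n x + 0 * \<psi> n x"])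
    show "H10 \<Omega> (\<lambda>x. ?c * \<psi> n x + 0 * \<psi> n x)"
      by (intro H10_real_lincomb test_H10 \<psi>(1))
  qed (use n in simp)
qed

text \<open>The direct method with strong convergence: the parallelogram estimate and coercivity
  make a minimizing sequence Cauchy in value and gradient, and \<open>H10_closed\<close> identifies
  the limit.\<close>

lemma exists_unit_minimizer:
  assumes ne: "\<Omega> \<noteq> {}" and s: "0 \<le> s" and t: "0 < t"
  obtains w where "unit_minimizer s t w"
proof -
  let ?I = "\<lambda>u. LINT x|M. u x :: real"
  define A where "A = (\<lambda>u. Q s t u) ` {u. H10 \<Omega> u \<and> ?I u = 1}"
  define m where "m = Inf A"
  have bdd: "bdd_below A"
    unfolding A_def using s t by (intro bdd_belowI2[of _ 0]) (simp add: form_nonneg)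
  have Ane: "A \<noteq> {}" unfolding A_def using exists_unit_mass[OF ne] by blast
  have m: "m \<le> Q s t u" if "H10 \<Omega> u" "?I u = 1" for u
    unfolding m_def by (rule cInf_lower[OF _ bdd]) (use that in \<open>auto simp: A_def\<close>)
  define e where "e n = inverse (real (Suc n))" for n
  have e: "e n > 0" for n by (simp add: e_def)
  have e0: "e \<longlonglongrightarrow> 0" unfolding e_def by (rule LIMSEQ_inverse_real_of_nat)
  have "\<exists>u. H10 \<Omega> u \<and> ?I u = 1 \<and> Q s t u < m + e n" for n
    using cInf_lessD[OF Ane, of "m + e n"] e[of n] by (auto simp: A_def m_def)
  then obtain u where u: "\<And>n. H10 \<Omega> (u n)" "\<And>n. ?I (u n) = 1" "\<And>n. Q s t (u n) < m + e n"
    by metis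
  note h = H1D[OF H10_imp_H1[OF u(1)]]
  obtain C where C: "0 < C" "\<And>u. H10 \<Omega> u \<Longrightarrow> (nrm u)\<^sup>2 \<le> C * Q s t u"
    "\<And>u b. b \<in> Basis \<Longrightarrow> (nrm (D b u))\<^sup>2 \<le> C * Q s t u"
    using form_coercive[OF s t] by blast
  have small: "\<exists>N. \<forall>i\<ge>N. \<forall>j\<ge>N. C * Q s t (\<lambda>x. u i x - u j x) < r\<^sup>2" if r: "0 < r" for r
  proof -
    \<comment> \<open>Chosen so that the bound \<open>4 * d\<close> on the form becomes
      \<open>r\<^sup>2\<close> after multiplication by \<open>C\<close>.\<close>
    define d where "d = r\<^sup>2 / (4 * C)"
    have "\<forall>\<^sub>F n in sequentially. e n < d"
      using r C by (intro order_tendstoD(2)[OF e0]) (auto simp: d_def)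
    then obtain N where N: "\<And>n. n \<ge> N \<Longrightarrow> e n < d" by (auto simp: eventually_sequentially)
    have "C * Q s t (\<lambda>x. u i x - u j x) < r\<^sup>2" if "i \<ge> N" "j \<ge> N" for i j
    proof -
      have "Q s t (\<lambda>x. u i x - u j x) \<le> 2 * (Q s t (u i) - m) + 2 * (Q s t (u j) - m)"
        by (rule form_parallelogram[OF u(1,2) u(1,2) m])
      also have "\<dots> < 2 * d + 2 * d"
      proof -
        have "Q s t (u k) - m < d" if "k \<ge> N" for k
          using less_trans[OF u(3)[of k] add_strict_left_mono[OF N[OF that], of m]] by simp
        from this[OF that(1)] this[OF that(2)] show ?thesis
          by (intro add_strict_mono mult_strict_left_mono) auto
      qed
      finally show ?thesis using C(1) by (simp add: d_def field_simps)
    qed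
    then show ?thesis by blast
  qed
  have H10d: "H10 \<Omega> (\<lambda>x. u i x - u j x)" for i j
    using H10_real_lincomb[OF u(1)[of i] u(1)[of j], of 1 "-1"] by simp
  have cau: "\<exists>N. \<forall>i\<ge>N. \<forall>j\<ge>N. nrm (\<lambda>x. u i x - u j x) < r" if r: "0 < r" for r
  proof -
    obtain N where N: "\<forall>i\<ge>N. \<forall>j\<ge>N. C * Q s t (\<lambda>x. u i x - u j x) < r\<^sup>2"
      using small[OF r] by blast
    have "nrm (\<lambda>x. u i x - u j x) < r" if "i \<ge> N" "j \<ge> N" for i j
      using order_le_less_trans[OF C(2)[OF H10d[of i j]]] N that r by (intro power2_less_imp_less[of _
        r]) auto
    then show ?thesis by blast
  qed
  have caug: "\<exists>N. \<forall>i\<ge>N. \<forall>j\<ge>N. nrm (\<lambda>x. D b (u i) x - D b (u j) x) < r"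
    if r: "0 < r" and b: "b \<in> Basis" for r b
  proof -
    obtain N where N: "\<forall>i\<ge>N. \<forall>j\<ge>N. C * Q s t (\<lambda>x. u i x - u j x) < r\<^sup>2"
      using small[OF r] by blast
    have "nrm (\<lambda>x. D b (u i) x - D b (u j) x) < r" if "i \<ge> N" "j \<ge> N" for i j
      unfolding L2_norm_weak_pd_diff[OF H10_imp_H1[OF u(1)] H10_imp_H1[OF u(1)] b, symmetric]
      using order_le_less_trans[OF C(3)[OF b]] N that r by (intro power2_less_imp_less[of _ r]) auto
    then show ?thesis by blast
  qed
  obtain w where w: "L2 w" "L2_lim u w"
    using L2_complete[OF h(1) cau] by blast
  have "\<exists>g. L2 g \<and> L2_lim (\<lambda>n. D b (u n)) g" if b: "b \<in> Basis" for b
    using L2_complete[OF h(2)[OF b] caug[OF _ b]] by blast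
  then obtain G where G: "\<And>b. b \<in> Basis \<Longrightarrow> L2 (G b)"
    "\<And>b. b \<in> Basis \<Longrightarrow> L2_lim (\<lambda>n. D b (u n)) (G b)"
    by metis
  have Hw: "H10 \<Omega> w" by (rule H10_closed(1)[OF u(1) w G])
  have "(\<lambda>n. ?I (u n)) \<longlonglongrightarrow> ?I w" by (rule L2_conv_integral[OF h(1) w])
  then have Iw: "?I w = 1" using u(2) by (simp add: LIMSEQ_const_iff)
  have wG: "has_weak_pd \<Omega> b w (G b)" if "b \<in> Basis" for b
    by (rule H10_closed(2)[OF u(1) w G]) (use that in auto)
  have "nrm (D b w) = nrm (G b)" if b: "b \<in> Basis" for b
  proof (rule L2_norm_cong_AE)
    show "AE x in M. norm (D b w x) = norm (G b x)"
      using weak_pd_AE[OF wG[OF b]] by eventually_elim simp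
  qed (use G(1)[OF b] H1D(2)[OF H10_imp_H1[OF Hw] b] in \<open>auto simp: Lp_def\<close>)
  then have "Q s t w = s * (nrm w)\<^sup>2 + t * (\<Sum>b\<in>Basis. (nrm (G b))\<^sup>2)"
    by (simp add: form_same)
  then have "(\<lambda>n. Q s t (u n)) \<longlonglongrightarrow> Q s t w"
    using form_tendsto[OF h(1) w h(2) G, where s=s and t=t] by (simp add: form_same[of _ _ "u _"])
  moreover have "(\<lambda>n. m + e n) \<longlonglongrightarrow> m + 0" by (intro tendsto_intros e0)
  ultimately have "Q s t w \<le> m + 0"
    by (rule LIMSEQ_le) (use u(3) in \<open>auto intro: less_imp_le\<close>)
  then have "Q s t w \<le> Q s t v" if "H10 \<Omega> v" "?I v = 1" for v
    using m[OF that] by simp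
  then show ?thesis using Hw Iw by (intro that[of w]) (simp add: unit_minimizer_def)
qed

text \<open>By coercivity a vanishing form would make the norm of \<open>w\<close> zero,
  contradicting its unit mass.\<close>

lemma unit_minimizer_pos:
  assumes w: "unit_minimizer s t w" and s: "0 \<le> s" and t: "0 < t"
  shows "0 < Q s t w"
proof (rule ccontr)
  assume "\<not> 0 < Q s t w"
  then have F: "Q s t w = 0" using form_nonneg[of s t w] s t by simp
  have H: "H10 \<Omega> w" and I: "(LINT x|M. w x) = 1" using w by (auto simp: unit_minimizer_def)
  obtain C where C: "0 < C" "\<And>u. H10 \<Omega> u \<Longrightarrow> (nrm u)\<^sup>2 \<le> C * Q s t u"
    "\<And>u b. b \<in> Basis \<Longrightarrow> (nrm (D b u))\<^sup>2 \<le> C * Q s t u"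
    using form_coercive[OF s t] by blast
  have "(nrm w)\<^sup>2 \<le> 0" using C(2)[OF H] F by simp
  then have "nrm w = 0" by simp
  moreover have 1: "L2 (\<lambda>x. 1::real)" by (rule Lp2_bounded[of _ 1]) auto
  ultimately have "(LINT x|M. norm (w x)) \<le> 0"
    using L2_cauchy_schwarz[OF H1D(1)[OF H10_imp_H1[OF H]] 1] by simp
  moreover have "norm (LINT x|M. w x) \<le> (LINT x|M. norm (w x))"
    by simp
  ultimately show False using I by simp
qed

text \<open>The form is homogeneous of degree two, so rescaling to unit mass extends minimality to
  every nonzero mass; at mass zero only nonnegativity is claimed.\<close>

lemma unit_minimizer_le:
  assumes w: "unit_minimizer s t w" and v: "H10 \<Omega> v" and "0 \<le> s" "0 \<le> t"
  shows "Q s t w * (LINT x|M. v x)\<^sup>2 \<le> Q s t v"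
proof (cases "(LINT x|M. v x) = 0")
  case True
  then show ?thesis using form_nonneg[of s t v] assms by simp
next
  case False
  let ?c = "LINT x|M. v x"
  note h = H10_imp_H1[OF v]
  have "H10 \<Omega> (\<lambda>x. (1 / ?c) * v x + 0 * v x)" by (intro H10_real_lincomb v)
  moreover have "(LINT x|M. (1 / ?c) * v x + 0 * v x) = 1" using False by simp
  ultimately have "Q s t w \<le> Q s t (\<lambda>x. (1 / ?c) * v x + 0 * v x)"
    using w by (auto simp: unit_minimizer_def)
  also have "\<dots> = Q s t v / ?c\<^sup>2"
    unfolding form_lincomb_same[OF h h] by (simp add: power_divide)
  finally show ?thesis using False by (simp add: field_simps)
qed

lemma unit_minimizer_nonneg:
  assumes w: "unit_minimizer s t w" and s: "0 \<le> s" and t: "0 < t"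
  shows "nonneg_fun \<Omega> w"
proof -
  have H: "H10 \<Omega> w" and I: "(LINT x|M. w x) = 1" using w by (auto simp: unit_minimizer_def)
  obtain \<phi> q where \<phi>: "\<And>n::nat. test (\<phi> n)"
    "(\<lambda>n. LINT x|M. (\<phi> n x)\<^sup>2) \<longlonglongrightarrow> (LINT x|M. \<bar>w x\<bar>)"
    "\<And>n. Q s t (\<lambda>x. (\<phi> n x)\<^sup>2) \<le> q n" "q \<longlonglongrightarrow> Q s t w"
    using H10_square_approx[OF H s less_imp_le[OF t]] by blast
  have "Q s t w * (LINT x|M. (\<phi> n x)\<^sup>2)\<^sup>2 \<le> q n" for n
  proof (rule order_trans[OF unit_minimizer_le[OF w _ s less_imp_le[OF t]] \<phi>(3)])
    show "H10 \<Omega> (\<lambda>x. (\<phi> n x)\<^sup>2)"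
      unfolding power2_eq_square
      by (intro test_H10 test_bilinear[OF bounded_bilinear_mult \<phi>(1) test_Ck[OF \<phi>(1)]])
  qed
  then have "Q s t w * (LINT x|M. \<bar>w x\<bar>)\<^sup>2 \<le> Q s t w"
    by (intro LIMSEQ_le[OF tendsto_mult[OF tendsto_const tendsto_power[OF \<phi>(2)]] \<phi>(4)]) auto
  \<comment> \<open>Positivity of the minimum permits cancelling it. The mass of
    \<open>\<bar>w\<bar>\<close> is then at most that of \<open>w\<close>, which leaves integral
    zero for the nonnegative function \<open>\<bar>w\<bar> - w\<close>.\<close>
  then have "(LINT x|M. \<bar>w x\<bar>)\<^sup>2 \<le> 1"
    using unit_minimizer_pos[OF w s t] by simp
  then have "(LINT x|M. \<bar>w x\<bar>) \<le> 1"
    by (rule power2_le_imp_le[of _ 1, unfolded power_one]) simp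
  moreover have iw: "integrable M w" by (rule H10_integrable[OF H])
  ultimately have "(LINT x|M. \<bar>w x\<bar> - w x) \<le> 0" using I by simp
  moreover have "(LINT x|M. \<bar>w x\<bar> - w x) \<ge> 0" by (intro Bochner_Integration.integral_nonneg) auto
  ultimately have "(LINT x|M. \<bar>w x\<bar> - w x) = 0" by simp
  then have "AE x in M. \<bar>w x\<bar> - w x = 0"
    using iw by (subst (asm) integral_nonneg_eq_0_iff_AE) auto
  then show ?thesis unfolding nonneg_fun_def by eventually_elim simp
qed

text \<open>Subtracting from \<open>v\<close> its mass times \<open>w\<close> gives a variation
  \<open>z\<close> that preserves the constraint in both directions. The multiplier is the minimum
  itself, as the choice \<open>v = w\<close> shows.\<close>

lemma unit_minimizer_euler_lagrange:
  assumes w: "unit_minimizer s t w" and v: "H10 \<Omega> v"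
  shows "form s t w v = Q s t w * (LINT x|M. v x)"
proof -
  have H: "H10 \<Omega> w" and I: "(LINT x|M. w x) = 1" using w by (auto simp: unit_minimizer_def)
  define c where "c = (LINT x|M. v x)"
  define z where "z x = 1 * v x + (- c) * w x" for x
  have Hz: "H10 \<Omega> z" unfolding z_def[abs_def] by (intro H10_real_lincomb v H)
  have iz: "integrable M z" and iw: "integrable M w" and iv: "integrable M v"
    using H10_integrable Hz H v by auto
  have z0: "(LINT x|M. z x) = 0"
    unfolding z_def using iw iv I by (simp add: c_def)
  note h = H10_imp_H1[OF H] H10_imp_H1[OF Hz] H10_imp_H1[OF v]
  have q: "0 \<le> 2 * r * form s t w z + r\<^sup>2 * Q s t z" for r
  proof -
    have "Q s t w \<le> Q s t (\<lambda>x. 1 * w x + r * z x)"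
    proof -
      have "H10 \<Omega> (\<lambda>x. 1 * w x + r * z x)" by (intro H10_real_lincomb H Hz)
      moreover have "(LINT x|M. 1 * w x + r * z x) = 1" using iw iz I z0 by simp
      ultimately show ?thesis using w unfolding unit_minimizer_def by blast
    qed
    then show ?thesis unfolding form_lincomb_same[OF h(1,2)] by simp
  qed
  have "form s t w z = 0"
  proof (rule ccontr)
    assume nz: "form s t w z \<noteq> 0"
    \<comment> \<open>The added \<open>1\<close> makes \<open>k\<close> a positive bound for the
      quadratic coefficient; at \<open>r = - a / k\<close> the increment of the form is at most
      \<open>- a\<^sup>2 / k\<close>.\<close>
    define a k where "a = form s t w z" and "k = \<bar>form s t z z\<bar> + 1"
    have k: "k > 0" "Q s t z \<le> k" by (auto simp: k_def)
    have "0 \<le> 2 * (- a / k) * a + (- a / k)\<^sup>2 * Q s t z" using q[of "- a / k"] by (simp add: a_def)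
    also have "\<dots> \<le> 2 * (- a / k) * a + (- a / k)\<^sup>2 * k" using k by (intro add_left_mono mult_left_mono) auto
    also have "\<dots> = - (a\<^sup>2 / k)" using k by (simp add: field_simps power2_eq_square)
    finally show False using nz k by (simp add: a_def divide_le_0_iff not_less[symmetric])
  qed
  moreover have "form s t w z = form s t w v - c * Q s t w"
    unfolding z_def[abs_def] form_lincomb_right[OF h(3) h(1) h(1)] by simp
  ultimately show ?thesis by (simp add: c_def mult.commute)
qed

end

section \<open>The density of a wave function in \<open>H\<^sub>0\<^sup>1\<close>\<close>

text \<open>This factor multiplies the gradient of the wave function in the gradient of the
  saturated density, so its bound keeps the latter square integrable. With
  \<open>y = (norm z)\<^sup>2 / k\<close> one has
  \<open>norm z \<le> 1 + k * y \<le> (1 + k) * exp y\<close>.\<close>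

lemma exp_cutoff_bounded:
  fixes z :: "'b::real_inner"
  assumes k: "0 < k"
  shows "exp (- (1 / k * (z \<bullet> z))) * norm z \<le> 1 + k"
proof -
  define y where "y = z \<bullet> z / k"
  have y: "0 \<le> y" using k by (simp add: y_def)
  have z2: "(norm z)\<^sup>2 = k * y" using k by (simp add: y_def power2_norm_eq_inner)
  have "2 * norm z \<le> 1 + (norm z)\<^sup>2"
    using zero_le_power2[of "norm z - 1"] by (simp add: power2_eq_square algebra_simps)
  then have "norm z \<le> 1 + (norm z)\<^sup>2" using norm_ge_zero[of z] by linarith
  also have "\<dots> \<le> (1 + k) * (1 + y)"
    using k y by (simp add: z2 algebra_simps)
  also have "\<dots> \<le> (1 + k) * exp y"
    using k exp_ge_add_one_self[of y] by (intro mult_left_mono) auto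
  finally have "norm z \<le> (1 + k) * exp y" .
  then have "exp (- y) * norm z \<le> exp (- y) * ((1 + k) * exp y)"
    by (intro mult_left_mono) auto
  also have "\<dots> = 1 + k"
    by (simp add: exp_minus field_simps)
  finally show ?thesis by (simp add: y_def)
qed

text \<open>The squeeze comes from \<open>1 - x \<le> exp (- x) \<le> 1 / (1 + x)\<close> at
  \<open>x = y / (n + 1)\<close>.\<close>

lemma saturate_tendsto:
  fixes y :: real
  assumes y: "0 \<le> y"
  shows "(\<lambda>n. real (Suc n) * (1 - exp (- (1 / real (Suc n) * y)))) \<longlonglongrightarrow> y"
proof (rule tendsto_sandwich)
  have l: "(\<lambda>n. inverse (real (Suc n))) \<longlonglongrightarrow> 0" by (rule LIMSEQ_inverse_real_of_nat)
  have "(\<lambda>n. y / (1 + inverse (real (Suc n)) * y)) \<longlonglongrightarrow> y / (1 + 0 * y)"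
    by (intro tendsto_intros l) auto
  then show "(\<lambda>n. y / (1 + inverse (real (Suc n)) * y)) \<longlonglongrightarrow> y" by simp
  have "y / (1 + inverse (real (Suc n)) * y) \<le> real (Suc n) * (1 - exp (- (1 / real (Suc n) * y)))" for n
  proof -
    define x where "x = inverse (real (Suc n)) * y"
    have x: "0 \<le> x" "1 / real (Suc n) * y = x" "y = real (Suc n) * x"
      using y by (simp_all add: x_def divide_inverse)
    have "exp (- x) \<le> inverse (1 + x)"
      unfolding exp_minus using x exp_ge_add_one_self[of x] by (intro le_imp_inverse_le) auto
    moreover have "x / (1 + x) = 1 - inverse (1 + x)" using x(1) by (simp add: field_simps)
    ultimately have "x / (1 + x) \<le> 1 - exp (- x)" by simp
    then have "real (Suc n) * (x / (1 + x)) \<le> real (Suc n) * (1 - exp (- x))"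
      by (rule mult_left_mono) simp
    then show ?thesis unfolding x(2) x_def[symmetric] by (simp add: x(3))
  qed
  then show "\<forall>\<^sub>F n in sequentially. y / (1 + inverse (real (Suc n)) * y)
      \<le> real (Suc n) * (1 - exp (- (1 / real (Suc n) * y)))" by simp
  have "real (Suc n) * (1 - exp (- (1 / real (Suc n) * y))) \<le> y" for n
    using mult_left_mono[OF exp_ge_add_one_self[of "- (1 / real (Suc n) * y)"], of "real (Suc n)"]
    by (simp add: algebra_simps del: of_nat_Suc)
  then show "\<forall>\<^sub>F n in sequentially. real (Suc n) * (1 - exp (- (1 / real (Suc n) * y))) \<le> y" by simp
qed simp

context bounded_open begin

text \<open>Saturation makes both the density and the factor in its chain rule bounded. The
  saturated densities of approximating test functions therefore converge together with their
  derivatives, although the approximants themselves are not uniformly bounded.\<close>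

lemma H10_saturated_norm_sq:
  fixes \<phi> :: "'a \<Rightarrow> 'b::euclidean_space"
  assumes \<phi>: "H10 \<Omega> \<phi>" and k: "0 < k"
  shows "H10 \<Omega> (\<lambda>x. k * (1 - exp (- (1 / k * (\<phi> x \<bullet> \<phi> x)))))"
    and "b \<in> Basis \<Longrightarrow> has_weak_pd \<Omega> b (\<lambda>x. k * (1 - exp (- (1 / k * (\<phi> x \<bullet> \<phi> x)))))
       (\<lambda>x. exp (- (1 / k * (\<phi> x \<bullet> \<phi> x))) * (2 * (\<phi> x \<bullet> D b \<phi> x)))"
proof -
  note h = H1D[OF H10_imp_H1[OF \<phi>]]
  obtain \<psi>0 where \<psi>0: "\<And>n::nat. test (\<psi>0 n)" "L2_lim \<psi>0 \<phi>"
    "\<And>b. b \<in> Basis \<Longrightarrow> L2_lim (\<lambda>n. pd b (\<psi>0 n)) (D b \<phi>)"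
    using H10E[OF \<phi>] by blast
  obtain r where r: "strict_mono r" "AE x in M. (\<lambda>n. \<psi>0 (r n) x) \<longlonglongrightarrow> \<phi> x"
    using L2_conv_AE_subseq[OF test_Lp[OF \<psi>0(1)] h(1) \<psi>0(2)] by blast
  \<comment> \<open>Convergence almost everywhere is what dominated convergence needs; passing to a
    subsequence keeps the convergence of the derivatives.\<close>
  define \<psi> where "\<psi> n = \<psi>0 (r n)" for n
  have \<psi>: "test (\<psi> n)" for n by (simp add: \<psi>_def \<psi>0(1))
  have ae: "AE x in M. (\<lambda>n. \<psi> n x) \<longlonglongrightarrow> \<phi> x" using r(2) by (simp add: \<psi>_def)
  have gr: "L2_lim (\<lambda>n. pd b (\<psi> n)) (D b \<phi>)" if "b \<in> Basis" for b
    using LIMSEQ_subseq_LIMSEQ[OF \<psi>0(3)[OF that] r(1)] by (simp add: comp_def \<psi>_def)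
  have [measurable]: "\<phi> \<in> borel_measurable M" "\<psi> n \<in> borel_measurable M" for n
    using Lp2D(1)[OF h(1)] Lp2D(1)[OF test_Lp[OF \<psi>]] by auto
  define T where "T y = k * (1 - exp (- (1 / k * y)))" for y :: real
  \<comment> \<open>The gradient of \<open>T (z \<bullet> z)\<close> in \<open>z\<close>: bounded
    and continuous, unlike \<open>2 *\<^sub>R z\<close>.\<close>
  define c where "c z = exp (- (1 / k * (z \<bullet> z))) *\<^sub>R 2 *\<^sub>R z" for z :: 'b
  have T: "0 \<le> T y" "T y \<le> k" if "0 \<le> y" for y
    using k that by (auto simp: T_def mult_le_cancel_left1 zero_le_mult_iff)
  have cbd: "norm (c z) \<le> 2 * (1 + k)" for z
    using exp_cutoff_bounded[OF k, of z] by (simp add: c_def)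
  have ccont: "isCont c z" for z
    unfolding c_def by (intro continuous_intros)
  have [measurable]: "c \<in> borel_measurable borel"
    by (intro borel_measurable_continuous_onI continuous_at_imp_continuous_on) (use ccont in auto)
  have Tcont: "isCont T y" for y
    unfolding T_def by (intro continuous_intros)
  have \<psi>2: "test (\<lambda>x. \<psi> n x \<bullet> \<psi> n x)" for n
    by (rule test_bilinear[OF bounded_bilinear_inner \<psi> test_Ck[OF \<psi>]])
  have Tt: "test (\<lambda>x. T (\<psi> n x \<bullet> \<psi> n x))" for n
    unfolding T_def by (rule test_saturate[OF \<psi>2])
  have pdT: "pd b (\<lambda>x. T (\<psi> n x \<bullet> \<psi> n x)) x = c (\<psi> n x) \<bullet> pd b (\<psi> n) x" for b n x
  proof -
    have "(T has_real_derivative exp (- (1 / k * y))) (at y)" for y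
      unfolding T_def using k by (auto intro!: derivative_eq_intros)
    from pd_compose[OF this test_differentiable[OF \<psi>2]]
    have "pd b (\<lambda>x. T (\<psi> n x \<bullet> \<psi> n x)) x = exp (- (1 / k * (\<psi> n x \<bullet> \<psi> n x))) * pd b (\<lambda>x. \<psi> n x \<bullet> \<psi> n x) x" .
    also have "pd b (\<lambda>x. \<psi> n x \<bullet> \<psi> n x) x = 2 * (\<psi> n x \<bullet> pd b (\<psi> n) x)"
      by (simp add: pd_bilinear[OF bounded_bilinear_inner] test_differentiable[OF \<psi>] inner_commute)
    finally show ?thesis by (simp add: c_def)
  qed
  have LpT: "L2 (\<lambda>x. T (\<phi> x \<bullet> \<phi> x))"
    by (rule Lp2_bounded[of _ k]) (use T in \<open>auto simp: T_def\<close>)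
  have convT: "L2_lim (\<lambda>n x. T (\<psi> n x \<bullet> \<psi> n x)) (\<lambda>x. T (\<phi> x \<bullet> \<phi> x))"
  proof (rule L2_conv_dominated)
    show "AE x in M. (\<lambda>n. T (\<psi> n x \<bullet> \<psi> n x)) \<longlonglongrightarrow> T (\<phi> x \<bullet> \<phi> x)"
      using ae by eventually_elim (intro isCont_tendsto_compose[OF Tcont] tendsto_inner)
    show "L2 (\<lambda>x. k)" by (rule Lp2_bounded[of _ k]) (use k in auto)
    show "AE x in M. norm (T (\<psi> n x \<bullet> \<psi> n x) - T (\<phi> x \<bullet> \<phi> x)) \<le> norm k" for n
    proof (rule AE_I2)
      fix x
      show "norm (T (\<psi> n x \<bullet> \<psi> n x) - T (\<phi> x \<bullet> \<phi> x)) \<le> norm k"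
        using T[of "\<psi> n x \<bullet> \<psi> n x"] T[of "\<phi> x \<bullet> \<phi> x"] k by (simp add: abs_le_iff)
    qed
  qed (use Lp2D(1)[OF LpT] Lp2D(1)[OF test_Lp[OF Tt]] in auto)
  define G where "G b x = c (\<phi> x) \<bullet> D b \<phi> x" for b x
  have inner_bd: "norm (c z \<bullet> v) \<le> 2 * (1 + k) * norm v" for z v
    using Cauchy_Schwarz_ineq2[of "c z" v] mult_right_mono[OF cbd[of z] norm_ge_zero[of v]] by simp
  have LpG: "L2 (G b)" if b: "b \<in> Basis" for b
  proof (rule Lp2_bound[OF h(2)[OF b]])
    show "G b \<in> borel_measurable M"
      unfolding G_def using Lp2D(1)[OF h(2)[OF b]] by measurable
    show "AE x in M. norm (G b x) \<le> 2 * (1 + k) * norm (D b \<phi> x)"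
      unfolding G_def by (rule AE_I2) (rule inner_bd)
  qed
  have convG: "L2_lim (\<lambda>n x. pd b (\<lambda>x. T (\<psi> n x \<bullet> \<psi> n x)) x) (G b)" if b: "b \<in> Basis" for b
  proof -
    let ?D = "D b \<phi>"
    have [measurable]: "?D \<in> borel_measurable M" "pd b (\<psi> n) \<in> borel_measurable M" for n
      using Lp2D(1)[OF h(2)[OF b]] Lp2D(1)[OF test_Lp[OF test_pd[OF \<psi> b]]] by auto
    \<comment> \<open>The derivative is \<open>A n + B n\<close>. In \<open>A n\<close> a bounded
      factor meets a difference that tends to zero in mean square; in \<open>B n\<close> the
      gradient is fixed and only the bounded factor varies, so dominated convergence
      applies.\<close>
    define A where "A n x = c (\<psi> n x) \<bullet> (pd b (\<psi> n) x - ?D x)" for n x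
    define B where "B n x = c (\<psi> n x) \<bullet> ?D x" for n x
    note dL = Lp2_diff[OF test_Lp[OF test_pd[OF \<psi> b]] h(2)[OF b]]
    have [measurable]: "A n \<in> borel_measurable M" "B n \<in> borel_measurable M" "G b \<in> borel_measurable M"
      for n
      unfolding A_def B_def G_def by measurable
    have LA: "L2 (A n)" for n
    proof (rule Lp2_bound[OF dL[of n]])
      show "AE x in M. norm (A n x) \<le> 2 * (1 + k) * norm (pd b (\<psi> n) x - ?D x)"
        unfolding A_def by (rule AE_I2) (rule inner_bd)
    qed measurable
    have LB: "L2 (B n)" for n
    proof (rule Lp2_bound[OF h(2)[OF b]])
      show "AE x in M. norm (B n x) \<le> 2 * (1 + k) * norm (?D x)"
        unfolding B_def by (rule AE_I2) (rule inner_bd)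
    qed measurable
    have nA: "nrm (A n) \<le> 2 * (1 + k) * nrm (\<lambda>x. pd b (\<psi> n) x - ?D x)" for n
    proof -
      have "nrm (A n) \<le> nrm (\<lambda>x. (2 * (1 + k)) *\<^sub>R (pd b (\<psi> n) x - ?D x))"
      proof (intro L2_norm_mono Lp2_scaleR dL AE_I2)
        show "norm (A n x) \<le> norm ((2 * (1 + k)) *\<^sub>R (pd b (\<psi> n) x - ?D x))" for x
          unfolding A_def norm_scaleR using order_trans[OF inner_bd mult_right_mono[OF abs_ge_self
            norm_ge_zero]] .
      qed
      then show ?thesis unfolding L2_norm_scaleR using k by simp
    qed
    have cB: "L2_lim B (G b)"
    proof (rule L2_conv_dominated)
      show "AE x in M. (\<lambda>n. B n x) \<longlonglongrightarrow> G b x"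
        unfolding B_def G_def
        using ae by eventually_elim (intro tendsto_inner isCont_tendsto_compose[OF ccont] tendsto_const)
      show "L2 (\<lambda>x. (4 * (1 + k)) *\<^sub>R ?D x)" by (rule Lp2_scaleR[OF h(2)[OF b]])
      show "AE x in M. norm (B n x - G b x) \<le> norm ((4 * (1 + k)) *\<^sub>R ?D x)" for n
      proof (rule AE_I2)
        fix x
        have "norm (B n x - G b x) \<le> norm (B n x) + norm (G b x)" by (rule norm_triangle_ineq4)
        also have "\<dots> \<le> 2 * (1 + k) * norm (?D x) + 2 * (1 + k) * norm (?D x)"
          unfolding B_def G_def by (intro add_mono inner_bd)
        also have "\<dots> = norm ((4 * (1 + k)) *\<^sub>R ?D x)"
        proof -
          have "\<bar>4 * (1 + k)\<bar> = 4 * (1 + k)" using k by simp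
          then show ?thesis unfolding norm_scaleR by (simp add: algebra_simps)
        qed
        finally show "norm (B n x - G b x) \<le> norm ((4 * (1 + k)) *\<^sub>R ?D x)" .
      qed
    qed measurable
    show ?thesis
    proof (rule Lim_null_comparison)
      show "(\<lambda>n. 2 * (1 + k) * nrm (\<lambda>x. pd b (\<psi> n) x - ?D x) + nrm (\<lambda>x. B n x - G b x)) \<longlonglongrightarrow> 0"
        using tendsto_add[OF tendsto_mult_right_zero[OF gr[OF b], of "2 * (1 + k)"] cB] by simp
      have "nrm (\<lambda>x. pd b (\<lambda>x. T (\<psi> n x \<bullet> \<psi> n x)) x - G b x)
         \<le> 2 * (1 + k) * nrm (\<lambda>x. pd b (\<psi> n) x - ?D x) + nrm (\<lambda>x. B n x - G b x)" for n
      proof -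
        have "(\<lambda>x. pd b (\<lambda>x. T (\<psi> n x \<bullet> \<psi> n x)) x - G b x) = (\<lambda>x. A n x + (B n x - G b x))"
          by (simp add: pdT A_def B_def inner_diff_right)
        then show ?thesis
          using L2_norm_triangle[OF LA[of n] Lp2_diff[OF LB[of n] LpG[OF b]]] nA[of n] by simp
      qed
      then show "\<forall>\<^sub>F n in sequentially. norm (nrm (\<lambda>x. pd b (\<lambda>x. T (\<psi> n x \<bullet> \<psi> n x)) x - G b x))
         \<le> 2 * (1 + k) * nrm (\<lambda>x. pd b (\<psi> n) x - ?D x) + nrm (\<lambda>x. B n x - G b x)"
        by (simp add: L2_norm_nonneg)
    qed
  qed
  show "H10 \<Omega> (\<lambda>x. k * (1 - exp (- (1 / k * (\<phi> x \<bullet> \<phi> x)))))"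
    using H10I(1)[OF Tt LpT convT LpG convG] by (simp add: T_def)
  have "has_weak_pd \<Omega> b (\<lambda>x. T (\<phi> x \<bullet> \<phi> x)) (G b)" if "b \<in> Basis"
    by (rule H10I(2)[OF Tt LpT convT LpG convG]) (use that in auto)
  then show "has_weak_pd \<Omega> b (\<lambda>x. k * (1 - exp (- (1 / k * (\<phi> x \<bullet> \<phi> x)))))
       (\<lambda>x. exp (- (1 / k * (\<phi> x \<bullet> \<phi> x))) * (2 * (\<phi> x \<bullet> D b \<phi> x)))" if "b \<in> Basis"
    using that by (simp add: T_def G_def[abs_def] c_def mult.assoc)
qed

text \<open>Smooth saturation replaces the truncation \<open>min (\<bar>\<phi>\<bar>\<^sup>2) k\<close>, so that the chain rule is only
  needed for test functions.\<close>

lemma H10_norm_sq: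
  fixes \<phi> :: "'a \<Rightarrow> 'b::euclidean_space"
  assumes \<phi>: "H10 \<Omega> \<phi>" and \<rho>: "H1 \<Omega> (\<lambda>x. \<phi> x \<bullet> \<phi> x)"
  shows "H10 \<Omega> (\<lambda>x. \<phi> x \<bullet> \<phi> x)"
proof -
  let ?g = "\<lambda>b x. 2 * (\<phi> x \<bullet> D b \<phi> x)"
  note h = H1D[OF H10_imp_H1[OF \<phi>]] and hr = H1D[OF \<rho>]
  define E where "E n x = exp (- (1 / real (Suc n) * (\<phi> x \<bullet> \<phi> x)))" for n x
  define U where "U n x = real (Suc n) * (1 - E n x)" for n x
  have HU: "H10 \<Omega> (U n)" for n
    using H10_saturated_norm_sq(1)[OF \<phi>, of "real (Suc n)"] by (simp add: U_def[abs_def] E_def)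
  have WU: "has_weak_pd \<Omega> b (U n) (\<lambda>x. E n x * ?g b x)" if "b \<in> Basis" for b n
    using H10_saturated_norm_sq(2)[OF \<phi>, of "real (Suc n)" b] that by (simp add: U_def[abs_def] E_def)
  have [measurable]: "\<phi> \<in> borel_measurable M" using Lp2D(1)[OF h(1)] .
  have E: "0 \<le> E n x" "E n x \<le> 1" for n x by (auto simp: E_def)
  have Elim: "(\<lambda>n. E n x) \<longlonglongrightarrow> 1" for x
  proof -
    have "(\<lambda>n. exp (- (inverse (real (Suc n)) * (\<phi> x \<bullet> \<phi> x)))) \<longlonglongrightarrow> exp (- (0 * (\<phi> x \<bullet> \<phi> x)))"
      by (intro tendsto_intros LIMSEQ_inverse_real_of_nat)
    then show ?thesis by (simp add: E_def inverse_eq_divide)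
  qed
  have U: "0 \<le> U n x" "U n x \<le> \<phi> x \<bullet> \<phi> x" for n x
  proof -
    show "0 \<le> U n x" using E by (simp add: U_def)
    show "U n x \<le> \<phi> x \<bullet> \<phi> x"
      using mult_left_mono[OF exp_ge_add_one_self[of "- (1 / real (Suc n) * (\<phi> x \<bullet> \<phi> x))"], of "real
        (Suc n)"]
      by (simp add: U_def E_def algebra_simps del: of_nat_Suc)
  qed
  have Ulim: "(\<lambda>n. U n x) \<longlonglongrightarrow> \<phi> x \<bullet> \<phi> x" for x
    unfolding U_def E_def by (rule saturate_tendsto) simp
  have [measurable]: "U n \<in> borel_measurable M" "E n \<in> borel_measurable M" for n
    unfolding U_def E_def by measurable
  have ir: "integrable M (\<lambda>x. \<phi> x \<bullet> \<phi> x)" by (rule Lp2_integrable[OF hr(1)])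
  \<comment> \<open>The product \<open>2 * (\<phi> x \<bullet> D b \<phi> x)\<close> is a priori
    only integrable, so this limit of the saturated densities is taken inside the weak identity.
    Uniqueness then equates it with the square integrable derivative supplied by the
    hypothesis.\<close>
  have wr: "AE x in M. D b (\<lambda>x. \<phi> x \<bullet> \<phi> x) x = ?g b x"
    if b: "b \<in> Basis" for b
  proof (rule weak_pd_AE)
    have [measurable]: "D b \<phi> \<in> borel_measurable M" using Lp2D(1)[OF h(2)[OF b]] .
    have ig: "integrable M (\<lambda>x. ?g b x)"
      using integrable_bilinear[OF bounded_bilinear_inner h(1) h(2)[OF b]] by simp
    show "has_weak_pd \<Omega> b (\<lambda>x. \<phi> x \<bullet> \<phi> x) (\<lambda>x. ?g b x)"
      unfolding has_weak_pd_def
    proof (intro conjI allI impI integrable_imp_loc_integrable ir ig)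
      fix \<psi> :: "'a \<Rightarrow> real" assume \<psi>: "test \<psi>"
      obtain C where C: "0 \<le> C" "\<And>x. norm (\<psi> x) \<le> C" using test_bounded[OF \<psi>] by blast
      obtain C' where C': "0 \<le> C'" "\<And>x. norm (pd b \<psi> x) \<le> C'"
        using test_bounded[OF test_pd[OF \<psi> b]] by blast
      have [measurable]: "\<psi> \<in> borel_measurable M" "pd b \<psi> \<in> borel_measurable M"
        using test_measurable[OF \<psi> sets_\<Omega>] test_measurable[OF test_pd[OF \<psi> b] sets_\<Omega>] by auto
      have "(\<lambda>n. LINT x|M. pd b \<psi> x *\<^sub>R U n x) \<longlonglongrightarrow> (LINT x|M. pd b \<psi> x *\<^sub>R (\<phi> x \<bullet> \<phi> x))"
      proof (rule integral_dominated_convergence)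
        show "integrable M (\<lambda>x. C' * (\<phi> x \<bullet> \<phi> x))" using ir by simp
        show "AE x in M. (\<lambda>n. pd b \<psi> x *\<^sub>R U n x) \<longlonglongrightarrow> pd b \<psi> x *\<^sub>R (\<phi> x \<bullet> \<phi> x)"
          by (intro AE_I2 tendsto_scaleR tendsto_const Ulim)
        show "AE x in M. norm (pd b \<psi> x *\<^sub>R U n x) \<le> C' * (\<phi> x \<bullet> \<phi> x)" for n
        proof (rule AE_I2)
          show "norm (pd b \<psi> x *\<^sub>R U n x) \<le> C' * (\<phi> x \<bullet> \<phi> x)" for x
            using mult_mono[OF C'(2)[of x] U(2)[of n x] C'(1) U(1)[of n x]] U(1)[of n x] by (simp add:
              abs_mult)
        qed
      qed measurable
      moreover have "(\<lambda>n. LINT x|M. \<psi> x *\<^sub>R (E n x * ?g b x))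
          \<longlonglongrightarrow> (LINT x|M. \<psi> x *\<^sub>R ?g b x)"
      proof (rule integral_dominated_convergence)
        show "integrable M (\<lambda>x. C * norm (?g b x))" using ig by simp
        have "(\<lambda>n. \<psi> x *\<^sub>R (E n x * ?g b x)) \<longlonglongrightarrow> \<psi> x *\<^sub>R (1 * ?g b x)" for x
          by (intro tendsto_scaleR tendsto_mult tendsto_const Elim)
        then show "AE x in M. (\<lambda>n. \<psi> x *\<^sub>R (E n x * ?g b x)) \<longlonglongrightarrow> \<psi> x *\<^sub>R ?g b x"
          by simp
        show "AE x in M. norm (\<psi> x *\<^sub>R (E n x * ?g b x)) \<le> C * norm (?g b x)" for n
        proof (rule AE_I2)
          fix x
          have "norm (E n x * ?g b x) \<le> norm (?g b x)"
            unfolding norm_mult[of "E n x"] using E[of n x] by (intro mult_left_le_one_le) auto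
          then show "norm (\<psi> x *\<^sub>R (E n x * ?g b x)) \<le> C * norm (?g b x)"
            unfolding norm_scaleR using C(2)[of x] C(1) by (intro mult_mono) auto
        qed
      qed measurable
      then have "(\<lambda>n. LINT x|M. pd b \<psi> x *\<^sub>R U n x) \<longlonglongrightarrow> - (LINT x|M. \<psi> x *\<^sub>R ?g b x)"
        using tendsto_minus WU[OF b] \<psi> unfolding has_weak_pd_def by force
      ultimately show "(LINT x|M. pd b \<psi> x *\<^sub>R (\<phi> x \<bullet> \<phi> x)) = - (LINT x|M. \<psi> x *\<^sub>R ?g b x)"
        by (rule LIMSEQ_unique)
    qed
  qed
  show ?thesis
  proof (rule H10_closed(1)[of U, OF HU hr(1) _ hr(2)])
    show "L2_lim U (\<lambda>x. \<phi> x \<bullet> \<phi> x)"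
    proof (rule L2_conv_dominated[OF _ _ _ hr(1)])
      show "AE x in M. norm (U n x - \<phi> x \<bullet> \<phi> x) \<le> norm (\<phi> x \<bullet> \<phi> x)" for n
      proof (rule AE_I2)
        show "norm (U n x - \<phi> x \<bullet> \<phi> x) \<le> norm (\<phi> x \<bullet> \<phi> x)" for x using U[of n x] by simp
      qed
    qed (use Ulim in auto)
    fix b :: 'a assume b: "b \<in> Basis"
    show "L2_lim (\<lambda>n. D b (U n)) (\<lambda>x. D b (\<lambda>x. \<phi> x \<bullet> \<phi> x) x)"
    proof (rule L2_conv_dominated[OF _ _ _ hr(2)[OF b]])
      \<comment> \<open>The derivative of \<open>U n\<close> is \<open>E n\<close>, a factor between
        zero and one, times the square integrable derivative of the density, which thus serves as
        majorant.\<close>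
      have wU: "AE x in M. D b (U n) x = E n x * D b (\<lambda>x. \<phi> x \<bullet> \<phi> x) x" for n
        using weak_pd_AE[OF WU[OF b]] wr[OF b] by eventually_elim simp
      show "AE x in M. norm (D b (U n) x - D b (\<lambda>x. \<phi> x \<bullet> \<phi> x) x)
          \<le> norm (D b (\<lambda>x. \<phi> x \<bullet> \<phi> x) x)" for n
        using wU[of n]
      proof eventually_elim
        case (elim x)
        let ?w = "D b (\<lambda>x. \<phi> x \<bullet> \<phi> x) x"
        have "D b (U n) x - ?w = - ((1 - E n x) * ?w)"
          by (simp add: elim algebra_simps)
        then have "norm (D b (U n) x - ?w) = (1 - E n x) * norm ?w"
          using E[of n x] by (simp add: abs_mult)
        also have "\<dots> \<le> norm ?w" using E[of n x] by (intro mult_left_le_one_le) auto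
        finally show ?case .
      qed
      have "AE x in M. \<forall>n. D b (U n) x = E n x * D b (\<lambda>x. \<phi> x \<bullet> \<phi> x) x"
        using wU by (simp add: AE_all_countable)
      then show "AE x in M. (\<lambda>n. D b (U n) x) \<longlonglongrightarrow> D b (\<lambda>x. \<phi> x \<bullet> \<phi> x) x"
      proof eventually_elim
        case (elim x)
        have "(\<lambda>n. E n x * D b (\<lambda>x. \<phi> x \<bullet> \<phi> x) x) \<longlonglongrightarrow> 1 * D b (\<lambda>x. \<phi> x \<bullet> \<phi> x) x"
          by (intro tendsto_mult Elim tendsto_const)
        then show ?case using elim by simp
      qed
    qed (use Lp2D(1)[OF H1D(2)[OF H10_imp_H1[OF HU] b]] Lp2D(1)[OF hr(2)[OF b]] in auto)
  qed
qed

section \<open>Limits of ground states\<close>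

lemma abs_sq_inner: "abs_sq \<phi> = (\<lambda>x. \<phi> x \<bullet> \<phi> x)"
  by (simp add: abs_sq_def[abs_def] power2_norm_eq_inner)

lemma Lp2_abs_sq:
  assumes "Lp 4 \<Omega> \<phi>" shows "L2 (abs_sq \<phi>)"
proof -
  have [measurable]: "\<phi> \<in> borel_measurable M" using assms by (simp add: Lp_def)
  have "norm (abs_sq \<phi> x) ^ 2 = norm (\<phi> x) ^ 4" for x
    by (simp add: abs_sq_def power_mult[symmetric])
  then show ?thesis
    using assms unfolding Lp_def by (simp add: abs_sq_def[abs_def])
qed

text \<open>Finite energy puts the density into \<open>H\<^sup>1\<close>; the zero boundary values
  come from those of the wave function through \<open>H10_norm_sq\<close>.\<close>

lemma admissible_density_abs_sq:
  assumes "admissible \<Omega> \<phi>"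
  shows "H10 \<Omega> (abs_sq \<phi>)" "(LINT x|M. abs_sq \<phi> x) = 1"
proof -
  have \<phi>: "H10 \<Omega> \<phi>" "nrm \<phi> = 1" "Lp 4 \<Omega> \<phi>" "weakly_differentiable \<Omega> (abs_sq \<phi>)"
    "integrable M (grad_sq \<Omega> (abs_sq \<phi>))"
    using assms by (auto simp: admissible_def finite_energy_def)
  show "(LINT x|M. abs_sq \<phi> x) = 1"
    using L2_norm_sq[of \<phi>] \<phi>(2) by (simp add: abs_sq_def)
  have "H1 \<Omega> (abs_sq \<phi>)"
    unfolding H1_def
  proof (intro conjI ballI)
    show "L2 (abs_sq \<phi>)" by (rule Lp2_abs_sq[OF \<phi>(3)])
    fix b :: 'a assume b: "b \<in> Basis"
    let ?g = "D b (abs_sq \<phi>)"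
    obtain g where "has_weak_pd \<Omega> b (abs_sq \<phi>) g"
      using \<phi>(4) b by (auto simp: weakly_differentiable_def)
    then have w: "has_weak_pd \<Omega> b (abs_sq \<phi>) ?g" by (rule has_weak_pd_weak_pd)
    have "L2 ?g"
    proof (rule Lp2I[OF \<phi>(5)])
      show "AE x in M. (norm (?g x))\<^sup>2 \<le> grad_sq \<Omega> (abs_sq \<phi>) x"
        unfolding grad_sq_def using b by (intro AE_I2 member_le_sum) auto
      show "?g \<in> borel_measurable M"
        using w by (auto simp: has_weak_pd_def intro: loc_integrable_measurable)
    qed
    with w show "\<exists>g. L2 g \<and> has_weak_pd \<Omega> b (abs_sq \<phi>) g" by blast
  qed
  then show "H10 \<Omega> (abs_sq \<phi>)"
    unfolding abs_sq_inner by (rule H10_norm_sq[OF \<phi>(1)])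
qed

lemma energy_eq_form:
  assumes "admissible \<Omega> \<phi>"
  shows "energy \<Omega> \<beta> \<delta> \<phi> = 1/2 * (LINT x|M. grad_sq \<Omega> \<phi> x)
    + 1/2 * Q \<beta> \<delta> (abs_sq \<phi>)"
proof -
  have \<phi>: "integrable M (grad_sq \<Omega> \<phi>)" "Lp 4 \<Omega> \<phi>"
    "integrable M (grad_sq \<Omega> (abs_sq \<phi>))"
    using assms by (auto simp: admissible_def finite_energy_def)
  note h = H1D[OF H10_imp_H1[OF admissible_density_abs_sq(1)[OF assms]]]
  have "(nrm (abs_sq \<phi>))\<^sup>2 = (LINT x|M. cmod (\<phi> x) ^ 4)"
    by (simp add: L2_norm_sq abs_sq_def power_mult[symmetric])
  moreover have "integrable M (\<lambda>x. cmod (\<phi> x) ^ 4)"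
    using \<phi>(2) by (simp add: Lp_def)
  ultimately show ?thesis
    using \<phi> by (simp add: energy_def form_same integral_grad_sq(2)[OF h(2)] algebra_simps)
qed

lemma test_admissible:
  assumes f: "test f" and 1: "(LINT x|M. (f x)\<^sup>2) = 1"
  shows "admissible \<Omega> (\<lambda>x. complex_of_real (f x))"
proof -
  have t: "test (\<lambda>x. complex_of_real (f x))"
    by (rule test_linear[OF bounded_linear_of_real f])
  have sq: "abs_sq (\<lambda>x. complex_of_real (f x)) = (\<lambda>x. f x * f x)"
    by (simp add: abs_sq_def[abs_def] power2_eq_square)
  have t2: "test (abs_sq (\<lambda>x. complex_of_real (f x)))"
    unfolding sq by (rule test_bilinear[OF bounded_bilinear_mult f test_Ck[OF f]])
  have "weakly_differentiable \<Omega> (abs_sq (\<lambda>x. complex_of_real (f x)))"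
    unfolding weakly_differentiable_def using test_has_weak_pd[OF t2] by blast
  then show ?thesis
    unfolding admissible_def finite_energy_def
    using test_H10[OF t] test_Lp[OF t]
      integral_grad_sq(1)[OF H1D(2)[OF test_H1[OF t]]]
      integral_grad_sq(1)[OF H1D(2)[OF test_H1[OF t2]]] 1
    by (simp add: L2_norm_def)
qed

text \<open>The kinetic energy of the ground state is dropped by its sign, and the common factor
  \<open>1/2\<close> is cleared. That of \<open>f\<close> depends on neither parameter.\<close>

lemma ground_state_form_le:
  assumes g: "ground_state \<Omega> \<beta> \<delta> \<phi>"
    and f: "test f" "(LINT x|M. (f x)\<^sup>2) = 1"
  shows "Q \<beta> \<delta> (abs_sq \<phi>)
    \<le> (LINT x|M. grad_sq \<Omega> (\<lambda>x. complex_of_real (f x)) x)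
      + Q \<beta> \<delta> (\<lambda>x. (f x)\<^sup>2)"
proof -
  have \<phi>: "admissible \<Omega> \<phi>" using g by (simp add: ground_state_def is_arg_min_def)
  have "energy \<Omega> \<beta> \<delta> \<phi> \<le> energy \<Omega> \<beta> \<delta> (\<lambda>x. complex_of_real (f x))"
    using g test_admissible[OF f] by (auto simp: ground_state_def is_arg_min_def not_less[symmetric])
  moreover have "0 \<le> (LINT x|M. grad_sq \<Omega> \<phi> x)"
    by (intro Bochner_Integration.integral_nonneg) (simp add: grad_sq_def sum_nonneg)
  moreover have "abs_sq (\<lambda>x. complex_of_real (f x)) = (\<lambda>x. (f x)\<^sup>2)"
    by (simp add: abs_sq_def[abs_def])
  ultimately show ?thesis
    by (simp add: energy_eq_form[OF \<phi>] energy_eq_form[OF test_admissible[OF f]])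
qed

text \<open>The scaling acts on the density by \<open>1 / \<integral> f\<^sup>2\<close>, hence on
  the form by its square. The identity holds for all coefficients with the same \<open>g\<close>, so
  it also covers the plain mean square norm.\<close>

lemma normalize_test_function:
  assumes f: "test f" and I: "0 < (LINT x|M. (f x)\<^sup>2)"
  obtains g where "test g" "(LINT x|M. (g x)\<^sup>2) = 1"
    "\<And>s t. Q s t (\<lambda>x. (g x)\<^sup>2)
       = Q s t (\<lambda>x. (f x)\<^sup>2) / (LINT x|M. (f x)\<^sup>2)\<^sup>2"
proof -
  let ?I = "LINT x|M. (f x)\<^sup>2"
  define c where "c = 1 / sqrt ?I"
  have c2: "c\<^sup>2 = 1 / ?I" using I by (simp add: c_def power_divide)
  have h: "H1 \<Omega> (\<lambda>x. (f x)\<^sup>2)"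
    unfolding power2_eq_square
    by (intro test_H1 test_bilinear[OF bounded_bilinear_mult f test_Ck[OF f]])
  show ?thesis
  proof (rule that[of "\<lambda>x. c *\<^sub>R f x"])
    show "test (\<lambda>x. c *\<^sub>R f x)"
      by (rule test_linear[OF bounded_linear_scaleR_right f])
    show "(LINT x|M. (c *\<^sub>R f x)\<^sup>2) = 1"
      using I c2 by (simp add: power_mult_distrib)
    have "(\<lambda>x. (c *\<^sub>R f x)\<^sup>2) = (\<lambda>x. c\<^sup>2 * (f x)\<^sup>2 + 0 * (f x)\<^sup>2)"
      by (simp add: power_mult_distrib)
    then show "Q s t (\<lambda>x. (c *\<^sub>R f x)\<^sup>2)
       = Q s t (\<lambda>x. (f x)\<^sup>2) / ?I\<^sup>2" for s t
      using form_lincomb_same[OF h h, of s t "c\<^sup>2" 0] by (simp add: c2 power_divide)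
  qed
qed

text \<open>Because \<open>w\<close> is nonnegative, the masses of the approximating squares tend to
  one, and normalizing them costs nothing in the limit. Hence squares of test functions reach the
  minimum over signed densities.\<close>

lemma unit_minimizer_approx:
  assumes w: "unit_minimizer s t w" and s: "0 \<le> s" and t: "0 < t" and e: "0 < e"
  obtains f where "test f" "(LINT x|M. (f x)\<^sup>2) = 1"
    "Q s t (\<lambda>x. (f x)\<^sup>2) < Q s t w + e"
proof -
  have H: "H10 \<Omega> w" and "(LINT x|M. w x) = 1" using w by (auto simp: unit_minimizer_def)
  moreover have "(LINT x|M. \<bar>w x\<bar>) = (LINT x|M. w x)"
  proof (rule integral_cong_AE)
    show "AE x in M. \<bar>w x\<bar> = w x"
      using unit_minimizer_nonneg[OF w s t] unfolding nonneg_fun_def by eventually_elim simp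
  qed (use H10_integrable[OF H] in auto)
  ultimately have abs1: "(LINT x|M. \<bar>w x\<bar>) = 1" by simp
  obtain \<phi> q where \<phi>: "\<And>n::nat. test (\<phi> n)"
    "(\<lambda>n. LINT x|M. (\<phi> n x)\<^sup>2) \<longlonglongrightarrow> (LINT x|M. \<bar>w x\<bar>)"
    "\<And>n. Q s t (\<lambda>x. (\<phi> n x)\<^sup>2) \<le> q n" "q \<longlonglongrightarrow> Q s t w"
    using H10_square_approx[OF H s less_imp_le[OF t]] by blast
  define I where "I n = (LINT x|M. (\<phi> n x)\<^sup>2)" for n
  have I: "I \<longlonglongrightarrow> 1" using \<phi>(2) abs1 by (simp add: I_def[abs_def])
  have "(\<lambda>n. q n / (I n)\<^sup>2) \<longlonglongrightarrow> Q s t w / 1\<^sup>2"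
    by (intro tendsto_divide tendsto_power I \<phi>(4)) simp
  then have "\<forall>\<^sub>F n in sequentially. q n / (I n)\<^sup>2 < Q s t w + e"
    by (rule order_tendstoD(2)) (use e in simp)
  moreover have "\<forall>\<^sub>F n in sequentially. 0 < I n"
    by (rule order_tendstoD(1)[OF I]) simp
  ultimately have "\<forall>\<^sub>F n in sequentially. q n / (I n)\<^sup>2 < Q s t w + e \<and> 0 < I n"
    by (rule eventually_conj)
  then obtain n where n: "q n / (I n)\<^sup>2 < Q s t w + e" "0 < I n"
    using eventually_happens'[OF sequentially_bot] by blast
  obtain g where g: "test g" "(LINT x|M. (g x)\<^sup>2) = 1"
    "\<And>s t. Q s t (\<lambda>x. (g x)\<^sup>2) = Q s t (\<lambda>x. (\<phi> n x)\<^sup>2) / (I n)\<^sup>2"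
    using normalize_test_function[OF \<phi>(1)[of n]] n(2) unfolding I_def by blast
  have "Q s t (\<lambda>x. (g x)\<^sup>2) \<le> q n / (I n)\<^sup>2"
    unfolding g(3) by (intro divide_right_mono \<phi>(3)) simp
  with n(1) show ?thesis by (intro that[OF g(1,2)]) simp
qed

section \<open>Regimes in which the gradient term survives\<close>

lemma unit_minimizer_H1_tendsto:
  assumes w: "unit_minimizer s t w" and s: "0 \<le> s" and t: "0 < t"
    and \<rho>: "\<forall>\<^sub>F i in F. H10 \<Omega> (\<rho> i) \<and> (LINT x|M. \<rho> i x) = 1"
    and lim: "((\<lambda>i. Q s t (\<rho> i)) \<longlongrightarrow> Q s t w) F"
  shows "H1_tendsto \<Omega> \<rho> w F"
proof -
  have H: "H10 \<Omega> w" using w by (simp add: unit_minimizer_def)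
  obtain C where C: "0 < C" "\<And>u. H10 \<Omega> u \<Longrightarrow> (nrm u)\<^sup>2 \<le> C * Q s t u"
    "\<And>u b. b \<in> Basis \<Longrightarrow> (nrm (D b u))\<^sup>2 \<le> C * Q s t u"
    using form_coercive[OF s t] by blast
  let ?B = "\<lambda>i. C * (2 * (Q s t (\<rho> i) - Q s t w))"
  have "(?B \<longlongrightarrow> C * (2 * (Q s t w - Q s t w))) F"
    by (intro tendsto_intros lim)
  then have B: "(?B \<longlongrightarrow> 0) F" by simp
  have small: "(f \<longlongrightarrow> 0) F" if "\<forall>\<^sub>F i in F. (f i)\<^sup>2 \<le> ?B i" for f :: "'b \<Rightarrow> real"
  proof -
    have "((\<lambda>i. (f i)\<^sup>2) \<longlongrightarrow> 0) F"
      by (rule Lim_null_comparison[OF _ B]) (use that in simp)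
    then show ?thesis by (simp only: tendsto_0_power2_iff)
  qed
  have d: "H10 \<Omega> (\<lambda>x. u x - w x)" if "H10 \<Omega> u" for u
    using H10_real_lincomb[OF that H, of 1 "-1"] by simp
  have gap: "C * Q s t (\<lambda>x. u x - w x) \<le> C * (2 * (Q s t u - Q s t w))"
    if "H10 \<Omega> u \<and> (LINT x|M. u x) = 1" for u
    using unit_minimizer_gap[OF w, of u] that C(1) by (intro mult_left_mono) auto
  have "\<forall>\<^sub>F i in F. (nrm (\<lambda>x. \<rho> i x - w x))\<^sup>2 \<le> ?B i"
    using \<rho>
  proof eventually_elim
    case (elim i)
    then show ?case using order_trans[OF C(2)[OF d] gap[OF elim]] by simp
  qed
  moreover have "\<forall>\<^sub>F i in F. (nrm (\<lambda>x. D b (\<rho> i) x - D b w x))\<^sup>2 \<le> ?B i"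
    if b: "b \<in> Basis" for b
    using \<rho>
  proof eventually_elim
    case (elim i)
    then have "H1 \<Omega> (\<rho> i)" by (intro H10_imp_H1) simp
    from L2_norm_weak_pd_diff[OF this H10_imp_H1[OF H] b] show ?case
      using order_trans[OF C(3)[OF b] gap[OF elim]] by simp
  qed
  moreover have "\<forall>\<^sub>F i in F. H1 \<Omega> (\<rho> i)"
    using \<rho> by eventually_elim (simp add: H10_imp_H1)
  ultimately show ?thesis
    by (simp add: H1_tendsto_iff[OF _ H10_imp_H1[OF H]] small)
qed

lemma form_scale: "form (c * s) (c * t) u v = c * form s t u v"
  by (simp add: form_def algebra_simps)

text \<open>Both regimes with a surviving gradient term are the case \<open>\<beta> / \<mu> \<rightarrow> s\<close>, \<open>\<delta> / \<mu> \<rightarrow> t > 0\<close>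
  of a single limit, with \<open>\<mu> = \<beta>\<close> and \<open>\<mu> = \<delta>\<close> respectively.\<close>

lemma ground_state_H1_tendsto:
  fixes \<delta> \<mu> :: "real \<Rightarrow> real"
  assumes w: "unit_minimizer s t w" and s: "0 \<le> s" and t: "0 < t"
    and \<mu>: "filterlim \<mu> at_top at_top"
    and S: "((\<lambda>\<beta>. \<beta> / \<mu> \<beta>) \<longlongrightarrow> s) at_top" and T: "((\<lambda>\<beta>. \<delta> \<beta> / \<mu> \<beta>) \<longlongrightarrow> t) at_top"
    and g: "\<forall>\<^sub>F \<beta> in at_top. ground_state \<Omega> \<beta> (\<delta> \<beta>) (\<phi> \<beta>)"
  shows "H1_tendsto \<Omega> (\<lambda>\<beta>. abs_sq (\<phi> \<beta>)) w at_top"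
proof (rule unit_minimizer_H1_tendsto[OF w s t])
  have \<rho>: "\<forall>\<^sub>F \<beta> in at_top. H10 \<Omega> (abs_sq (\<phi> \<beta>)) \<and> (LINT x|M. abs_sq (\<phi> \<beta>) x) = 1"
    using g by eventually_elim (simp add: ground_state_def is_arg_min_def admissible_density_abs_sq)
  then show "\<forall>\<^sub>F \<beta> in at_top. H10 \<Omega> (abs_sq (\<phi> \<beta>)) \<and> (LINT x|M. abs_sq (\<phi> \<beta>) x) = 1" .
  define m where "m = Q s t w"
  define R where "R \<beta> = Q s t (abs_sq (\<phi> \<beta>))" for \<beta>
  obtain C where C: "0 < C" "\<And>u. H10 \<Omega> u \<Longrightarrow> (nrm u)\<^sup>2 \<le> C * Q s t u"
    "\<And>u b. b \<in> Basis \<Longrightarrow> (nrm (D b u))\<^sup>2 \<le> C * Q s t u"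
    using form_coercive[OF s t] by blast
  \<comment> \<open>The relative error of replacing the actual coefficients by \<open>s\<close> and
    \<open>t\<close>: coercivity bounds the squared norm by \<open>C * R \<beta>\<close>, and the
    gradient sum is at most \<open>R \<beta> / t\<close>. No prior bound on \<open>R \<beta>\<close>
    is required.\<close>
  define \<eta> where "\<eta> \<beta> = \<bar>s - \<beta> / \<mu> \<beta>\<bar> * C + \<bar>t - \<delta> \<beta> / \<mu> \<beta>\<bar> / t" for \<beta>
  have "(\<eta> \<longlongrightarrow> \<bar>s - s\<bar> * C + \<bar>t - t\<bar> / t) at_top"
    unfolding \<eta>_def using t by (intro tendsto_intros S T) auto
  then have \<eta>: "(\<eta> \<longlongrightarrow> 0) at_top" by simp
  have R: "(1 - \<eta> \<beta>) * R \<beta> \<le> Q (\<beta> / \<mu> \<beta>) (\<delta> \<beta> / \<mu> \<beta>) (abs_sq (\<phi> \<beta>))"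
    if H: "H10 \<Omega> (abs_sq (\<phi> \<beta>))" for \<beta>
  proof -
    let ?u = "abs_sq (\<phi> \<beta>)"
    let ?A = "(nrm ?u)\<^sup>2" and ?P = "\<Sum>b\<in>Basis. (nrm (D b ?u))\<^sup>2"
    have P: "0 \<le> ?P" "?P \<le> R \<beta> / t"
      using s t by (auto simp: R_def form_same sum_nonneg field_simps)
    have "(s - \<beta> / \<mu> \<beta>) * ?A \<le> \<bar>s - \<beta> / \<mu> \<beta>\<bar> * (C * R \<beta>)"
      using C(2)[OF H] by (intro mult_mono) (auto simp: R_def)
    moreover have "(t - \<delta> \<beta> / \<mu> \<beta>) * ?P \<le> \<bar>t - \<delta> \<beta> / \<mu> \<beta>\<bar> * (R \<beta> / t)"
      using P by (intro mult_mono) auto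
    ultimately have "(s - \<beta> / \<mu> \<beta>) * ?A + (t - \<delta> \<beta> / \<mu> \<beta>) * ?P \<le> \<eta> \<beta> * R \<beta>"
      by (simp add: \<eta>_def distrib_right mult.assoc)
    then show ?thesis
      by (simp add: R_def form_same algebra_simps)
  qed
  show "((\<lambda>\<beta>. Q s t (abs_sq (\<phi> \<beta>))) \<longlongrightarrow> Q s t w) at_top"
    unfolding R_def[symmetric] m_def[symmetric]
  proof (rule order_tendstoI)
    fix a assume "a < m"
    show "\<forall>\<^sub>F \<beta> in at_top. a < R \<beta>"
      using \<rho>
    proof eventually_elim
      case (elim \<beta>)
      then have "m \<le> R \<beta>" using w unfolding m_def R_def unit_minimizer_def by blast
      with \<open>a < m\<close> show ?case by simp
    qed
  next
    fix a assume "m < a"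
    then obtain f where f: "test f" "(LINT x|M. (f x)\<^sup>2) = 1"
      "Q s t (\<lambda>x. (f x)\<^sup>2) < a"
      using unit_minimizer_approx[OF w s t, of "a - m"] by (auto simp: m_def)
    define K where "K = (LINT x|M. grad_sq \<Omega> (\<lambda>x. complex_of_real (f x)) x)"
    \<comment> \<open>The comparison estimate divided by \<open>\<mu> \<beta>\<close> and solved for
      \<open>R \<beta>\<close>, which is legitimate once \<open>\<eta> \<beta> < 1\<close>. For
      fixed \<open>f\<close> it tends to the form at the trial density, which is below
      \<open>a\<close>.\<close>
    define Z where "Z \<beta> = (K / \<mu> \<beta> + Q (\<beta> / \<mu> \<beta>) (\<delta> \<beta> / \<mu> \<beta>) (\<lambda>x. (f x)\<^sup>2)) / (1 - \<eta> \<beta>)" for \<beta>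
    have "((\<lambda>\<beta>. K / \<mu> \<beta>) \<longlongrightarrow> 0) at_top"
      by (rule tendsto_divide_0[OF tendsto_const filterlim_at_top_imp_at_infinity[OF \<mu>]])
    then have "(Z \<longlongrightarrow> (0 + Q s t (\<lambda>x. (f x)\<^sup>2)) / (1 - 0)) at_top"
      unfolding Z_def form_def by (intro tendsto_intros \<eta> S T) auto
    then have "\<forall>\<^sub>F \<beta> in at_top. Z \<beta> < a"
      by (rule order_tendstoD(2)) (use f(3) in simp)
    moreover have "\<forall>\<^sub>F \<beta> in at_top. \<eta> \<beta> < 1"
      by (rule order_tendstoD(2)[OF \<eta>]) simp
    moreover have "\<forall>\<^sub>F \<beta> in at_top. 0 < \<mu> \<beta>"
      using \<mu> by (simp add: filterlim_at_top_dense)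
    ultimately show "\<forall>\<^sub>F \<beta> in at_top. R \<beta> < a"
      using \<rho> g
    proof eventually_elim
      case (elim \<beta>)
      let ?f = "\<lambda>x. (f x)\<^sup>2" and ?u = "abs_sq (\<phi> \<beta>)"
      have sc: "Q \<beta> (\<delta> \<beta>) u = \<mu> \<beta> * Q (\<beta> / \<mu> \<beta>) (\<delta> \<beta> / \<mu> \<beta>) u" for u
        using form_scale[of "\<mu> \<beta>" "\<beta> / \<mu> \<beta>" "\<delta> \<beta> / \<mu> \<beta>" u u] elim(3) by simp
      have "\<mu> \<beta> * Q (\<beta> / \<mu> \<beta>) (\<delta> \<beta> / \<mu> \<beta>) ?u \<le> K + \<mu> \<beta> * Q (\<beta> / \<mu> \<beta>) (\<delta> \<beta> / \<mu> \<beta>) ?f"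
        using ground_state_form_le[OF elim(5) f(1,2)] unfolding sc K_def .
      then have "Q (\<beta> / \<mu> \<beta>) (\<delta> \<beta> / \<mu> \<beta>) ?u \<le> K / \<mu> \<beta> + Q (\<beta> / \<mu> \<beta>) (\<delta> \<beta> / \<mu> \<beta>) ?f"
        using elim(3) by (simp add: field_simps)
      with R[of \<beta>] elim(4) have "(1 - \<eta> \<beta>) * R \<beta> \<le> K / \<mu> \<beta> + Q (\<beta> / \<mu> \<beta>) (\<delta> \<beta> / \<mu> \<beta>) ?f"
        by simp
      then have "R \<beta> \<le> Z \<beta>"
        using elim(2) by (simp add: Z_def pos_le_divide_eq mult.commute)
      with elim(1) show ?case by simp
    qed
  qed
qed

text \<open>A minimizer over the larger signed class that happens to be nonnegative also minimizes
  over densities. Any other minimizing density has the same form value, so the gap estimate and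
  coercivity force it to coincide.\<close>

lemma unit_minimizer_unique_minimizer:
  assumes w: "unit_minimizer s t w" and s: "0 \<le> s" and t: "0 < t"
    and E: "\<And>u. H10 \<Omega> u \<Longrightarrow> E u = 1/2 * Q s t u"
  shows "unique_minimizer \<Omega> E (admissible_density \<Omega>) (nonneg_fun \<Omega>) w"
proof -
  have H: "H10 \<Omega> w" "(LINT x|M. w x) = 1"
    and min: "\<And>u. H10 \<Omega> u \<Longrightarrow> (LINT x|M. u x) = 1 \<Longrightarrow> Q s t w \<le> Q s t u"
    using w by (auto simp: unit_minimizer_def)
  have nn: "nonneg_fun \<Omega> w" by (rule unit_minimizer_nonneg[OF w s t])
  have adm: "admissible_density \<Omega> w" using H nn by (simp add: admissible_density_def)
  have "is_arg_min E (admissible_density \<Omega>) w"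
    unfolding is_arg_min_def
  proof (intro conjI adm notI; elim exE conjE)
    fix u assume "admissible_density \<Omega> u" "E u < E w"
    then show False
      using min[of u] E[of u] E[OF H(1)] by (simp add: admissible_density_def)
  qed
  moreover have "AE x in M. v x = w x" if v: "is_arg_min E (admissible_density \<Omega>) v" for v
  proof -
    have V: "H10 \<Omega> v" "(LINT x|M. v x) = 1" "E v \<le> E w"
      using v adm by (auto simp: is_arg_min_def admissible_density_def not_less)
    have d: "H10 \<Omega> (\<lambda>x. v x - w x)" using H10_real_lincomb[OF V(1) H(1), of 1 "-1"] by simp
    obtain C where C: "0 < C" "\<And>u. H10 \<Omega> u \<Longrightarrow> (nrm u)\<^sup>2 \<le> C * Q s t u"
      "\<And>u b. b \<in> Basis \<Longrightarrow> (nrm (D b u))\<^sup>2 \<le> C * Q s t u"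
      using form_coercive[OF s t] by blast
    have "Q s t (\<lambda>x. v x - w x) \<le> 0"
      using unit_minimizer_gap[OF w V(1,2)] V(3) E[OF V(1)] E[OF H(1)] by simp
    then have "(nrm (\<lambda>x. v x - w x))\<^sup>2 \<le> 0"
      using C(2)[OF d] C(1) by (meson mult_nonneg_nonpos less_imp_le order_trans)
    then have "(LINT x|M. (norm (v x - w x))\<^sup>2) = 0"
      using zero_le_power2[of "nrm (\<lambda>x. v x - w x)"] unfolding L2_norm_sq by linarith
    then have "AE x in M. (norm (v x - w x))\<^sup>2 = 0"
      by (subst (asm) integral_nonneg_eq_0_iff_AE[OF Lp2D(2)[OF H1D(1)[OF H10_imp_H1[OF d]]]]) auto
    then show ?thesis by eventually_elim simp
  qed
  ultimately show ?thesis using nn unfolding unique_minimizer_def by blast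
qed

text \<open>The Euler-Lagrange equation for test functions, with one derivative moved back from
  \<open>w\<close> by its weak derivative identity and the result solved for the Laplacian by
  dividing by \<open>t\<close>.\<close>

lemma unit_minimizer_weak_laplacian:
  assumes w: "unit_minimizer s t w" and t: "0 < t"
  shows "has_weak_laplacian \<Omega> w (\<lambda>x. (s * w x - Q s t w) / t)"
  unfolding has_weak_laplacian_def
proof (intro conjI allI impI)
  have H: "H10 \<Omega> w" using w by (auto simp: unit_minimizer_def)
  note h = H1D[OF H10_imp_H1[OF H]]
  have iw: "integrable M w" by (rule H10_integrable[OF H])
  show "loc_integrable \<Omega> w" "loc_integrable \<Omega> (\<lambda>x. (s * w x - Q s t w) / t)"
    by (intro integrable_imp_loc_integrable integrable_divide Bochner_Integration.integrable_diff
        integrable_mult_right iw integrable_const_\<Omega>)+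
  fix \<psi> :: "'a \<Rightarrow> real" assume \<psi>: "test \<psi>"
  have i: "integrable M (\<lambda>x. f x * g x)"
    if "L2 f" "L2 g" for f g :: "'a \<Rightarrow> real"
    by (rule integrable_bilinear[OF bounded_bilinear_mult that])
  have eq: "(LINT x|M. pd b (pd b \<psi>) x * w x)
     = - (LINT x|M. D b w x * D b \<psi> x)" if b: "b \<in> Basis" for b
  proof -
    have "(LINT x|M. pd b (pd b \<psi>) x * w x) = - (LINT x|M. pd b \<psi> x * D b w x)"
      using h(3)[OF b] test_pd[OF \<psi> b] by (simp add: has_weak_pd_def)
    also have "(LINT x|M. pd b \<psi> x * D b w x) = (LINT x|M. D b w x * D b \<psi> x)"
    proof (rule integral_cong_AE)
      show "AE x in M. pd b \<psi> x * D b w x = D b w x * D b \<psi> x"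
        using weak_pd_AE[OF test_has_weak_pd[OF \<psi> b]] by eventually_elim simp
    qed (use Lp2D(1)[OF h(2)[OF b]] Lp2D(1)[OF test_Lp[OF test_pd[OF \<psi> b]]]
        Lp2D(1)[OF H1D(2)[OF test_H1[OF \<psi>] b]] in auto)
    finally show ?thesis .
  qed
  have "(LINT x|M. (\<Sum>b\<in>Basis. pd b (pd b \<psi>) x) * w x)
     = (\<Sum>b\<in>Basis. LINT x|M. pd b (pd b \<psi>) x * w x)"
    unfolding sum_distrib_right
    by (intro Bochner_Integration.integral_sum i h(1) test_Lp[OF test_pd[OF test_pd[OF \<psi>]]])
  also have "\<dots> = - (\<Sum>b\<in>Basis. LINT x|M. D b w x * D b \<psi> x)"
    by (simp add: eq sum_negf)
  also have "\<dots> = (s * (LINT x|M. w x * \<psi> x) - Q s t w * (LINT x|M. \<psi> x)) / t"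
    using unit_minimizer_euler_lagrange[OF w test_H10[OF \<psi>]] t
    by (simp add: form_def[of s t w \<psi>] field_simps)
  also have "\<dots> = (LINT x|M. \<psi> x * ((s * w x - Q s t w) / t))"
  proof -
    have "(\<lambda>x. \<psi> x * ((s * w x - Q s t w) / t)) = (\<lambda>x. (s * (w x * \<psi> x) - Q s t w * \<psi> x) / t)"
      by (simp add: fun_eq_iff algebra_simps)
    then show ?thesis
      using i[OF h(1) test_Lp[OF \<psi>]] Lp2_integrable[OF test_Lp[OF \<psi>]] by simp
  qed
  finally show "(LINT x|M. (\<Sum>b\<in>Basis. pd b (pd b \<psi>) x) * w x)
     = (LINT x|M. \<psi> x * ((s * w x - Q s t w) / t))" .
qed

lemma E_bd_plus_eq_form: "H10 \<Omega> u \<Longrightarrow> E_bd_plus \<Omega> d u = 1/2 * Q 1 d u"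
  using Lp2D(2)[OF H1D(1)[OF H10_imp_H1], of u] integral_grad_sq[OF H1D(2)[OF H10_imp_H1], of u]
  by (simp add: E_bd_plus_def form_same L2_norm_sq[of u] field_simps)

lemma E_d_eq_form: "H10 \<Omega> u \<Longrightarrow> E_d \<Omega> u = 1/2 * Q 0 1 u"
  using integral_grad_sq(2)[OF H1D(2)[OF H10_imp_H1], of u] by (simp add: E_d_def form_same)

section \<open>The regime in which the gradient term disappears\<close>

lemma integral_const_\<Omega>: "(LINT x|M. c) = c * measure lebesgue \<Omega>" for c :: real
  by (simp add: measure_\<Omega>)

text \<open>Expanding the square, unit mass fixes the cross term. This one identity yields the lower
  bound, the uniqueness and the convergence in this regime.\<close>

lemma L2_dist_const_sq:
  assumes u: "L2 u" and 1: "(LINT x|M. u x) = 1" and ne: "\<Omega> \<noteq> {}"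
  shows "(nrm (\<lambda>x. u x - 1 / measure lebesgue \<Omega>))\<^sup>2 = (nrm u)\<^sup>2 - 1 / measure lebesgue \<Omega>"
proof -
  let ?V = "measure lebesgue \<Omega>"
  have V: "0 < ?V" by (rule measure_pos[OF ne])
  have "(norm (u x - 1 / ?V))\<^sup>2 = (norm (u x))\<^sup>2 - 2 / ?V * u x + 1 / ?V\<^sup>2" for x
    by (simp add: power2_diff power_divide)
  then have "(nrm (\<lambda>x. u x - 1 / ?V))\<^sup>2
      = (LINT x|M. (norm (u x))\<^sup>2 - 2 / ?V * u x + 1 / ?V\<^sup>2)"
    by (simp only: L2_norm_sq)
  also have "\<dots> = (nrm u)\<^sup>2 - 2 / ?V * 1 + 1 / ?V\<^sup>2 * ?V"
    using Lp2D(2)[OF u] Lp2_integrable[OF u] integrable_const_\<Omega>[of "1 / ?V\<^sup>2"]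
    by (simp add: L2_norm_sq 1 measure_\<Omega>)
  also have "\<dots> = (nrm u)\<^sup>2 - 1 / ?V"
    using V by (simp add: field_simps power2_eq_square)
  finally show ?thesis .
qed

text \<open>For test functions \<open>\<psi> n\<close> tending boundedly to one, the quotient of
  \<open>\<integral> (\<psi> n)\<^sup>4\<close> by the square of
  \<open>\<integral> (\<psi> n)\<^sup>2\<close> tends to \<open>V / V\<^sup>2\<close>, with
  \<open>V\<close> the volume. Their gradients may blow up, which is harmless since only one of them
  is used at a time.\<close>

lemma uniform_density_approx:
  assumes ne: "\<Omega> \<noteq> {}" and a: "1 / measure lebesgue \<Omega> < a"
  obtains f :: "'a \<Rightarrow> real" where "test f" "(LINT x|M. (f x)\<^sup>2) = 1"
    "(nrm (\<lambda>x. (f x)\<^sup>2))\<^sup>2 < a"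
proof -
  let ?V = "measure lebesgue \<Omega>"
  have V: "0 < ?V" by (rule measure_pos[OF ne])
  obtain \<psi> :: "nat \<Rightarrow> 'a \<Rightarrow> real" where \<psi>: "\<And>n. test (\<psi> n)"
    "\<And>n x. 0 \<le> \<psi> n x" "\<And>n x. \<psi> n x \<le> 1" "\<And>x. x \<in> \<Omega> \<Longrightarrow> (\<lambda>n. \<psi> n x) \<longlonglongrightarrow> 1"
    using test_functions_tendsto_one by blast
  have lim: "(\<lambda>n. LINT x|M. (\<psi> n x) ^ p) \<longlonglongrightarrow> ?V" for p
  proof -
    have "(\<lambda>n. LINT x|M. (\<psi> n x) ^ p) \<longlonglongrightarrow> (LINT x|M. 1)"
    proof (rule integral_dominated_convergence)
      show "integrable M (\<lambda>x. 1::real)" by (rule integrable_const_\<Omega>)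
      show "(\<lambda>x. (\<psi> n x) ^ p) \<in> borel_measurable M" for n
        using test_measurable[OF \<psi>(1) sets_\<Omega>] by (rule borel_measurable_power)
      show "AE x in M. (\<lambda>n. (\<psi> n x) ^ p) \<longlonglongrightarrow> 1"
      proof (rule AE_I2)
        fix x assume "x \<in> space M"
        then have "(\<lambda>n. (\<psi> n x) ^ p) \<longlonglongrightarrow> 1 ^ p" by (intro tendsto_power \<psi>(4)) simp
        then show "(\<lambda>n. (\<psi> n x) ^ p) \<longlonglongrightarrow> 1" by simp
      qed
      show "AE x in M. norm ((\<psi> n x) ^ p) \<le> 1" for n
        using \<psi>(2,3) by (intro AE_I2) (simp add: power_le_one)
    qed simp
    then show ?thesis by (simp add: measure_\<Omega>)
  qed
  define I where "I n = (LINT x|M. (\<psi> n x)\<^sup>2)" for n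
  define J where "J n = (nrm (\<lambda>x. (\<psi> n x)\<^sup>2))\<^sup>2" for n
  have I: "I \<longlonglongrightarrow> ?V" using lim[of 2] by (simp add: I_def[abs_def])
  have "J n = (LINT x|M. (\<psi> n x) ^ 4)" for n
    by (simp add: J_def L2_norm_sq power_mult[symmetric])
  then have J: "J \<longlonglongrightarrow> ?V" using lim[of 4] by presburger
  have "(\<lambda>n. J n / (I n)\<^sup>2) \<longlonglongrightarrow> ?V / ?V\<^sup>2"
    using V by (intro tendsto_intros I J) auto
  then have "(\<lambda>n. J n / (I n)\<^sup>2) \<longlonglongrightarrow> 1 / ?V" using V by (simp add: power2_eq_square)
  then have "\<forall>\<^sub>F n in sequentially. J n / (I n)\<^sup>2 < a" by (rule order_tendstoD(2)) (rule a)
  moreover have "\<forall>\<^sub>F n in sequentially. 0 < I n" by (rule order_tendstoD(1)[OF I V])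
  ultimately have "\<forall>\<^sub>F n in sequentially. J n / (I n)\<^sup>2 < a \<and> 0 < I n" by (rule eventually_conj)
  then obtain n where n: "J n / (I n)\<^sup>2 < a" "0 < I n"
    using eventually_happens'[OF sequentially_bot] by blast
  obtain g where g: "test g" "(LINT x|M. (g x)\<^sup>2) = 1"
    "\<And>s t. Q s t (\<lambda>x. (g x)\<^sup>2) = Q s t (\<lambda>x. (\<psi> n x)\<^sup>2) / (I n)\<^sup>2"
    using normalize_test_function[OF \<psi>(1)[of n]] n(2) unfolding I_def by blast
  have "(nrm (\<lambda>x. (g x)\<^sup>2))\<^sup>2 = J n / (I n)\<^sup>2"
    using g(3)[of 1 0] by (simp add: form_same J_def)
  with n(1) show ?thesis by (intro that[OF g(1,2)]) simp
qed

lemma ground_state_L2_tendsto: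
  fixes \<delta> :: "real \<Rightarrow> real"
  assumes ne: "\<Omega> \<noteq> {}" and \<delta>: "\<forall>\<^sub>F \<beta> in at_top. \<delta> \<beta> > 0"
    and T: "((\<lambda>\<beta>. \<delta> \<beta> / \<beta>) \<longlongrightarrow> 0) at_top"
    and g: "\<forall>\<^sub>F \<beta> in at_top. ground_state \<Omega> \<beta> (\<delta> \<beta>) (\<phi> \<beta>)"
  shows "L2_tendsto \<Omega> (\<lambda>\<beta>. abs_sq (\<phi> \<beta>)) (\<lambda>x. 1 / measure lebesgue \<Omega>) at_top"
proof -
  let ?V = "measure lebesgue \<Omega>"
  define R where "R \<beta> = (nrm (abs_sq (\<phi> \<beta>)))\<^sup>2" for \<beta>
  have \<rho>: "\<forall>\<^sub>F \<beta> in at_top. L2 (abs_sq (\<phi> \<beta>)) \<and> (LINT x|M. abs_sq (\<phi> \<beta>) x) = 1"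
    using g
  proof eventually_elim
    case (elim \<beta>)
    then have "admissible \<Omega> (\<phi> \<beta>)" by (simp add: ground_state_def is_arg_min_def)
    from admissible_density_abs_sq[OF this] show ?case by (simp add: H1D(1)[OF H10_imp_H1])
  qed
  then have eq: "\<forall>\<^sub>F \<beta> in at_top. (nrm (\<lambda>x. abs_sq (\<phi> \<beta>) x - 1 / ?V))\<^sup>2 = R \<beta> - 1 / ?V"
    unfolding R_def by eventually_elim (simp add: L2_dist_const_sq ne)
  have "(R \<longlongrightarrow> 1 / ?V) at_top"
  proof (rule order_tendstoI)
    fix a assume "a < 1 / ?V"
    show "\<forall>\<^sub>F \<beta> in at_top. a < R \<beta>"
      using eq
    proof eventually_elim
      case (elim \<beta>)
      then have "0 \<le> R \<beta> - 1 / ?V" by (metis zero_le_power2)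
      with \<open>a < 1 / ?V\<close> show ?case by linarith
    qed
  next
    fix a assume "1 / ?V < a"
    then obtain f :: "'a \<Rightarrow> real" where f: "test f" "(LINT x|M. (f x)\<^sup>2) = 1"
      "(nrm (\<lambda>x. (f x)\<^sup>2))\<^sup>2 < a"
      using uniform_density_approx[OF ne] by blast
    define K where "K = (LINT x|M. grad_sq \<Omega> (\<lambda>x. complex_of_real (f x)) x)"
    define A where "A = (nrm (\<lambda>x. (f x)\<^sup>2))\<^sup>2"
    define P where "P = (\<Sum>b\<in>Basis. (nrm (D b (\<lambda>x. (f x)\<^sup>2)))\<^sup>2)"
    \<comment> \<open>The trial function is fixed before \<beta> grows, so its kinetic energy
      \<open>K\<close> and its gradient sum \<open>P\<close> are constants and both contributions
      vanish in the limit.\<close>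
    define Z where "Z \<beta> = K / \<beta> + A + \<delta> \<beta> / \<beta> * P" for \<beta>
    have "((\<lambda>\<beta>. K / \<beta>) \<longlongrightarrow> 0) at_top"
      by (rule tendsto_divide_0[OF tendsto_const filterlim_at_top_imp_at_infinity[OF filterlim_ident]])
    then have "(Z \<longlongrightarrow> 0 + A + 0 * P) at_top"
      unfolding Z_def by (intro tendsto_intros T)
    then have "\<forall>\<^sub>F \<beta> in at_top. Z \<beta> < a"
      by (rule order_tendstoD(2)) (use f(3) in \<open>simp add: A_def\<close>)
    then show "\<forall>\<^sub>F \<beta> in at_top. R \<beta> < a"
      using \<delta> g eventually_gt_at_top[of 0]
    proof eventually_elim
      case (elim \<beta>)
      have "\<beta> * R \<beta> \<le> Q \<beta> (\<delta> \<beta>) (abs_sq (\<phi> \<beta>))"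
        using elim(2) by (simp add: form_same R_def sum_nonneg)
      also have "\<dots> \<le> K + (\<beta> * A + \<delta> \<beta> * P)"
        using ground_state_form_le[OF elim(3) f(1,2)] unfolding form_same[of _ _ "\<lambda>x. (f x)\<^sup>2"] K_def
          A_def P_def .
      also have "\<dots> = \<beta> * Z \<beta>" using elim(4) by (simp add: Z_def field_simps)
      finally show ?case using elim(1,4) by simp
    qed
  qed
  then have "((\<lambda>\<beta>. R \<beta> - 1 / ?V) \<longlongrightarrow> 1 / ?V - 1 / ?V) at_top" by (intro tendsto_intros)
  then have "((\<lambda>\<beta>. (nrm (\<lambda>x. abs_sq (\<phi> \<beta>) x - 1 / ?V))\<^sup>2) \<longlongrightarrow> 0) at_top"
    using tendsto_cong[OF eq] by simp
  moreover have "\<forall>\<^sub>F \<beta> in at_top. L2 (abs_sq (\<phi> \<beta>))" using \<rho> by eventually_elim simp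
  moreover have "L2 (\<lambda>x. 1 / ?V)" by (rule Lp2_bounded[of _ "1 / ?V"]) auto
  ultimately show ?thesis by (simp add: L2_tendsto_def tendsto_0_power2_iff)
qed

lemma E_b_eq_L2_norm: "E_b \<Omega> \<phi> = 1/2 * (nrm (abs_sq \<phi>))\<^sup>2"
  by (simp add: E_b_def L2_norm_sq abs_sq_def power_mult[symmetric])

text \<open>\<open>E_b\<close> sees only the density, for which \<open>L2_dist_const_sq\<close>
  settles minimality; the sign condition then selects one wave function with that density.\<close>

lemma uniform_state_unique_minimizer:
  assumes ne: "\<Omega> \<noteq> {}"
  shows "unique_minimizer \<Omega> (E_b \<Omega>) (admissible_b \<Omega>) (nonneg_wave \<Omega>)
    (\<lambda>x. complex_of_real (1 / sqrt (measure lebesgue \<Omega>)))"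
proof -
  let ?V = "measure lebesgue \<Omega>"
  let ?u = "\<lambda>x::'a. complex_of_real (1 / sqrt ?V)"
  have V: "0 < ?V" by (rule measure_pos[OF ne])
  have abs_u: "abs_sq ?u = (\<lambda>x. 1 / ?V)"
    using V by (simp add: abs_sq_def[abs_def] norm_divide power_divide)
  have adm: "admissible_b \<Omega> ?u"
  proof -
    have "(LINT x|M. (norm (?u x))\<^sup>2) = (LINT x|M. 1 / ?V)"
      using fun_cong[OF abs_u] by (simp only: abs_sq_def)
    then have "(nrm ?u)\<^sup>2 = 1"
      using V by (simp only: L2_norm_sq integral_const_\<Omega>) simp
    moreover have "Lp p \<Omega> ?u" for p
      unfolding Lp_def using integrable_const_\<Omega> by (intro conjI) auto
    ultimately show ?thesis by (simp add: admissible_b_def)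
  qed
  have gap: "(nrm (\<lambda>x. abs_sq v x - 1 / ?V))\<^sup>2 = 2 * E_b \<Omega> v - 1 / ?V"
    and Lv: "L2 (abs_sq v)" if v: "admissible_b \<Omega> v" for v
  proof -
    have v': "Lp 4 \<Omega> v" "(nrm v)\<^sup>2 = 1" using v by (auto simp: admissible_b_def)
    show L: "L2 (abs_sq v)" by (rule Lp2_abs_sq[OF v'(1)])
    have "(LINT x|M. abs_sq v x) = 1"
      using v'(2) by (simp add: L2_norm_sq abs_sq_def)
    from L2_dist_const_sq[OF L this ne]
    show "(nrm (\<lambda>x. abs_sq v x - 1 / ?V))\<^sup>2 = 2 * E_b \<Omega> v - 1 / ?V"
      by (simp add: E_b_eq_L2_norm)
  qed
  have Eu: "2 * E_b \<Omega> ?u = 1 / ?V"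
    using gap[OF adm] unfolding abs_u by (simp add: L2_norm_zero)
  have min: "is_arg_min (E_b \<Omega>) (admissible_b \<Omega>) ?u"
    unfolding is_arg_min_def
  proof (intro conjI adm notI; elim exE conjE)
    fix v assume "admissible_b \<Omega> v" "E_b \<Omega> v < E_b \<Omega> ?u"
    then show False
      using gap[of v] Eu zero_le_power2[of "nrm (\<lambda>x. abs_sq v x - 1 / ?V)"] by linarith
  qed
  have "AE x in M. v x = ?u x"
    if v: "is_arg_min (E_b \<Omega>) (admissible_b \<Omega>) v" and nn: "nonneg_wave \<Omega> v" for v
  proof -
    have av: "admissible_b \<Omega> v" and "E_b \<Omega> v \<le> E_b \<Omega> ?u"
      using v adm by (auto simp: is_arg_min_def not_less)
    then have "(nrm (\<lambda>x. abs_sq v x - 1 / ?V))\<^sup>2 \<le> 0" using gap[OF av] Eu by linarith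
    then have z: "(LINT x|M. (norm (abs_sq v x - 1 / ?V))\<^sup>2) = 0"
      using zero_le_power2[of "nrm (\<lambda>x. abs_sq v x - 1 / ?V)"] unfolding L2_norm_sq by linarith
    have "L2 (\<lambda>x. abs_sq v x - 1 / ?V)"
      by (rule Lp2_diff[OF Lv[OF av] Lp2_bounded[of _ "1 / ?V"]]) auto
    from z have "AE x in M. (norm (abs_sq v x - 1 / ?V))\<^sup>2 = 0"
      by (subst (asm) integral_nonneg_eq_0_iff_AE[OF Lp2D(2)[OF \<open>L2 (\<lambda>x. abs_sq v x - 1 / ?V)\<close>]]) auto
    then show ?thesis
      using nn unfolding nonneg_wave_def
    proof eventually_elim
      case (elim x)
      \<comment> \<open>A nonnegative real value is determined by its squared modulus.\<close>
      have r: "v x = complex_of_real (Re (v x))" using elim(2) by simp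
      have "(Re (v x))\<^sup>2 = 1 / ?V"
        using elim(1) by (subst (asm) abs_sq_def, subst (asm) r) (simp del: of_real_Re)
      then have "Re (v x) = sqrt (1 / ?V)" using elim(2) real_sqrt_unique by metis
      then show ?case by (subst r) (simp add: real_sqrt_divide)
    qed
  qed
  moreover have "nonneg_wave \<Omega> ?u" using V by (simp add: nonneg_wave_def)
  ultimately show ?thesis using min unfolding unique_minimizer_def by blast
qed

text \<open>Collects the conclusions common to both gradient regimes for an abstract functional
  \<open>E\<close>. The witness \<open>L\<close> is an explicit expression in \<open>w\<close>, so
  the equation holds at every point and not just almost everywhere.\<close>

lemma limit_density:
  assumes ne: "\<Omega> \<noteq> {}" and s: "0 \<le> s" and t: "0 < t"
    and E: "\<And>u. H10 \<Omega> u \<Longrightarrow> E u = 1/2 * Q s t u"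
    and \<mu>: "filterlim \<mu> at_top at_top"
    and S: "((\<lambda>\<beta>. \<beta> / \<mu> \<beta>) \<longlongrightarrow> s) at_top" and T: "((\<lambda>\<beta>. \<delta> \<beta> / \<mu> \<beta>) \<longlongrightarrow> t) at_top"
    and g: "\<forall>\<^sub>F \<beta> in at_top. ground_state \<Omega> \<beta> (\<delta> \<beta>) (\<phi> \<beta>)"
  obtains w L where "unique_minimizer \<Omega> E (admissible_density \<Omega>) (nonneg_fun \<Omega>) w"
    "H1_tendsto \<Omega> (\<lambda>\<beta>. abs_sq (\<phi> \<beta>)) w at_top" "has_weak_laplacian \<Omega> w L"
    "\<And>x. s * w x - t * L x = 2 * E w" "H10 \<Omega> w"
proof -
  obtain w where w: "unit_minimizer s t w" by (rule exists_unit_minimizer[OF ne s t])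
  then have H: "H10 \<Omega> w" by (simp add: unit_minimizer_def)
  show ?thesis
  proof (rule that)
    show "unique_minimizer \<Omega> E (admissible_density \<Omega>) (nonneg_fun \<Omega>) w"
      by (rule unit_minimizer_unique_minimizer[OF w s t E])
    show "H1_tendsto \<Omega> (\<lambda>\<beta>. abs_sq (\<phi> \<beta>)) w at_top"
      by (rule ground_state_H1_tendsto[OF w s t \<mu> S T g])
    show "has_weak_laplacian \<Omega> w (\<lambda>x. (s * w x - Q s t w) / t)"
      by (rule unit_minimizer_weak_laplacian[OF w t])
    show "s * w x - t * ((s * w x - Q s t w) / t) = 2 * E w" for x
      using t by (simp add: E[OF H])
  qed (rule H)
qed

end

theorem theorem4p1:
  fixes \<Omega> :: "'a::euclidean_space set"
    and \<delta> :: "real \<Rightarrow> real"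
    and \<phi>\<^sub>g :: "real \<Rightarrow> 'a \<Rightarrow> complex"
  assumes "DIM('a) \<in> {1, 2, 3}"
    and "open \<Omega>" "connected \<Omega>" "bounded \<Omega>"
    and "\<forall>\<^sub>F \<beta> in at_top. \<delta> \<beta> > 0"
    and "\<forall>\<^sub>F \<beta> in at_top. positive_ground_state \<Omega> \<beta> (\<delta> \<beta>) (\<phi>\<^sub>g \<beta>)"
  shows
    "(\<delta> \<in> o[at_top](\<lambda>\<beta>. \<beta>) \<longrightarrow>
       (\<exists>\<phi>_inf. unique_minimizer \<Omega> (E_b \<Omega>) (admissible_b \<Omega>) (nonneg_wave \<Omega>) \<phi>_inf \<and>
          L2_tendsto \<Omega> (\<lambda>\<beta>. abs_sq (\<phi>\<^sub>g \<beta>)) (abs_sq \<phi>_inf) at_top \<and>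
          (AE x in lebesgue_on \<Omega>. abs_sq \<phi>_inf x = 1 / measure lebesgue \<Omega>)))
     \<and>
     (\<forall>\<delta>_inf>0. ((\<lambda>\<beta>. \<delta> \<beta> / \<beta>) \<longlongrightarrow> \<delta>_inf) at_top \<longrightarrow>
       (\<exists>\<rho>_inf. unique_minimizer \<Omega> (E_bd_plus \<Omega> \<delta>_inf) (admissible_density \<Omega>) (nonneg_fun \<Omega>) \<rho>_inf \<and>
          H1_tendsto \<Omega> (\<lambda>\<beta>. abs_sq (\<phi>\<^sub>g \<beta>)) \<rho>_inf at_top \<and>
          (\<exists>L. has_weak_laplacian \<Omega> \<rho>_inf L \<and>
             (AE x in lebesgue_on \<Omega>. \<rho>_inf x - \<delta>_inf * L x = 2 * E_bd_plus \<Omega> \<delta>_inf \<rho>_inf)) \<and>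
          H10 \<Omega> \<rho>_inf))
     \<and>
     (filterlim \<delta> at_top at_top \<and> (\<lambda>\<beta>. \<beta>) \<in> o[at_top](\<delta>) \<longrightarrow>
       (\<exists>\<rho>_inf. unique_minimizer \<Omega> (E_d \<Omega>) (admissible_density \<Omega>) (nonneg_fun \<Omega>) \<rho>_inf \<and>
          H1_tendsto \<Omega> (\<lambda>\<beta>. abs_sq (\<phi>\<^sub>g \<beta>)) \<rho>_inf at_top \<and>
          (\<exists>L. has_weak_laplacian \<Omega> \<rho>_inf L \<and>
             (AE x in lebesgue_on \<Omega>. - L x = 2 * E_d \<Omega> \<rho>_inf)) \<and>
          H10 \<Omega> \<rho>_inf))"
proof -
  interpret bounded_open \<Omega>
    using assms by unfold_locales
  have g: "\<forall>\<^sub>F \<beta> in at_top. ground_state \<Omega> \<beta> (\<delta> \<beta>) (\<phi>\<^sub>g \<beta>)"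
    using assms(6) by eventually_elim (simp add: positive_ground_state_def)
  have ne: "\<Omega> \<noteq> {}"
  proof
    \<comment> \<open>On the empty set every norm is zero, so no ground state could be
      normalized.\<close>
    assume empty: "\<Omega> = {}"
    obtain \<beta> where "ground_state \<Omega> \<beta> (\<delta> \<beta>) (\<phi>\<^sub>g \<beta>)"
      using eventually_happens'[OF trivial_limit_at_top_linorder g] by blast
    then have "L2_norm \<Omega> (\<phi>\<^sub>g \<beta>) = 1"
      by (simp add: ground_state_def is_arg_min_def admissible_def)
    then show False using empty by (simp add: L2_norm_def)
  qed
  show ?thesis
  proof (intro conjI allI impI)
    assume small: "\<delta> \<in> o[at_top](\<lambda>\<beta>. \<beta>)"
    show "\<exists>\<phi>_inf. unique_minimizer \<Omega> (E_b \<Omega>) (admissible_b \<Omega>) (nonneg_wave \<Omega>) \<phi>_inf \<and>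
        L2_tendsto \<Omega> (\<lambda>\<beta>. abs_sq (\<phi>\<^sub>g \<beta>)) (abs_sq \<phi>_inf) at_top \<and>
        (AE x in lebesgue_on \<Omega>. abs_sq \<phi>_inf x = 1 / measure lebesgue \<Omega>)"
    proof (intro exI conjI)
      have sq: "abs_sq (\<lambda>x::'a. complex_of_real (1 / sqrt (measure lebesgue \<Omega>))) = (\<lambda>x. 1 / measure
        lebesgue \<Omega>)"
        using measure_pos[OF ne] by (simp add: abs_sq_def[abs_def] norm_divide power_divide)
      show "L2_tendsto \<Omega> (\<lambda>\<beta>. abs_sq (\<phi>\<^sub>g \<beta>)) (abs_sq (\<lambda>x. complex_of_real (1 / sqrt (measure lebesgue
        \<Omega>)))) at_top"
        unfolding sq by (rule ground_state_L2_tendsto[OF ne assms(5) smalloD_tendsto[OF small] g])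
      show "AE x in lebesgue_on \<Omega>. abs_sq (\<lambda>x. complex_of_real (1 / sqrt (measure lebesgue \<Omega>))) x
          = 1 / measure lebesgue \<Omega>"
        unfolding sq by simp
    qed (rule uniform_state_unique_minimizer[OF ne])
  next
    fix d :: real assume d: "d > 0" "((\<lambda>\<beta>. \<delta> \<beta> / \<beta>) \<longlongrightarrow> d) at_top"
    show "\<exists>\<rho>_inf. unique_minimizer \<Omega> (E_bd_plus \<Omega> d) (admissible_density \<Omega>) (nonneg_fun \<Omega>) \<rho>_inf \<and>
        H1_tendsto \<Omega> (\<lambda>\<beta>. abs_sq (\<phi>\<^sub>g \<beta>)) \<rho>_inf at_top \<and>
        (\<exists>L. has_weak_laplacian \<Omega> \<rho>_inf L \<and>
           (AE x in lebesgue_on \<Omega>. \<rho>_inf x - d * L x = 2 * E_bd_plus \<Omega> d \<rho>_inf)) \<and>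
        H10 \<Omega> \<rho>_inf"
    proof -
      \<comment> \<open>The quotient is one only eventually, because \<open>0 / 0 = 0\<close>; here
        the scale is \<open>\<mu> = \<beta>\<close> with \<open>s = 1\<close> and
        \<open>t = d\<close>.\<close>
      have "\<forall>\<^sub>F \<beta>::real in at_top. \<beta> / \<beta> = 1"
        using eventually_gt_at_top[of 0] by eventually_elim simp
      then have S: "((\<lambda>\<beta>::real. \<beta> / \<beta>) \<longlongrightarrow> 1) at_top" by (rule tendsto_eventually)
      show ?thesis
      proof (rule limit_density[OF ne zero_le_one d(1) _ filterlim_ident S d(2) g])
        show "E_bd_plus \<Omega> d u = 1/2 * form 1 d u u" if "H10 \<Omega> u" for u
          by (rule E_bd_plus_eq_form[OF that])
      next
        fix w L
        assume "unique_minimizer \<Omega> (E_bd_plus \<Omega> d) (admissible_density \<Omega>) (nonneg_fun \<Omega>) w"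
          "H1_tendsto \<Omega> (\<lambda>\<beta>. abs_sq (\<phi>\<^sub>g \<beta>)) w at_top" "has_weak_laplacian \<Omega> w L"
          "\<And>x. 1 * w x - d * L x = 2 * E_bd_plus \<Omega> d w" "H10 \<Omega> w"
        then show ?thesis by (intro exI[of _ w] conjI exI[of _ L]) auto
      qed
    qed
  next
    assume "filterlim \<delta> at_top at_top \<and> (\<lambda>\<beta>. \<beta>) \<in> o[at_top](\<delta>)"
    then have \<delta>: "filterlim \<delta> at_top at_top" "(\<lambda>\<beta>. \<beta>) \<in> o[at_top](\<delta>)" by simp_all
    show "\<exists>\<rho>_inf. unique_minimizer \<Omega> (E_d \<Omega>) (admissible_density \<Omega>) (nonneg_fun \<Omega>) \<rho>_inf \<and>
        H1_tendsto \<Omega> (\<lambda>\<beta>. abs_sq (\<phi>\<^sub>g \<beta>)) \<rho>_inf at_top \<and>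
        (\<exists>L. has_weak_laplacian \<Omega> \<rho>_inf L \<and> (AE x in lebesgue_on \<Omega>. - L x = 2 * E_d \<Omega> \<rho>_inf)) \<and>
        H10 \<Omega> \<rho>_inf"
    proof -
      \<comment> \<open>Here the scale is \<open>\<mu> = \<delta>\<close>, with \<open>s = 0\<close>
        and \<open>t = 1\<close>; eventual positivity of \<delta> rules out division by
        zero.\<close>
      have "\<forall>\<^sub>F \<beta> in at_top. \<delta> \<beta> / \<delta> \<beta> = 1"
        using assms(5) by eventually_elim simp
      then have T: "((\<lambda>\<beta>. \<delta> \<beta> / \<delta> \<beta>) \<longlongrightarrow> 1) at_top" by (rule tendsto_eventually)
      show ?thesis
      proof (rule limit_density[OF ne order_refl zero_less_one _ \<delta>(1) smalloD_tendsto[OF \<delta>(2)] T g])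
        show "E_d \<Omega> u = 1/2 * form 0 1 u u" if "H10 \<Omega> u" for u
          by (rule E_d_eq_form[OF that])
      next
        fix w L
        assume "unique_minimizer \<Omega> (E_d \<Omega>) (admissible_density \<Omega>) (nonneg_fun \<Omega>) w"
          "H1_tendsto \<Omega> (\<lambda>\<beta>. abs_sq (\<phi>\<^sub>g \<beta>)) w at_top" "has_weak_laplacian \<Omega> w L"
          "\<And>x. 0 * w x - 1 * L x = 2 * E_d \<Omega> w" "H10 \<Omega> w"
        then show ?thesis by (intro exI[of _ w] conjI exI[of _ L]) auto
      qed
    qed
  qed
qed


end
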